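(* Let $n\ge4$ and let $I_n$ be the ideal of all $f\in\mathbb C[x_1,\dots,x_n]^{\mathfrak S_n}$ such that $f(x,x,y,y,x_5,\dots,x_n)=0$ identically. Then the minimal degree of the generators of $I_n$ (equivalently, the minimal degree of a nonzero homogeneous element of $I_n$) is $M(n)=(n-1)(n-3)=n^2-4n+3$. The corresponding generator, unique up to a scalar multiple, is the Jack polynomial $P_\lambda(x,\theta)$ at $\theta=-\tfrac12$ with $\lambda=(2n-5,2n-7,\dots,5,3,0,0,0)$ (this Jack polynomial being well defined at $\theta=-\frac12$). Moreover, the polynomial $$Q(x)=\operatorname{Symm}\left(\prod_{j=4}^n(x_1-x_j)(x_2-x_j)(x_3-x_j)\prod_{4\le k<l\le n}(x_k-x_l)^2\right)$$ belongs to $I_n$, has degree $M(n)$, and coincides up to a multiple with this Jack polynomial.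
   Context: $\operatorname{Symm}$ denotes symmetrization over $\mathfrak S_n$ acting by permuting $x_1,\dots,x_n$. Degree is total degree in $x_1,\dots,x_n$. $P_\lambda(x,\theta)$ is the (monic) Jack polynomial in $n$ variables with parameter $\theta=\alpha^{-1}$, $\alpha$ being the parameter in Macdonald's book, i.e. $P_\lambda(x,\theta)=\lim_{q\to1}P_\lambda(x;q,q^\theta)$ with $P_\lambda(x;q,t)$ the Macdonald polynomial; its coefficients are rational functions of $\theta$, and "well defined at $\theta=-\frac12$" means they have no pole there. The partition $\lambda$ has $n$ parts: the $n-3$ odd numbers from $2n-5$ down to $3$, followed by three zeros. *)

theory Defs
  imports
    "HOL-Analysis.Analysis"
    "HOL-Library.Poly_Mapping"
    "HOL-Combinatorics.Permutations"
    "HOL-Computational_Algebra.Polynomial"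
    "HOL-Algebra.Ideal"
begin

section \<open>Multivariate polynomials\<close>

text \<open>
  Monomials are finitely supported exponent vectors and polynomials are finitely supported
  coefficient functions on monomials; the product of the library is the convolution, that is,
  polynomial multiplication. The variables are indexed from 1, so polynomials in
  \<open>x\<^sub>1, \<dots>, x\<^sub>n\<close> are those all of whose monomials are supported in \<open>{1..n}\<close>.
\<close>

type_synonym monomial = "nat \<Rightarrow>\<^sub>0 nat"
type_synonym mpoly = "monomial \<Rightarrow>\<^sub>0 complex"

definition var :: "nat \<Rightarrow> mpoly" where
  "var i = Poly_Mapping.single (Poly_Mapping.single i 1) 1"

definition cscale :: "complex \<Rightarrow> mpoly \<Rightarrow> mpoly" where
  "cscale c f = Poly_Mapping.single 0 c * f"

definition meval :: "mpoly \<Rightarrow> (nat \<Rightarrow> complex) \<Rightarrow> complex" where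
  "meval f x = (\<Sum>m\<in>Poly_Mapping.keys f.
      Poly_Mapping.lookup f m * (\<Prod>i\<in>Poly_Mapping.keys m. x i ^ Poly_Mapping.lookup m i))"

definition mon_degree :: "monomial \<Rightarrow> nat" where
  "mon_degree m = (\<Sum>i\<in>Poly_Mapping.keys m. Poly_Mapping.lookup m i)"

definition total_degree :: "mpoly \<Rightarrow> nat" where
  "total_degree f = Max (insert 0 (mon_degree ` Poly_Mapping.keys f))"

definition homogeneous :: "nat \<Rightarrow> mpoly \<Rightarrow> bool" where
  "homogeneous d f \<longleftrightarrow> (\<forall>m\<in>Poly_Mapping.keys f. mon_degree m = d)"

definition mpolys :: "nat \<Rightarrow> mpoly set" where
  "mpolys n = {f. \<forall>m\<in>Poly_Mapping.keys f. Poly_Mapping.keys m \<subseteq> {1..n}}"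

section \<open>Symmetric polynomials and the ideal\<close>

text \<open>
  For injective \<open>s\<close>, \<open>map_key s\<close> is precomposition with \<open>s\<close>. Hence for a permutation \<open>s\<close> the
  coefficient of \<open>perm_poly s f\<close> at \<open>m\<close> is the coefficient of \<open>f\<close> at \<open>m \<circ> s\<close>, which means that
  \<open>perm_poly s\<close> replaces each variable \<open>x\<^sub>i\<close> by \<open>x\<^bsub>s i\<^esub>\<close>.
\<close>

definition perm_poly :: "(nat \<Rightarrow> nat) \<Rightarrow> mpoly \<Rightarrow> mpoly" where
  "perm_poly s f = Poly_Mapping.map_key (Poly_Mapping.map_key s) f"

definition Symm :: "nat \<Rightarrow> mpoly \<Rightarrow> mpoly" where
  "Symm n f = (\<Sum>s | s permutes {1..n}. perm_poly s f)"

definition sym_polys :: "nat \<Rightarrow> mpoly set" where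
  "sym_polys n = {f \<in> mpolys n. \<forall>s. s permutes {1..n} \<longrightarrow> perm_poly s f = f}"

definition sym_ring :: "nat \<Rightarrow> mpoly ring" where
  "sym_ring n = \<lparr>carrier = sym_polys n, monoid.mult = (*), one = 1, zero = 0, add = (+)\<rparr>"

definition ideal_I :: "nat \<Rightarrow> mpoly set" where
  "ideal_I n = {f \<in> sym_polys n. \<forall>x. meval f (x(2 := x 1, 4 := x 3)) = 0}"

section \<open>Macdonald polynomials\<close>

text \<open>A partition with at most \<open>n\<close> nonzero parts is a list of length \<open>n\<close>, padded with zeros.\<close>

definition is_partition :: "nat \<Rightarrow> nat list \<Rightarrow> bool" where
  "is_partition n mu \<longleftrightarrow> length mu = n \<and> sorted_wrt (\<ge>) mu"

definition dominated :: "nat list \<Rightarrow> nat list \<Rightarrow> bool" where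
  "dominated mu lam \<longleftrightarrow> sum_list mu = sum_list lam \<and>
     (\<forall>k. sum_list (take k mu) \<le> sum_list (take k lam))"

definition msym :: "nat \<Rightarrow> nat list \<Rightarrow> mpoly" where
  "msym n mu = (\<Sum>m | Poly_Mapping.keys m \<subseteq> {1..n} \<and>
       mset (map (Poly_Mapping.lookup m) [1..<Suc n]) = mset mu. Poly_Mapping.single m 1)"

text \<open>
  Macdonald's \<open>q\<close>-difference operator \<open>D\<^sub>n\<^sup>1\<close>. It acts on functions and is meaningful at the points
  with pairwise distinct coordinates.
\<close>

definition macdonald_op ::
    "nat \<Rightarrow> complex \<Rightarrow> complex \<Rightarrow> ((nat \<Rightarrow> complex) \<Rightarrow> complex) \<Rightarrow> (nat \<Rightarrow> complex) \<Rightarrow> complex" where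
  "macdonald_op n q t F x =
     (\<Sum>i\<in>{1..n}. (\<Prod>j\<in>{1..n} - {i}. (t * x i - x j) / (x i - x j)) * F (x(i := q * x i)))"

text \<open>
  \<open>P\<^sub>\<lambda>(x;q,t)\<close> is the eigenfunction of \<open>D\<^sub>n\<^sup>1\<close> of the form \<open>m\<^sub>\<lambda>\<close> plus lower terms. The eigenvalues
  belonging to \<open>\<lambda>\<close> and to the \<open>\<mu> < \<lambda>\<close> differ for generic parameters, in particular for
  \<open>0 < q < 1\<close> and \<open>t = q\<^sup>\<theta>\<close> with \<open>\<theta> > 0\<close>, and these are the only values used below.
\<close>

definition is_macdonald :: "nat \<Rightarrow> complex \<Rightarrow> complex \<Rightarrow> nat list \<Rightarrow> mpoly \<Rightarrow> bool" where
  "is_macdonald n q t lam P \<longleftrightarrow>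
     (\<exists>u. P = msym n lam +
        (\<Sum>mu | is_partition n mu \<and> dominated mu lam \<and> mu \<noteq> lam. cscale (u mu) (msym n mu))) \<and>
     (\<forall>x. inj_on x {1..n} \<longrightarrow>
        macdonald_op n q t (meval P) x = (\<Sum>i\<in>{1..n}. t ^ (n - i) * q ^ (lam ! (i - 1))) * meval P x)"

definition macdonald :: "nat \<Rightarrow> complex \<Rightarrow> complex \<Rightarrow> nat list \<Rightarrow> mpoly" where
  "macdonald n q t lam = (THE P. is_macdonald n q t lam P)"

section \<open>Jack polynomials\<close>

text \<open>
  \<open>jack_coeff_fraction n lam m a b\<close>: the rational function \<open>a(\<theta>) / b(\<theta>)\<close> is the coefficient of
  the monomial \<open>m\<close> in \<open>P\<^sub>\<lambda>(x,\<theta>) = lim\<^bsub>q\<rightarrow>1\<^esub> P\<^sub>\<lambda>(x;q,q\<^sup>\<theta>)\<close>. The limit is taken for real \<open>\<theta> > 0\<close>,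
  which is enough to determine the rational function; it is then evaluated at other \<open>\<theta>\<close>.
\<close>

definition jack_coeff_fraction ::
    "nat \<Rightarrow> nat list \<Rightarrow> monomial \<Rightarrow> complex poly \<Rightarrow> complex poly \<Rightarrow> bool" where
  "jack_coeff_fraction n lam m a b \<longleftrightarrow> b \<noteq> 0 \<and>
     (\<forall>\<theta>::real. \<theta> > 0 \<and> poly b (complex_of_real \<theta>) \<noteq> 0 \<longrightarrow>
        ((\<lambda>q::real. Poly_Mapping.lookup
             (macdonald n (complex_of_real q) (complex_of_real (q powr \<theta>)) lam) m)
          \<longlongrightarrow> poly a (complex_of_real \<theta>) / poly b (complex_of_real \<theta>)) (at_left 1))"

definition jack_well_defined :: "nat \<Rightarrow> nat list \<Rightarrow> complex \<Rightarrow> bool" where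
  "jack_well_defined n lam \<theta>0 \<longleftrightarrow>
     (\<forall>m. \<exists>a b. jack_coeff_fraction n lam m a b \<and> poly b \<theta>0 \<noteq> 0)"

definition jack :: "nat \<Rightarrow> nat list \<Rightarrow> complex \<Rightarrow> mpoly" where
  "jack n lam \<theta>0 = (THE J. \<forall>m. \<exists>a b. jack_coeff_fraction n lam m a b \<and> poly b \<theta>0 \<noteq> 0 \<and>
     Poly_Mapping.lookup J m = poly a \<theta>0 / poly b \<theta>0)"

section \<open>The objects of the theorem\<close>

definition min_deg :: "nat \<Rightarrow> nat" where
  "min_deg n = (n - 1) * (n - 3)"

definition jack_lambda :: "nat \<Rightarrow> nat list" where
  "jack_lambda n = map (\<lambda>i. 2 * (n - i) - 3) [1..<n - 2] @ [0, 0, 0]"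

definition Q_poly :: "nat \<Rightarrow> mpoly" where
  "Q_poly n = Symm n
     ((\<Prod>j\<in>{4..n}. (var 1 - var j) * (var 2 - var j) * (var 3 - var j)) *
      (\<Prod>(k, l)\<in>{(k, l). 4 \<le> k \<and> k < l \<and> l \<le> n}. (var k - var l) ^ 2))"

end

(*
  Lower bound and uniqueness: restrict f in I_n to x_1 = x_2, then to x_1 = x_2 = x_3 = x. Symmetry
  makes the first restriction divisible by all (x_k - x_l)^2 with k, l >= 3. Since (d_1 - 2 d_3) of it
  vanishes at x_3 = x_1, the second restriction is divisible by (x - x_j)^3 for j >= 4, hence by a
  product of degree (n - 1)(n - 3). If the second restriction is zero, then f has a larger degree.

  Identification with the Jack polynomial: multiplied by the Vandermonde polynomial, Macdonald's
  eigenvalue equation is a linear system that is triangular for the dominance order. Divided by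
  (1 - q)^2 it converges for q -> 1, the limit being polynomial in theta; its pivots are differences of
  eigenvalues, which vanish neither for theta > 0 nor, for the given lambda, at theta = -1/2. A Hessian
  computation on the locus x_1 = x_2, x_3 = x_4 shows that the limit operator at theta = -1/2
  preserves I_n. So Q, which spans the part of I_n of minimal degree and has leading monomial
  x^lambda, is an eigenvector and solves the same triangular system as the Jack polynomial.
*)
theory Submission
  imports Defs "HOL-Real_Asymp.Real_Asymp"
begin

section \<open>Polynomials, renaming of variables and Euler derivations\<close>

text \<open>The obstacle is that Macdonald's operator and its limit have their poles exactly on the
  diagonals that define the ideal. Multiplied by the Vandermonde polynomial V, the limit becomes a
  bilinear expression \<open>Phi\<close> in V and f, which is polynomial and, for symmetric f, again
  a multiple of V. Since V vanishes to second order on the locus, the quotient is read off there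
  from a single mixed second derivative. The cross term of \<open>Phi\<close> contributes 2 \<theta>
  times what the term V D_i^2 f contributes, so the condition 2 \<theta> + 1 = 0 singles out
  \<theta> = -1/2.

  The scale (1 - q)^2 is forced: for partitions of one size the eigenvalues agree at q = 1, and
  their first derivatives there depend only on n, \<theta> and the size. Differences therefore start
  at second order, with half the difference of the sums of (\<theta> \<delta>_i + \<mu>_i)^2.

  The degree bound is tight by one: a nonzero restriction to three equal variables costs (n - 1)(n -
  3), while a vanishing one costs at least (n - 2)^2 = (n - 1)(n - 3) + 1.\<close>

abbreviation lookup where "lookup \<equiv> Poly_Mapping.lookup"
abbreviation keys where "keys \<equiv> Poly_Mapping.keys"
abbreviation single where "single \<equiv> Poly_Mapping.single"

lemma additive_zero:
  fixes L :: "'a::monoid_add \<Rightarrow> 'b::group_add"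
  assumes "\<And>f g. L (f + g) = L f + L g"
  shows "L 0 = 0"
  using assms[of 0 0] by (metis add.right_neutral add_left_cancel)

lemma additive_sum:
  fixes L :: "'a::comm_monoid_add \<Rightarrow> 'b::ab_group_add"
  assumes "\<And>f g. L (f + g) = L f + L g"
  shows "L (sum F A) = (\<Sum>a\<in>A. L (F a))"
  using assms additive_zero[of L] by (induction A rule: infinite_finite_induct) auto

lemma poly_mapping_eq_sum_single:
  fixes f :: "'a \<Rightarrow>\<^sub>0 'b::comm_monoid_add"
  shows "f = (\<Sum>m\<in>keys f. single m (lookup f m))"
proof (rule poly_mapping_eqI)
  fix N
  show "lookup f N = lookup (\<Sum>m\<in>keys f. single m (lookup f m)) N"
    by (simp add: lookup_sum lookup_single when_def in_keys_iff sum.delta)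
qed

lemma poly_mapping_additive_induct [case_names zero add single]:
  fixes f :: "'a \<Rightarrow>\<^sub>0 'b::comm_monoid_add"
  assumes z: "P 0" and a: "\<And>f g. P f \<Longrightarrow> P g \<Longrightarrow> P (f + g)" and s: "\<And>m c. P (single m c)"
  shows "P f"
proof -
  have "P (\<Sum>m\<in>A. single m (lookup f m))" if "finite A" for A
    using that by (induction A) (auto intro: assms)
  then show ?thesis using poly_mapping_eq_sum_single[of f] by (metis finite_keys)
qed

text \<open>Both sides are biadditive, so products of single terms decide. \<open>meval\<close> and
  \<open>ren\<close> obtain their multiplicativity from here.\<close>

lemma additive_multiplicative:
  fixes L :: "('a::monoid_add \<Rightarrow>\<^sub>0 'b::comm_ring_1) \<Rightarrow> 'c::ring_1"
  assumes a: "\<And>f g. L (f + g) = L f + L g"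
    and s: "\<And>m c k d. L (single m c * single k d) = L (single m c) * L (single k d)"
  shows "L (f * g) = L f * L g"
proof -
  have z: "L 0 = 0" using a by (rule additive_zero)
  have 1: "L (single m c * g) = L (single m c) * L g" for m c g
    by (induction g rule: poly_mapping_additive_induct) (auto simp: z a s algebra_simps)
  show ?thesis
    by (induction f rule: poly_mapping_additive_induct) (auto simp: z a 1 algebra_simps)
qed

text \<open>Constants and variables generate the polynomial ring, so identities between
  homomorphisms or derivations are checked on generators, with the product rule as induction
  step.\<close>

lemma mpoly_induct [case_names const var add mult]:
  assumes "\<And>c. P (single 0 c)" and "\<And>i. P (var i)"
    and a: "\<And>f g. P f \<Longrightarrow> P g \<Longrightarrow> P (f + g)" and m: "\<And>f g. P f \<Longrightarrow> P g \<Longrightarrow> P (f * g)"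
  shows "P (f :: mpoly)"
proof (induction f rule: poly_mapping_additive_induct)
  case zero
  then show ?case using assms(1)[of 0] by simp
next
  case (add f g)
  then show ?case by (rule a)
next
  case (single m c)
  have pw: "P (single (single i k) 1)" for i k
  proof (induction k)
    case 0
    then show ?case using assms(1)[of 1] by simp
  next
    case (Suc k)
    have "single (single i (Suc k)) (1::complex) = var i * single (single i k) 1"
      by (simp add: var_def mult_single flip: single_add)
    then show ?case using m[OF assms(2)[of i] Suc] by simp
  qed
  show ?case
  proof (induction m rule: poly_mapping_additive_induct)
    case zero
    then show ?case by (rule assms(1))
  next
    case (add f g)
    have "single (f + g) c = single f 1 * single g c" by (simp add: mult_single)
    moreover have "P (single f 1)"
    proof (induction f rule: poly_mapping_additive_induct)
      case zero
      then show ?case by (rule assms(1))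
    next
      case (add f g)
      then have "P (single f 1 * single g 1)" by (intro m)
      then show ?case by (simp add: mult_single)
    next
      case (single i k)
      then show ?case by (rule pw)
    qed
    ultimately show ?case using add m by metis
  next
    case (single i k)
    have "single (single i k) c = single 0 c * single (single i k) 1" by (simp add: mult_single)
    then show ?case using m[OF assms(1)[of c] pw[of i k]] by simp
  qed
qed

lemma var_neq_zero [simp]: "var i \<noteq> 0"
  by (metis lookup_single_eq lookup_zero var_def zero_neq_one)

lemma var_eq_iff [simp]: "var i = var j \<longleftrightarrow> i = j"
proof
  assume "var i = var j"
  then have "lookup (var i) (single i 1) = lookup (var j) (single i 1)" by simp
  then have "single j 1 = single i (1::nat)" by (simp add: var_def lookup_single when_def split: if_splits)
  then have "lookup (single j 1) i = lookup (single i (1::nat)) i" by simp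
  then show "i = j" by (simp add: lookup_single when_def split: if_splits)
qed simp

subsection \<open>Evaluation\<close>

definition mon_eval :: "monomial \<Rightarrow> (nat \<Rightarrow> complex) \<Rightarrow> complex" where
  "mon_eval m x = (\<Prod>i\<in>keys m. x i ^ lookup m i)"

lemma mon_eval_superset:
  assumes "finite A" "keys m \<subseteq> A"
  shows "mon_eval m x = (\<Prod>i\<in>A. x i ^ lookup m i)"
  unfolding mon_eval_def using assms by (intro prod.mono_neutral_left) (auto simp: in_keys_iff)

lemma mon_eval_zero [simp]: "mon_eval 0 x = 1"
  by (simp add: mon_eval_def)

lemma mon_eval_single [simp]: "mon_eval (single i k) x = x i ^ k"
  by (simp add: mon_eval_def)

lemma mon_eval_add: "mon_eval (m + k) x = mon_eval m x * mon_eval k x"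
proof -
  let ?A = "keys m \<union> keys k"
  have "keys (m + k) \<subseteq> ?A" by (rule keys_add)
  then show ?thesis
    by (subst (1 2 3) mon_eval_superset[of ?A]) (auto simp: lookup_add power_add prod.distrib)
qed

lemma meval_add: "meval (f + g) x = meval f x + meval g x"
  unfolding meval_def by (rule setsum_keys_plus_distrib) (auto simp: algebra_simps)

lemma meval_single [simp]: "meval (single m c) x = c * mon_eval m x"
  unfolding meval_def mon_eval_def by (cases "c = 0") auto

lemma meval_zero [simp]: "meval 0 x = 0"
  by (simp add: meval_def)

lemma meval_mult: "meval (f * g) x = meval f x * meval g x"
  by (rule additive_multiplicative) (auto simp: meval_add mult_single mon_eval_add)

lemma meval_uminus [simp]: "meval (- f) x = - meval f x"
  by (metis add.right_inverse add_eq_0_iff meval_add meval_zero)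

lemma meval_diff [simp]: "meval (f - g) x = meval f x - meval g x"
  by (metis diff_conv_add_uminus meval_add meval_uminus)

lemma meval_var [simp]: "meval (var i) x = x i"
  by (simp add: var_def)

lemma meval_one [simp]: "meval 1 x = 1"
  by (metis meval_single mon_eval_zero mult_1 single_one)

lemma meval_prod: "meval (prod F A) x = (\<Prod>a\<in>A. meval (F a) x)"
  by (induction A rule: infinite_finite_induct) (auto simp: meval_mult)

lemma mon_eval_mult_arg: "mon_eval m (\<lambda>i. x i * y i) = mon_eval m x * mon_eval m y"
  by (simp add: mon_eval_def power_mult_distrib prod.distrib)

lemma mon_eval_separates:
  assumes "m \<noteq> k"
  obtains x where "mon_eval m x \<noteq> mon_eval k x"
proof -
  obtain i where i: "lookup m i \<noteq> lookup k i"
    using assms by (metis poly_mapping_eqI)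
  \<comment> \<open>One coordinate 2 and all others 1 isolate the exponent of x_i as a power of 2;
    norms make these powers comparable as reals.\<close>
  let ?x = "(\<lambda>_. 1)(i := 2)"
  have "mon_eval m ?x = 2 ^ lookup m i" for m
  proof -
    have "mon_eval m ?x = (\<Prod>j\<in>insert i (keys m). ?x j ^ lookup m j)"
      by (rule mon_eval_superset) auto
    also have "\<dots> = (\<Prod>j\<in>{i}. ?x j ^ lookup m j)"
      by (rule prod.mono_neutral_right) auto
    finally show ?thesis by simp
  qed
  then have "norm (mon_eval m ?x) \<noteq> norm (mon_eval k ?x)" using i by (simp add: norm_power)
  then have "mon_eval m ?x \<noteq> mon_eval k ?x" by auto
  then show ?thesis by (rule that)
qed

text \<open>Dedekind's independence of characters, applied to the monomial functions.\<close>

lemma mon_eval_independent: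
  assumes "finite S" "\<And>x. (\<Sum>m\<in>S. c m * mon_eval m x) = 0" "m \<in> S"
  shows "c m = 0"
  using assms
proof (induction S arbitrary: c m rule: finite_induct)
  case (insert k S)
  \<comment> \<open>Evaluating the relation at the product of x and y and subtracting
    \<open>mon_eval k y\<close> times the relation at x cancels the term of
    \<open>k\<close>.\<close>
  have eq: "(\<Sum>m\<in>S. (c m * (mon_eval m y - mon_eval k y)) * mon_eval m x) = 0" for x y
  proof -
    have "(\<Sum>m\<in>S. (c m * (mon_eval m y - mon_eval k y)) * mon_eval m x)
       = (\<Sum>m\<in>insert k S. c m * mon_eval m (\<lambda>i. x i * y i)) - mon_eval k y * (\<Sum>m\<in>insert k S. c m * mon_eval m x)"
      using insert(1,2)
      by (simp add: mon_eval_mult_arg algebra_simps sum_distrib_left sum_subtractf)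
    then show ?thesis using insert.prems(1) by simp
  qed
  have S0: "c m' = 0" if "m' \<in> S" for m'
  proof -
    have "m' \<noteq> k" using that insert(2) by auto
    then obtain y where y: "mon_eval m' y \<noteq> mon_eval k y" by (rule mon_eval_separates)
    have "c m' * (mon_eval m' y - mon_eval k y) = 0"
      using insert.IH[OF eq that] .
    then show ?thesis using y by simp
  qed
  have "c k = 0" using insert.prems(1)[of "\<lambda>_. 1"] insert(1,2) S0
    by (simp add: mon_eval_def)
  then show ?case using S0 insert.prems by auto
qed auto

lemma meval_eq_zeroD:
  assumes "\<And>x. meval f x = 0"
  shows "f = 0"
proof (rule poly_mapping_eqI)
  fix m
  have "lookup f m = 0" if "m \<in> keys f"
    using mon_eval_independent[of "keys f" "lookup f" m] assms that by (auto simp: meval_def mon_eval_def)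
  then show "lookup f m = lookup 0 m" by (auto simp: in_keys_iff)
qed

subsection \<open>Renaming of variables\<close>

text \<open>The map \<open>r\<close> may be non-injective, in which case the exponents of identified
  variables add up. Permutations of variables and restrictions to diagonals thus become instances of
  one ring homomorphism \<open>ren\<close>.\<close>

definition mren :: "(nat \<Rightarrow> nat) \<Rightarrow> monomial \<Rightarrow> monomial" where
  "mren r m = (\<Sum>i\<in>keys m. single (r i) (lookup m i))"

definition ren :: "(nat \<Rightarrow> nat) \<Rightarrow> mpoly \<Rightarrow> mpoly" where
  "ren r f = (\<Sum>m\<in>keys f. single (mren r m) (lookup f m))"

lemma mren_add: "mren r (m + k) = mren r m + mren r k"
  unfolding mren_def by (rule setsum_keys_plus_distrib) (auto simp: single_add)

lemma mren_zero [simp]: "mren r 0 = 0"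
  by (simp add: mren_def)

lemma mren_single [simp]: "mren r (single i k) = single (r i) k"
  by (simp add: mren_def)

lemma ren_add: "ren r (f + g) = ren r f + ren r g"
  unfolding ren_def by (rule setsum_keys_plus_distrib) (auto simp: single_add)

lemma ren_single [simp]: "ren r (single m c) = single (mren r m) c"
  by (simp add: ren_def)

lemma ren_zero [simp]: "ren r 0 = 0"
  by (simp add: ren_def)

lemma ren_one [simp]: "ren r 1 = 1"
  by (metis mren_zero ren_single single_one)

lemma ren_mult: "ren r (f * g) = ren r f * ren r g"
  by (rule additive_multiplicative) (auto simp: ren_add mult_single mren_add)

lemma ren_var [simp]: "ren r (var i) = var (r i)"
  by (simp add: var_def)

lemma ren_sum: "ren r (sum F A) = (\<Sum>a\<in>A. ren r (F a))"
  by (rule additive_sum) (rule ren_add)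

lemma ren_prod: "ren r (prod F A) = (\<Prod>a\<in>A. ren r (F a))"
  by (induction A rule: infinite_finite_induct) (auto simp: ren_mult)

lemma ren_power: "ren r (f ^ k) = ren r f ^ k"
  by (induction k) (auto simp: ren_mult)

lemma ren_uminus [simp]: "ren r (- f) = - ren r f"
  by (metis add.right_inverse add_eq_0_iff ren_add ren_zero)

lemma ren_diff [simp]: "ren r (f - g) = ren r f - ren r g"
  by (metis diff_conv_add_uminus ren_add ren_uminus)

lemma mren_mren: "mren r (mren s m) = mren (r \<circ> s) m"
  by (induction m rule: poly_mapping_additive_induct) (auto simp: mren_add)

lemma ren_ren: "ren r (ren s f) = ren (r \<circ> s) f"
  by (induction f rule: poly_mapping_additive_induct) (auto simp: ren_add mren_mren comp_def)

lemma mren_id [simp]: "mren id m = m"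
  by (induction m rule: poly_mapping_additive_induct) (auto simp: mren_add)

lemma ren_id [simp]: "ren id f = f"
  by (induction f rule: poly_mapping_additive_induct) (auto simp: ren_add simp del: id_apply)

lemma meval_ren: "meval (ren r f) x = meval f (x \<circ> r)"
proof (induction f rule: mpoly_induct)
qed (auto simp: ren_add ren_mult meval_add meval_mult)

lemma lookup_mren_bij:
  assumes "bij s"
  shows "lookup (mren s m) (s i) = lookup m i"
proof (induction m rule: poly_mapping_additive_induct)
  case (single k c)
  then show ?case using assms by (auto simp: lookup_single when_def dest: bij_is_inj injD)
qed (auto simp: mren_add lookup_add)

lemma mren_map_key:
  assumes "bij s"
  shows "mren s (Poly_Mapping.map_key s m) = m"
proof (rule poly_mapping_eqI)
  fix i
  obtain j where j: "i = s j" using assms by (metis bij_pointE)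
  show "lookup (mren s (Poly_Mapping.map_key s m)) i = lookup m i"
    unfolding j lookup_mren_bij[OF assms] using bij_is_inj[OF assms] by (simp add: map_key.rep_eq)
qed

lemma map_key_mren:
  assumes "bij s"
  shows "Poly_Mapping.map_key s (mren s m) = m"
  by (rule poly_mapping_eqI)
    (use assms in \<open>simp add: map_key.rep_eq bij_is_inj lookup_mren_bij\<close>)

lemma mren_inj: "bij s \<Longrightarrow> mren s m = mren s k \<longleftrightarrow> m = k"
  by (metis map_key_mren)

lemma lookup_ren_bij:
  assumes "bij s"
  shows "lookup (ren s f) (mren s m) = lookup f m"
proof (induction f rule: poly_mapping_additive_induct)
  case (single k c)
  then show ?case using assms by (auto simp: lookup_single when_def mren_inj)
qed (auto simp: ren_add lookup_add)

lemma perm_poly_eq_ren: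
  assumes "bij s"
  shows "perm_poly s f = ren s f"
proof (rule poly_mapping_eqI)
  fix m
  have "inj (Poly_Mapping.map_key s :: monomial \<Rightarrow> monomial)"
    by (metis assms injI mren_map_key)
  then have "lookup (perm_poly s f) m = lookup f (Poly_Mapping.map_key s m)"
    by (simp add: perm_poly_def map_key.rep_eq)
  also have "\<dots> = lookup (ren s f) m"
    using lookup_ren_bij[OF assms, of f "Poly_Mapping.map_key s m"] mren_map_key[OF assms] by simp
  finally show "lookup (perm_poly s f) m = lookup (ren s f) m" .
qed

lemma keys_mren_subset: "keys (mren r m) \<subseteq> r ` keys m"
proof -
  have "keys (mren r m) \<subseteq> (\<Union>i\<in>keys m. keys (single (r i) (lookup m i)))"
    unfolding mren_def by (rule keys_sum)
  also have "\<dots> \<subseteq> r ` keys m" by (auto split: if_splits)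
  finally show ?thesis .
qed

lemma keys_ren_subset: "keys (ren r f) \<subseteq> mren r ` keys f"
proof -
  have "keys (ren r f) \<subseteq> (\<Union>i\<in>keys f. keys (single (mren r i) (lookup f i)))"
    unfolding ren_def by (rule keys_sum)
  also have "\<dots> \<subseteq> mren r ` keys f" by (auto split: if_splits)
  finally show ?thesis .
qed

lemma mren_cong: "(\<And>i. i \<in> keys m \<Longrightarrow> r i = s i) \<Longrightarrow> mren r m = mren s m"
  by (simp add: mren_def)

subsection \<open>Euler derivations\<close>

text \<open>This is x_j d/dx_j. Monomials are its eigenvectors, with the exponent of x_j as
  eigenvalue, so it preserves degrees and expresses weights that are polynomial in the
  exponents.\<close>

definition D :: "nat \<Rightarrow> mpoly \<Rightarrow> mpoly" where
  "D j f = (\<Sum>m\<in>keys f. single m (of_nat (lookup m j) * lookup f m))"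

lemma D_add: "D j (f + g) = D j f + D j g"
  unfolding D_def by (rule setsum_keys_plus_distrib) (auto simp: single_add algebra_simps)

lemma D_single [simp]: "D j (single m c) = single m (of_nat (lookup m j) * c)"
  by (cases "c = 0") (auto simp: D_def)

lemma D_zero [simp]: "D j 0 = 0"
  by (simp add: D_def)

lemma D_uminus [simp]: "D j (- f) = - D j f"
  by (metis add.right_inverse add_eq_0_iff D_add D_zero)

lemma D_diff [simp]: "D j (f - g) = D j f - D j g"
  by (metis diff_conv_add_uminus D_add D_uminus)

lemma D_sum: "D j (sum F A) = (\<Sum>a\<in>A. D j (F a))"
  by (rule additive_sum) (rule D_add)

lemma D_mult: "D j (f * g) = D j f * g + f * D j g"
proof (induction f rule: poly_mapping_additive_induct)
  case (single m c)
  show ?case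
    by (induction g rule: poly_mapping_additive_induct)
      (auto simp: D_add mult_single lookup_add algebra_simps simp flip: single_add)
qed (auto simp: D_add algebra_simps)

lemma D_var: "D j (var i) = (if i = j then var i else 0)"
  by (auto simp: var_def lookup_single when_def)

lemma D_const [simp]: "D j (single 0 c) = 0"
  by simp

lemma D_commute: "D i (D j f) = D j (D i f)"
  by (induction f rule: poly_mapping_additive_induct) (auto simp: D_add algebra_simps)

lemma D_ren_bij:
  assumes "bij s"
  shows "D (s j) (ren s f) = ren s (D j f)"
  by (induction f rule: poly_mapping_additive_induct) (auto simp: D_add ren_add lookup_mren_bij[OF assms])

text \<open>The chain rule: on x_b = x_a both variables move together, and each contributes its own
  Euler derivation.\<close>

lemma D_ren_merge:
  assumes "a \<noteq> b"
  shows "D a (ren (id(b := a)) f) = ren (id(b := a)) (D a f + D b f)"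
proof (induction f rule: mpoly_induct)
  case (var i)
  then show ?case using assms by (auto simp: D_var ren_add)
qed (auto simp: D_add ren_add ren_mult D_mult algebra_simps)

lemma D_ren_merge_other:
  assumes "c \<noteq> a" "c \<noteq> b"
  shows "D c (ren (id(b := a)) f) = ren (id(b := a)) (D c f)"
proof (induction f rule: mpoly_induct)
  case (var i)
  then show ?case using assms by (auto simp: D_var ren_add)
qed (auto simp: D_add ren_add ren_mult D_mult algebra_simps)

subsection \<open>Divisibility by differences of variables\<close>

text \<open>The factor theorem, by induction over generators; the product step uses f g - f' g' = f
  (g - g') + (f - f') g'.\<close>

lemma diff_var_dvd_diff_ren: "var a - var b dvd f - ren (id(b := a)) f"
proof (induction f rule: mpoly_induct)
  case (var i)
  show ?case by (cases "i = b") (auto intro: dvdI[of _ _ "-1"])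
next
  case (add f g)
  have "f + g - ren (id(b := a)) (f + g) = (f - ren (id(b := a)) f) + (g - ren (id(b := a)) g)"
    by (simp add: ren_add)
  then show ?case using add by (metis dvd_add)
next
  case (mult f g)
  have "f * g - ren (id(b := a)) (f * g)
     = f * (g - ren (id(b := a)) g) + (f - ren (id(b := a)) f) * ren (id(b := a)) g"
    by (simp add: ren_mult algebra_simps)
  then show ?case using mult by (metis dvd_add dvd_mult dvd_mult2)
qed auto

lemma diff_var_dvd_iff: "var a - var b dvd f \<longleftrightarrow> ren (id(b := a)) f = 0"
proof
  assume "var a - var b dvd f"
  then obtain g where "f = (var a - var b) * g" by (rule dvdE)
  then show "ren (id(b := a)) f = 0" by (simp add: ren_mult)
next
  assume "ren (id(b := a)) f = 0"
  then show "var a - var b dvd f" using diff_var_dvd_diff_ren[of a b f] by simp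
qed

text \<open>Divisibility is the vanishing of a homomorphism into an integral domain, and the kernel
  of such a map is a prime ideal.\<close>

lemma prime_elem_diff_var:
  assumes "a \<noteq> b"
  shows "prime_elem (var a - var b)"
proof (rule prime_elemI)
  show "var a - var b \<noteq> 0" using assms by simp
  show "\<not> var a - var b dvd 1" unfolding diff_var_dvd_iff by simp
  show "var a - var b dvd f \<or> var a - var b dvd g" if "var a - var b dvd f * g" for f g
    using that unfolding diff_var_dvd_iff by (auto simp: ren_mult)
qed

lemma prime_power_dvd_mult_cancel:
  fixes p :: "'a::idom"
  assumes p: "prime_elem p" and "\<not> p dvd u" "p ^ k dvd u * g"
  shows "p ^ k dvd g"
  using assms(3)
proof (induction k arbitrary: g)
  case (Suc k)
  have "p dvd u * g" using Suc.prems by (metis dvd_mult_left power_Suc)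
  then have "p dvd g" using p assms(2) prime_elem_dvd_multD by blast
  then obtain h where h: "g = p * h" by (rule dvdE)
  have "p * p ^ k dvd p * (u * h)" using Suc.prems h by (simp add: mult.left_commute)
  then have "p ^ k dvd u * h" using p by (simp add: prime_elem_def)
  then have "p ^ k dvd h" by (rule Suc.IH)
  then show ?case unfolding h power_Suc by (rule mult_dvd_mono[OF dvd_refl])
qed simp

lemma prime_elem_dvd_prod:
  fixes p :: "'a::comm_semiring_1"
  assumes "finite A" "prime_elem p" "p dvd prod F A"
  obtains i where "i \<in> A" "p dvd F i"
proof -
  have "\<exists>i\<in>A. p dvd F i" using assms
    by (induction A rule: finite_induct) (auto dest: prime_elem_dvd_multD simp: prime_elem_def)
  then show ?thesis using that by blast
qed

text \<open>Takes the place of unique factorization: a prime that divides none of the factors split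
  off so far can be cancelled past their product.\<close>

lemma prod_prime_power_dvd:
  fixes p :: "'i \<Rightarrow> 'a::idom"
  assumes "finite P" "\<And>i. i \<in> P \<Longrightarrow> prime_elem (p i)"
    "\<And>i j. i \<in> P \<Longrightarrow> j \<in> P \<Longrightarrow> i \<noteq> j \<Longrightarrow> \<not> p i dvd p j"
    "\<And>i. i \<in> P \<Longrightarrow> p i ^ e i dvd f"
  shows "(\<Prod>i\<in>P. p i ^ e i) dvd f"
  using assms
proof (induction P rule: finite_induct)
  case (insert i P)
  then obtain g where g: "f = (\<Prod>i\<in>P. p i ^ e i) * g" by (auto elim: dvdE)
  have "\<not> p i dvd (\<Prod>i\<in>P. p i ^ e i)"
  proof
    assume "p i dvd (\<Prod>i\<in>P. p i ^ e i)"
    then obtain j where "j \<in> P" "p i dvd p j ^ e j"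
      using prime_elem_dvd_prod[OF insert.hyps(1)] insert.prems(1)[of i] by auto
    then have "p i dvd p j" using insert.prems(1)[of i] by (meson insertI1 prime_elem_dvd_power)
    then show False using insert.prems(2)[of i j] \<open>j \<in> P\<close> insert.hyps(2) by auto
  qed
  then have "p i ^ e i dvd g"
    using prime_power_dvd_mult_cancel[of "p i" "\<Prod>i\<in>P. p i ^ e i" "e i" g] insert.prems g by auto
  then have "(\<Prod>i\<in>P. p i ^ e i) * p i ^ e i dvd f" unfolding g by (rule mult_dvd_mono[OF dvd_refl])
  then show ?case using insert.hyps by (simp add: mult.commute)
qed simp

declare One_nat_def [simp del]

subsection \<open>Homogeneous polynomials\<close>

lemma mon_degree_add: "mon_degree (m + k) = mon_degree m + mon_degree k"
  unfolding mon_degree_def by (rule setsum_keys_plus_distrib) auto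

lemma mon_degree_zero [simp]: "mon_degree 0 = 0"
  by (simp add: mon_degree_def)

lemma mon_degree_single [simp]: "mon_degree (single i k) = k"
  by (simp add: mon_degree_def)

lemma mon_degree_mren [simp]: "mon_degree (mren r m) = mon_degree m"
  by (induction m rule: poly_mapping_additive_induct) (auto simp: mren_add mon_degree_add)

lemma mon_degree_eq_0_iff [simp]: "mon_degree m = 0 \<longleftrightarrow> m = 0"
  by (auto simp: mon_degree_def in_keys_iff intro: poly_mapping_eqI)

lemma homogeneous_zero [simp]: "homogeneous d 0"
  by (simp add: homogeneous_def)

lemma homogeneous_const [simp]: "homogeneous 0 (single 0 c)"
  by (simp add: homogeneous_def)

lemma homogeneous_one [simp]: "homogeneous 0 1"
  using homogeneous_const[of 1] by simp

lemma homogeneous_add: "homogeneous d f \<Longrightarrow> homogeneous d g \<Longrightarrow> homogeneous d (f + g)"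
  unfolding homogeneous_def using keys_add[of f g] by blast

lemma homogeneous_uminus: "homogeneous d f \<Longrightarrow> homogeneous d (- f)"
  by (simp add: homogeneous_def in_keys_iff)

lemma homogeneous_diff: "homogeneous d f \<Longrightarrow> homogeneous d g \<Longrightarrow> homogeneous d (f - g)"
  by (metis diff_conv_add_uminus homogeneous_add homogeneous_uminus)

lemma homogeneous_sum: "(\<And>a. a \<in> A \<Longrightarrow> homogeneous d (F a)) \<Longrightarrow> homogeneous d (sum F A)"
  by (induction A rule: infinite_finite_induct) (auto intro: homogeneous_add)

lemma homogeneous_mult: "homogeneous d f \<Longrightarrow> homogeneous e g \<Longrightarrow> homogeneous (d + e) (f * g)"
  unfolding homogeneous_def using keys_mult[of f g] by (auto simp: mon_degree_add)

lemma homogeneous_prod: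
  "(\<And>a. a \<in> A \<Longrightarrow> homogeneous (d a) (F a)) \<Longrightarrow> homogeneous (sum d A) (prod F A)"
  by (induction A rule: infinite_finite_induct) (auto intro: homogeneous_mult)

lemma homogeneous_power: "homogeneous d f \<Longrightarrow> homogeneous (k * d) (f ^ k)"
  by (induction k) (auto intro: homogeneous_mult)

lemma homogeneous_var [simp]: "homogeneous (Suc 0) (var i)"
  by (simp add: homogeneous_def var_def)

lemma homogeneous_diff_var_power: "homogeneous k ((var a - var b) ^ k)"
  using homogeneous_power[of "Suc 0" "var a - var b" k] by (simp add: homogeneous_diff)

lemma homogeneous_ren: "homogeneous d f \<Longrightarrow> homogeneous d (ren r f)"
  unfolding homogeneous_def using keys_ren_subset[of r f] by fastforce

lemma homogeneous_0_eq_const: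
  assumes "homogeneous 0 h"
  shows "h = single 0 (lookup h 0)"
proof (rule poly_mapping_eqI)
  fix m
  show "lookup h m = lookup (single 0 (lookup h 0)) m"
    using assms by (cases "m = 0") (auto simp: homogeneous_def lookup_single when_def in_keys_iff)
qed

definition component :: "nat \<Rightarrow> mpoly \<Rightarrow> mpoly" where
  "component d f = (\<Sum>m\<in>keys f. single m (if mon_degree m = d then lookup f m else 0))"

lemma component_add: "component d (f + g) = component d f + component d g"
  unfolding component_def by (rule setsum_keys_plus_distrib) (auto simp: single_add)

lemma component_homogeneous:
  assumes "homogeneous e f"
  shows "component d f = (if d = e then f else 0)"
proof -
  have "component d f = (\<Sum>m\<in>keys f. if d = e then single m (lookup f m) else 0)"
    unfolding component_def using assms by (intro sum.cong) (auto simp: homogeneous_def)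
  then show ?thesis using poly_mapping_eq_sum_single[of f] by auto
qed

lemma homogeneous_component: "homogeneous d (component d f)"
  unfolding component_def by (rule homogeneous_sum) (auto simp: homogeneous_def)

lemma component_mult:
  assumes "homogeneous e g"
  shows "component d (g * h) = (if e \<le> d then g * component (d - e) h else 0)"
proof (induction h rule: poly_mapping_additive_induct)
  case zero
  then show ?case by (simp add: component_def)
next
  case (add f g)
  then show ?case by (auto simp: component_add algebra_simps)
next
  case (single m c)
  have s: "homogeneous (mon_degree m) (single m c)" by (auto simp: homogeneous_def)
  show ?case
    using component_homogeneous[OF homogeneous_mult[OF assms s], of d]
      component_homogeneous[OF s, of "d - e"] by auto
qed

text \<open>Taking the component of degree d of g h replaces h by one of its own components;
  cancelling g shows that h equals that component.\<close>

lemma homogeneous_mult_cancel: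
  assumes "homogeneous d (g * h)" "homogeneous e g" "g * h \<noteq> 0"
  shows "e \<le> d" "homogeneous (d - e) h"
proof -
  have 1: "g * h = (if e \<le> d then g * component (d - e) h else 0)"
    using component_mult[OF assms(2)] component_homogeneous[OF assms(1), of d] by metis
  then show "e \<le> d" using assms(3) by argo
  then have "h = component (d - e) h" using 1 assms(3) by auto
  then show "homogeneous (d - e) h" by (metis homogeneous_component)
qed

lemma homogeneous_dvd_degree_le:
  assumes "g dvd f" "homogeneous d f" "homogeneous e g" "f \<noteq> 0"
  shows "e \<le> d"
  using assms homogeneous_mult_cancel(1) by (metis dvdE)

lemma homogeneous_dvd_eq_cscale:
  assumes "g dvd f" "homogeneous d f" "homogeneous d g"
  obtains c where "f = cscale c g"
proof (cases "f = 0")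
  case True
  then show ?thesis using that[of 0] by (simp add: cscale_def)
next
  case False
  obtain h where h: "f = g * h" using assms(1) by (rule dvdE)
  then have "homogeneous 0 h" using homogeneous_mult_cancel(2)[of d g h d] assms False by simp
  then have "f = cscale (lookup h 0) g"
    using h homogeneous_0_eq_const[of h] by (metis cscale_def mult.commute)
  then show ?thesis by (rule that)
qed

lemma lookup_cscale [simp]: "lookup (cscale c f) m = c * lookup f m"
  unfolding cscale_def mult_map_scale_conv_mult[symmetric]
  by (simp add: Poly_Mapping.map.rep_eq when_def)

lemma cscale_add: "cscale c (f + g) = cscale c f + cscale c g"
  by (simp add: cscale_def algebra_simps)

lemma ren_cscale [simp]: "ren r (cscale c f) = cscale c (ren r f)"
  by (simp add: cscale_def ren_mult)

lemma D_cscale [simp]: "D j (cscale c f) = cscale c (D j f)"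
  by (simp add: cscale_def D_mult)

lemma cscale_cscale [simp]: "cscale c (cscale d f) = cscale (c * d) f"
  by (rule poly_mapping_eqI) simp

lemma cscale_one [simp]: "cscale 1 f = f"
  by (rule poly_mapping_eqI) simp

lemma cscale_eq_0_iff [simp]: "cscale c f = 0 \<longleftrightarrow> c = 0 \<or> f = 0"
proof -
  have "single (0::monomial) c = 0 \<longleftrightarrow> c = 0"
    by (metis lookup_single_eq lookup_zero single_zero)
  then show ?thesis by (simp add: cscale_def)
qed

lemma homogeneous_cscale: "homogeneous d f \<Longrightarrow> homogeneous d (cscale c f)"
  by (auto simp: homogeneous_def in_keys_iff)

lemma total_degree_homogeneous:
  assumes "homogeneous d f" "f \<noteq> 0"
  shows "total_degree f = d"
proof -
  obtain m where "m \<in> keys f" using assms(2) by (metis keys_eq_empty ex_in_conv)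
  then have "mon_degree ` keys f = {d}" using assms(1) by (auto simp: homogeneous_def)
  then show ?thesis by (simp add: total_degree_def)
qed

subsection \<open>Polynomials in finitely many variables, symmetric polynomials\<close>

lemma mpolys_zero [simp]: "0 \<in> mpolys n" and mpolys_const [simp]: "single 0 c \<in> mpolys n"
  by (auto simp: mpolys_def)

lemma mpolys_one [simp]: "1 \<in> mpolys n"
  by (auto simp: mpolys_def)

lemma mpolys_add: "f \<in> mpolys n \<Longrightarrow> g \<in> mpolys n \<Longrightarrow> f + g \<in> mpolys n"
  unfolding mpolys_def using keys_add[of f g] by blast

lemma mpolys_uminus: "f \<in> mpolys n \<Longrightarrow> - f \<in> mpolys n"
  by (auto simp: mpolys_def in_keys_iff)

lemma mpolys_diff: "f \<in> mpolys n \<Longrightarrow> g \<in> mpolys n \<Longrightarrow> f - g \<in> mpolys n"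
  by (metis diff_conv_add_uminus mpolys_add mpolys_uminus)

lemma mpolys_mult:
  assumes "f \<in> mpolys n" "g \<in> mpolys n"
  shows "f * g \<in> mpolys n"
proof -
  have "keys m \<subseteq> {1..n}" if m: "m \<in> keys (f * g)" for m
  proof -
    obtain a b where "m = a + b" "a \<in> keys f" "b \<in> keys g"
      using m keys_mult[of f g] by blast
    then show ?thesis using assms keys_add[of a b] unfolding mpolys_def by blast
  qed
  then show ?thesis by (simp add: mpolys_def)
qed

lemma mpolys_var: "i \<in> {1..n} \<Longrightarrow> var i \<in> mpolys n"
  by (auto simp: mpolys_def var_def)

lemma mpolys_sum: "(\<And>a. a \<in> A \<Longrightarrow> F a \<in> mpolys n) \<Longrightarrow> sum F A \<in> mpolys n"
  by (induction A rule: infinite_finite_induct) (auto intro: mpolys_add)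

lemma mpolys_prod: "(\<And>a. a \<in> A \<Longrightarrow> F a \<in> mpolys n) \<Longrightarrow> prod F A \<in> mpolys n"
  by (induction A rule: infinite_finite_induct) (auto intro: mpolys_mult)

lemma mpolys_power: "f \<in> mpolys n \<Longrightarrow> f ^ k \<in> mpolys n"
  by (induction k) (auto intro: mpolys_mult)

lemma mpolys_ren_into:
  assumes "r ` keys' \<subseteq> {1..n}" "\<And>m. m \<in> keys f \<Longrightarrow> keys m \<subseteq> keys'"
  shows "ren r f \<in> mpolys n"
proof -
  have "keys m \<subseteq> {1..n}" if m: "m \<in> keys (ren r f)" for m
  proof -
    obtain k where "k \<in> keys f" "m = mren r k" using m keys_ren_subset[of r f] by auto
    then show ?thesis using keys_mren_subset[of r k] assms by blast
  qed
  then show ?thesis by (simp add: mpolys_def)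
qed

lemma ren_cong_keys:
  assumes "\<And>m i. m \<in> keys f \<Longrightarrow> i \<in> keys m \<Longrightarrow> r i = s i"
  shows "ren r f = ren s f"
  unfolding ren_def using assms mren_cong[of _ r s] by (intro sum.cong) auto

lemma ren_cong_mpolys:
  assumes "f \<in> mpolys n" "\<And>i. i \<in> {1..n} \<Longrightarrow> r i = s i"
  shows "ren r f = ren s f"
  using assms unfolding mpolys_def by (intro ren_cong_keys) blast

text \<open>Sending every variable outside 1..n to x_1 fixes g and g h, hence also h, while its
  image always lies in \<open>mpolys n\<close>.\<close>

lemma mpolys_mult_cancel:
  assumes "g * h \<in> mpolys n" "g \<in> mpolys n" "g \<noteq> 0" "n \<ge> 1"
  shows "h \<in> mpolys n"
proof -
  define r where "r i = (if i \<in> {1..n} then i else 1)" for i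
  have fix_r: "ren r f = f" if "f \<in> mpolys n" for f
    using ren_cong_mpolys[OF that, of r id] by (simp add: r_def)
  have "g * ren r h = g * h" using fix_r[OF assms(1)] fix_r[OF assms(2)] by (simp add: ren_mult)
  then have "ren r h = h" using assms(3) by simp
  moreover have "ren r h \<in> mpolys n"
    by (rule mpolys_ren_into[of r UNIV]) (use assms(4) in \<open>auto simp: r_def\<close>)
  ultimately show ?thesis by simp
qed

lemma perm_poly_permutes: "s permutes {1..n} \<Longrightarrow> perm_poly s f = ren s f"
  by (simp add: perm_poly_eq_ren permutes_bij)

lemma mpolys_ren_permutes:
  assumes "s permutes {1..n}" "f \<in> mpolys n"
  shows "ren s f \<in> mpolys n"
  by (rule mpolys_ren_into[of s "{1..n}"]) (use assms in \<open>auto simp: mpolys_def permutes_image\<close>)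

lemma sym_polys_iff:
  "f \<in> sym_polys n \<longleftrightarrow> f \<in> mpolys n \<and> (\<forall>s. s permutes {1..n} \<longrightarrow> ren s f = f)"
  by (auto simp: sym_polys_def perm_poly_permutes)

lemma sym_polys_ren: "f \<in> sym_polys n \<Longrightarrow> s permutes {1..n} \<Longrightarrow> ren s f = f"
  by (simp add: sym_polys_iff)

lemma ideal_I_iff:
  "f \<in> ideal_I n \<longleftrightarrow> f \<in> sym_polys n \<and> ren (id(2 := 1, 4 := 3)) f = 0"
proof -
  have eq: "x \<circ> id(2 := 1, 4 := 3) = x(2 := x 1, 4 := x 3)" for x :: "nat \<Rightarrow> complex"
    by auto
  have "(\<forall>x. meval f (x(2 := x 1, 4 := x 3)) = 0) \<longleftrightarrow> (\<forall>x. meval (ren (id(2 := 1, 4 := 3)) f) x = 0)"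
    unfolding meval_ren eq ..
  also have "\<dots> \<longleftrightarrow> ren (id(2 := 1, 4 := 3)) f = 0" by (auto intro: meval_eq_zeroD)
  finally show ?thesis by (auto simp: ideal_I_def)
qed

lemma permutes_extend:
  assumes "finite A" "B \<subseteq> A" "inj_on f B" "f ` B \<subseteq> A"
  obtains s where "s permutes A" "\<And>x. x \<in> B \<Longrightarrow> s x = f x"
proof -
  have fB: "finite B" using assms(1,2) by (rule rev_finite_subset)
  have "card (A - B) = card (A - f ` B)"
    using assms fB by (simp add: card_Diff_subset card_image)
  then obtain h where h: "bij_betw h (A - B) (A - f ` B)"
    using assms(1) finite_same_card_bij by (metis finite_Diff)
  define s where "s x = (if x \<in> B then f x else if x \<in> A then h x else x)" for x
  have "bij_betw s (B \<union> (A - B)) (f ` B \<union> (A - f ` B))"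
  proof (rule bij_betw_combine)
    show "bij_betw s B (f ` B)" using assms(3) by (simp add: s_def bij_betw_def inj_on_def)
    show "bij_betw s (A - B) (A - f ` B)" using h by (rule bij_betw_cong[THEN iffD1, rotated]) (auto simp: s_def)
  qed auto
  then have "bij_betw s A A" using assms(2,4) by (simp add: Un_absorb1)
  then have "s permutes A" using assms(2) by (intro bij_imp_permutes) (auto simp: s_def)
  then show ?thesis by (rule that) (simp add: s_def)
qed

section \<open>The lower bound for the degree\<close>

lemma mpoly_eq_uminus_self: "(f :: mpoly) = - f \<Longrightarrow> f = 0"
proof -
  assume "f = - f"
  then have "2 * f = 0" by (metis add.right_inverse mult_2)
  then show "f = 0" by simp
qed

abbreviation swap :: "nat \<Rightarrow> nat \<Rightarrow> nat \<Rightarrow> nat" where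
  "swap \<equiv> Transposition.transpose"

lemma merge_comp_transpose:
  "id(b := a) \<circ> swap a b = id(b := (a::nat))"
  by (auto simp: Transposition.transpose_def)

text \<open>After one factor x_a - x_b is split off a symmetric f, the quotient is antisymmetric in
  the two variables and so vanishes on the diagonal again.\<close>

lemma diff_var_square_dvd:
  assumes "ren (swap a b) f = f" "ren (id(b := a)) f = 0" "a \<noteq> b"
  shows "(var a - var b) ^ 2 dvd f"
proof -
  let ?t = "swap a b"
  obtain g where g: "f = (var a - var b) * g" using assms(2) diff_var_dvd_iff by (metis dvdE)
  have "(var a - var b) * (- ren ?t g) = (var a - var b) * g"
    using assms(1) unfolding g by (simp add: ren_mult algebra_simps)
  then have "- ren ?t g = g" using assms(3) by (metis mult_left_cancel right_minus_eq var_eq_iff)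
  then have "ren (id(b := a)) g = - ren (id(b := a)) (ren ?t g)" by (metis ren_uminus)
  then have "ren (id(b := a)) g = - ren (id(b := a)) g" by (simp add: ren_ren merge_comp_transpose)
  then have "var a - var b dvd g" unfolding diff_var_dvd_iff by (rule mpoly_eq_uminus_self)
  then show ?thesis unfolding g power2_eq_square by (rule mult_dvd_mono[OF dvd_refl])
qed

text \<open>A permutation carries 1, 2, 3, 4 to a, b, c, d. By symmetry it does not change f, and
  after it g factors through the merging of 2 with 1 and of 4 with 3.\<close>

lemma ren_eq_0_of_coincidence:
  assumes f: "f \<in> ideal_I n" and "distinct [a, b, c, d]" "set [a, b, c, d] \<subseteq> {1..n}"
    and g: "g a = g b" "g c = g d"
  shows "ren g f = 0"
proof -
  define p where "p = (id :: nat \<Rightarrow> nat)(1 := a, 2 := b, 3 := c, 4 := d)"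
  have "card {a, b, c, d} = 4" using assms(2) by simp
  then have n: "n \<ge> 4" using assms(3) card_mono[of "{1..n}" "{a, b, c, d}"] by simp
  obtain s where s: "s permutes {1..n}" "\<And>x. x \<in> {1, 2, 3, 4} \<Longrightarrow> s x = p x"
  proof (rule permutes_extend[of "{1..n}" "{1, 2, 3, 4}" p])
    show "inj_on p {1, 2, 3, 4}" using assms(2) by (auto simp: p_def inj_on_def)
  qed (use n assms(3) in \<open>auto simp: p_def\<close>)
  have "s 1 = a" "s 2 = b" "s 3 = c" "s 4 = d" using s(2) by (auto simp: p_def)
  then have "g \<circ> s = g \<circ> s \<circ> id(2 := 1, 4 := 3)" using g by (auto simp: fun_eq_iff)
  moreover have "ren g f = ren (g \<circ> s) f"
    using f s(1) by (metis ideal_I_iff ren_ren sym_polys_ren)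
  ultimately have "ren g f = ren (g \<circ> s) (ren (id(2 := 1, 4 := 3)) f)"
    by (metis ren_ren)
  then show ?thesis using f by (simp add: ideal_I_iff)
qed

lemma diff_var_not_dvd_diff_var:
  assumes "a < b" "c < d" "(a, b) \<noteq> (c, d)"
  shows "\<not> var a - var b dvd var c - var d"
  using assms by (auto simp: diff_var_dvd_iff split: if_splits)

lemma prod_diff_var_power_dvd:
  assumes "finite P" "\<And>a b. (a, b) \<in> P \<Longrightarrow> a < b"
    "\<And>a b. (a, b) \<in> P \<Longrightarrow> (var a - var b) ^ e (a, b) dvd f"
  shows "(\<Prod>p\<in>P. (var (fst p) - var (snd p)) ^ e p) dvd f"
proof (rule prod_prime_power_dvd)
  show "prime_elem (var (fst p) - var (snd p))" if "p \<in> P" for p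
    using that assms(2)[of "fst p" "snd p"] by (intro prime_elem_diff_var) simp
  show "\<not> var (fst p) - var (snd p) dvd var (fst q) - var (snd q)" if "p \<in> P" "q \<in> P" "p \<noteq> q" for p q
    using that assms(2)[of "fst p" "snd p"] assms(2)[of "fst q" "snd q"]
    by (intro diff_var_not_dvd_diff_var) (auto simp: prod_eq_iff)
  show "(var (fst p) - var (snd p)) ^ e p dvd f" if "p \<in> P" for p
    using that assms(3)[of "fst p" "snd p"] by simp
qed (rule assms(1))

definition upper_pairs :: "nat set \<Rightarrow> (nat \<times> nat) set" where
  "upper_pairs A = {(k, l). k \<in> A \<and> l \<in> A \<and> k < l}"

lemma upper_pairs_subset: "upper_pairs A \<subseteq> A \<times> A"
  by (auto simp: upper_pairs_def)

lemma finite_upper_pairs [simp]: "finite A \<Longrightarrow> finite (upper_pairs A)"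
  using finite_subset[OF upper_pairs_subset] by blast

lemma card_upper_pairs:
  assumes "finite A"
  shows "2 * card (upper_pairs A) = card A * (card A - 1)"
proof -
  have "A \<times> A = upper_pairs A \<union> prod.swap ` upper_pairs A \<union> (\<lambda>a. (a, a)) ` A"
    by (auto simp: upper_pairs_def image_iff)
  moreover have "card (upper_pairs A \<union> prod.swap ` upper_pairs A \<union> (\<lambda>a. (a, a)) ` A)
     = card (upper_pairs A) + card (prod.swap ` upper_pairs A) + card ((\<lambda>a. (a, a)) ` A)"
    using assms finite_upper_pairs[OF assms]
    by (subst card_Un_disjoint; (subst card_Un_disjoint)?) (auto simp: upper_pairs_def)
  moreover have "card (prod.swap ` upper_pairs A) = card (upper_pairs A)"
    by (rule card_image) (auto intro: inj_onI)
  moreover have "card ((\<lambda>a. (a, a)) ` A) = card A"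
    by (rule card_image) (auto intro: inj_onI)
  ultimately have "card (A \<times> A) = 2 * card (upper_pairs A) + card A" by simp
  then have "card A * card A = 2 * card (upper_pairs A) + card A"
    by (simp only: card_cartesian_product)
  then show ?thesis by (simp add: diff_mult_distrib2)
qed

definition star_pairs :: "nat \<Rightarrow> nat \<Rightarrow> (nat \<times> nat) set" where
  "star_pairs k n = Pair 1 ` {k..n} \<union> upper_pairs {k..n}"

text \<open>Here x_1 stands for the merged variables and k..n for the remaining ones. The cases (e,
  k) = (3, 4), (1, 3), (2, 2) bound the degrees after merging three variables, two variables and
  none.\<close>

definition star_prod :: "nat \<Rightarrow> nat \<Rightarrow> nat \<Rightarrow> mpoly" where
  "star_prod e k n = (\<Prod>p\<in>star_pairs k n. (var (fst p) - var (snd p)) ^ (if fst p = 1 then e else 2))"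

lemma star_prod_homogeneous:
  assumes "k > 1" "k \<le> Suc n"
  shows "homogeneous ((Suc n - k) * (e + n - k)) (star_prod e k n)"
proof -
  have "homogeneous (\<Sum>p\<in>star_pairs k n. if fst p = 1 then e else 2) (star_prod e k n)"
    unfolding star_prod_def by (rule homogeneous_prod) (rule homogeneous_diff_var_power)
  moreover have "(\<Sum>p\<in>star_pairs k n. if fst p = 1 then e else 2)
     = (\<Sum>p\<in>Pair (1::nat) ` {k..n}. if fst p = 1 then e else 2) + (\<Sum>p\<in>upper_pairs {k..n}. if fst p = 1 then e else 2)"
    unfolding star_pairs_def using assms finite_upper_pairs[of "{k..n}"]
    by (subst sum.union_disjoint) (auto simp: upper_pairs_def)
  moreover have "(\<Sum>p\<in>Pair (1::nat) ` {k..n}. if fst p = 1 then e else 2) = (Suc n - k) * e"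
    by (subst sum.reindex) (auto intro: inj_onI)
  moreover have "(\<Sum>p\<in>upper_pairs {k..n}. if fst p = 1 then e else 2) = (\<Sum>p\<in>upper_pairs {k..n}. 2)"
    using assms by (intro sum.cong) (auto simp: upper_pairs_def)
  moreover have "(\<Sum>p\<in>upper_pairs {k..n}. 2::nat) = (Suc n - k) * (Suc n - k - 1)"
    using card_upper_pairs[of "{k..n}"] by simp
  moreover have "(Suc n - k) * e + (Suc n - k) * (Suc n - k - 1) = (Suc n - k) * (e + n - k)"
  proof (cases "k = Suc n")
    case False
    then obtain c where "n = k + c" using assms(2) by (metis le_SucE le_Suc_ex)
    then show ?thesis by (simp add: algebra_simps)
  qed simp
  ultimately show ?thesis by simp
qed

lemma star_prod_dvd:
  assumes "k > 1" "\<And>j. j \<in> {k..n} \<Longrightarrow> (var 1 - var j) ^ e dvd f"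
    "\<And>i j. k \<le> i \<Longrightarrow> i < j \<Longrightarrow> j \<le> n \<Longrightarrow> (var i - var j) ^ 2 dvd f"
  shows "star_prod e k n dvd f"
  unfolding star_prod_def
  by (rule prod_diff_var_power_dvd[where e = "\<lambda>p. if fst p = 1 then e else 2"])
    (use assms in \<open>auto simp: star_pairs_def simp flip: upper_pairs_def\<close>, auto simp: upper_pairs_def)

lemma ren_numeral [simp]: "ren r (numeral k) = numeral k"
  by (metis mren_zero ren_single single_numeral)

lemma D_numeral [simp]: "D j (numeral k) = 0"
  by (metis D_const single_numeral)

lemma transpose_permutes:
  "a \<in> {1..n} \<Longrightarrow> b \<in> {1..n} \<Longrightarrow> swap a b permutes {1..n::nat}"
  by (rule permutes_swap_id)

section \<open>Restrictions of an element of the ideal to x_1 = x_2 and to x_1 = x_2 = x_3\<close>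

context
  fixes n :: nat and f :: mpoly
  assumes n4: "n \<ge> 4" and f: "f \<in> ideal_I n"
begin

abbreviation (input) "merge12 \<equiv> ren (id(2 := 1)) f"
abbreviation (input) "merge123 \<equiv> ren (id(3 := 1)) (ren (id(2 := 1)) f)"

lemma ideal_I_ren: "s permutes {1..n} \<Longrightarrow> ren s f = f"
  using f unfolding ideal_I_iff by (blast intro: sym_polys_ren)

lemma merge12_transpose:
  assumes "a \<in> {3..n}" "b \<in> {3..n}"
  shows "ren (swap a b) merge12 = merge12"
proof -
  have "swap a b \<circ> id(2 := 1) = id(2 := 1) \<circ> swap a b"
    using assms by (auto simp: fun_eq_iff Transposition.transpose_def)
  then have "ren (swap a b) merge12 = ren (id(2 := 1)) (ren (swap a b) f)"
    by (simp add: ren_ren)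
  then show ?thesis using ideal_I_ren[OF transpose_permutes[of a n b]] assms by simp
qed

text \<open>With x_1 = x_2 already imposed, x_a = x_b is the second coincidence required by the
  ideal; the remaining symmetry doubles the factor.\<close>

lemma merge12_dvd:
  assumes "a \<in> {3..n}" "b \<in> {3..n}" "a \<noteq> b"
  shows "(var a - var b) ^ 2 dvd merge12"
proof (rule diff_var_square_dvd)
  show "ren (id(b := a)) merge12 = 0"
    unfolding ren_ren by (rule ren_eq_0_of_coincidence[OF f, of 1 2 a b]) (use assms in auto)
qed (use assms merge12_transpose in auto)

lemma merge123_dvd:
  assumes "4 \<le> a" "a < b" "b \<le> n"
  shows "(var a - var b) ^ 2 dvd merge123"
proof -
  obtain g where "merge12 = (var a - var b) ^ 2 * g"
    using merge12_dvd[of a b] assms by (auto elim: dvdE)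
  then have "merge123 = (var a - var b) ^ 2 * ren (id(3 := 1)) g"
    using assms by (simp add: ren_mult ren_power)
  then show ?thesis by simp
qed

text \<open>
  At \<open>x\<^sub>1 = x\<^sub>2 = x\<^sub>3\<close> the symmetry of \<open>f\<close> forces \<open>\<partial>\<^sub>1 - 2 \<partial>\<^sub>3\<close> to kill \<open>f(x, x, x\<^sub>3, \<dots>)\<close>. Applied to
  \<open>(x\<^sub>3 - x\<^sub>j)\<^sup>2 h\<close> this shows that \<open>h\<close> has a further factor \<open>x\<^sub>1 - x\<^sub>j\<close>.
\<close>

lemma merge123_dvd_cube:
  assumes j: "j \<in> {4..n}"
  shows "(var 1 - var j) ^ 3 dvd merge123"
proof -
  let ?r = "id(3 := 1) :: nat \<Rightarrow> nat" and ?s = "id(2 := 1) :: nat \<Rightarrow> nat"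
  let ?u = "var 1 - var j"
  obtain h where h: "merge12 = (var 3 - var j) ^ 2 * h"
    using merge12_dvd[of 3 j] j by (auto elim: dvdE)
  \<comment> \<open>The transposition of 1 and a fixes f and is invisible on x_1 = x_2 = x_3, so the
    three derivatives agree there. By the chain rule D 1 of the merged polynomial counts two of them
    and D 3 only one.\<close>
  have Deq: "ren (?r \<circ> ?s) (D a f) = ren (?r \<circ> ?s) (D 1 f)" if "a \<in> {2, 3}" for a
  proof -
    let ?t = "swap 1 a"
    have "bij ?t" by simp
    then have "D (?t 1) (ren ?t f) = ren ?t (D 1 f)" by (rule D_ren_bij)
    then have "D a f = ren ?t (D 1 f)"
      using ideal_I_ren[OF transpose_permutes[of 1 n a]] that n4 by auto
    moreover have "?r \<circ> ?s \<circ> ?t = ?r \<circ> ?s" using that by (auto simp: Transposition.transpose_def fun_eq_iff)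
    ultimately show ?thesis by (simp add: ren_ren)
  qed
  have "ren ?r (D 1 merge12) = ren (?r \<circ> ?s) (D 1 f) + ren (?r \<circ> ?s) (D 2 f)"
    using D_ren_merge[of 1 2 f] by (simp add: ren_ren ren_add)
  moreover have "ren ?r (D 3 merge12) = ren (?r \<circ> ?s) (D 3 f)"
    using D_ren_merge_other[of 3 1 2 f] by (simp add: ren_ren)
  ultimately have eq: "ren ?r (D 1 merge12) = 2 * ren ?r (D 3 merge12)"
    using Deq[of 2] Deq[of 3] by simp
  have "D 1 merge12 = (var 3 - var j) ^ 2 * D 1 h"
    using j unfolding h power2_eq_square by (simp add: D_mult D_var)
  moreover have "D 3 merge12 = (var 3 - var j) ^ 2 * D 3 h + var 3 * (var 3 - var j) * h + var 3 * (var 3 - var j) * h"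
    using j unfolding h power2_eq_square by (simp add: D_mult D_add D_var algebra_simps)
  ultimately have "?u ^ 2 * ren ?r (D 1 h) = 2 * (?u ^ 2 * ren ?r (D 3 h) + var 1 * ?u * ren ?r h + var 1 * ?u * ren ?r h)"
    using eq j by (simp add: ren_mult ren_add ren_power)
  \<comment> \<open>Only differentiating the square (x_3 - x_j)^2 leaves a term with a single factor
    u; all other terms carry u^2. Cancelling one u shows that u divides 4 x_1 h on the
    diagonal.\<close>
  then have "?u * (?u * (ren ?r (D 1 h) - 2 * ren ?r (D 3 h)) - 4 * (var 1 * ren ?r h)) = 0"
    unfolding power2_eq_square by (simp add: algebra_simps)
  then have "?u * (ren ?r (D 1 h) - 2 * ren ?r (D 3 h)) = 4 * (var 1 * ren ?r h)"
    using j by auto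
  then have "?u dvd 4 * (var 1 * ren ?r h)" by (metis dvd_triv_left)
  then have "?u dvd ren ?r h"
    unfolding diff_var_dvd_iff by (auto simp: ren_mult ren_numeral)
  then have "?u ^ 2 * ?u dvd ?u ^ 2 * ren ?r h" by (rule mult_dvd_mono[OF dvd_refl])
  moreover have "merge123 = ?u ^ 2 * ren ?r h" unfolding h using j by (simp add: ren_mult ren_power)
  ultimately show ?thesis by (simp add: power3_eq_cube power2_eq_square)
qed

lemma star_prod_dvd_merge123: "star_prod 3 4 n dvd merge123"
  by (rule star_prod_dvd) (use merge123_dvd_cube merge123_dvd in auto)

text \<open>The merged polynomial is still symmetric in x_3, ..., x_n, so its zero at x_3 = x_1
  spreads to all x_j = x_1.\<close>

lemma star_prod_dvd_merge12:
  assumes "merge123 = 0"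
  shows "star_prod 1 3 n dvd merge12"
proof (rule star_prod_dvd)
  fix j assume j: "j \<in> {3..n}"
  let ?t = "swap 3 j"
  have "id(j := 1) \<circ> ?t = ?t \<circ> id(3 := 1)"
    using j by (auto simp: Transposition.transpose_def fun_eq_iff)
  then have "ren (id(j := 1)) (ren ?t merge12) = ren ?t merge123"
    by (metis ren_ren)
  then have "ren (id(j := 1)) merge12 = 0" using merge12_transpose[of 3 j] j assms by simp
  then show "(var 1 - var j) ^ 1 dvd merge12" by (simp add: diff_var_dvd_iff)
qed (use merge12_dvd in auto)

lemma star_prod_dvd_ideal_I:
  assumes "merge12 = 0"
  shows "star_prod 2 2 n dvd f"
proof -
  have "(var i - var j) ^ 2 dvd f" if ij: "i \<in> {1..n}" "j \<in> {1..n}" "i \<noteq> j" for i j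
  proof (rule diff_var_square_dvd)
    have "inj_on (id(1 := i, 2 := j)) {1, 2}" using ij by (simp add: inj_on_def)
    moreover have "id(1 := i, 2 := j) ` {1, 2} \<subseteq> {1..n}" using ij by simp
    moreover have "{1, 2} \<subseteq> {1..n}" using n4 by auto
    ultimately obtain s where s: "s permutes {1..n}" "\<And>x. x \<in> {1, 2} \<Longrightarrow> s x = (id(1 := i, 2 := j)) x"
      using permutes_extend[of "{1..n}" "{1, 2}" "id(1 := i, 2 := j)"] by blast
    then have "s 1 = i" "s 2 = j" by auto
    then have "id(j := i) \<circ> s = id(j := i) \<circ> s \<circ> id(2 := 1)" by (auto simp: fun_eq_iff)
    then have "ren (id(j := i)) (ren s f) = ren (id(j := i) \<circ> s) merge12" by (metis ren_ren)
    then show "ren (id(j := i)) f = 0" using assms ideal_I_ren[OF s(1)] by simp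
  qed (use ij ideal_I_ren[OF transpose_permutes] in auto)
  then show ?thesis using n4 by (intro star_prod_dvd) auto
qed

text \<open>If the triple restriction vanishes, the degree is at least (n - 2)^2, or even n (n - 1)
  when the restriction to x_1 = x_2 vanishes too; both exceed (n - 1)(n - 3).\<close>

lemma merge123_nonzero:
  assumes "f \<noteq> 0" "homogeneous d f" "d \<le> min_deg n"
  shows "merge123 \<noteq> 0"
proof
  assume 0: "merge123 = 0"
  obtain k where k: "n = k + 4" using n4 by (metis add.commute le_Suc_ex)
  show False
  proof (cases "merge12 = 0")
    case True
    then have "(Suc n - 2) * (2 + n - 2) \<le> d"
      using star_prod_dvd_ideal_I assms n4
      by (intro homogeneous_dvd_degree_le[OF _ assms(2) star_prod_homogeneous]) auto
    then show False using assms(3) by (simp add: min_deg_def k algebra_simps)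
  next
    case False
    then have "(Suc n - 3) * (1 + n - 3) \<le> d"
      using star_prod_dvd_merge12[OF 0] assms n4
      by (intro homogeneous_dvd_degree_le[OF _ homogeneous_ren[OF assms(2)] star_prod_homogeneous]) auto
    then show False using assms(3) by (simp add: min_deg_def k algebra_simps)
  qed
qed

lemma ideal_I_min_degree:
  assumes "f \<noteq> 0" "homogeneous d f"
  shows "min_deg n \<le> d"
proof (rule ccontr)
  assume "\<not> min_deg n \<le> d"
  then have "merge123 \<noteq> 0" using merge123_nonzero assms by simp
  then have "(Suc n - 4) * (3 + n - 4) \<le> d"
    using star_prod_dvd_merge123 n4
    by (intro homogeneous_dvd_degree_le[OF _ homogeneous_ren[OF homogeneous_ren[OF assms(2)]] star_prod_homogeneous]) auto
  moreover have "(Suc n - 4) * (3 + n - 4) = min_deg n"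
    using n4 by (auto simp: min_deg_def mult.commute)
  ultimately show False using \<open>\<not> min_deg n \<le> d\<close> by simp
qed

lemma merge123_eq_cscale:
  assumes "homogeneous (min_deg n) f"
  obtains c where "merge123 = cscale c (star_prod 3 4 n)"
proof (rule homogeneous_dvd_eq_cscale[OF star_prod_dvd_merge123])
  show "homogeneous (min_deg n) merge123" by (intro homogeneous_ren assms)
  have "(Suc n - 4) * (3 + n - 4) = min_deg n"
    using n4 by (auto simp: min_deg_def mult.commute)
  then show "homogeneous (min_deg n) (star_prod 3 4 n)"
    using star_prod_homogeneous[of 4 n 3] n4 by simp
qed

end

lemma mpolys_cscale: "f \<in> mpolys n \<Longrightarrow> cscale c f \<in> mpolys n"
  unfolding cscale_def by (intro mpolys_mult) auto

lemma ideal_I_cscale: "f \<in> ideal_I n \<Longrightarrow> cscale c f \<in> ideal_I n"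
  by (auto simp: ideal_I_iff sym_polys_iff mpolys_cscale)

lemma ideal_I_diff: "f \<in> ideal_I n \<Longrightarrow> g \<in> ideal_I n \<Longrightarrow> f - g \<in> ideal_I n"
  by (auto simp: ideal_I_iff sym_polys_iff mpolys_diff)

text \<open>In this degree the restriction to x_1 = x_2 = x_3 is injective, and its image lies on
  the line spanned by \<open>star_prod 3 4 n\<close>.\<close>

lemma ideal_I_min_degree_unique:
  assumes n: "n \<ge> 4" and f: "f \<in> ideal_I n" "homogeneous (min_deg n) f"
    and g: "g \<in> ideal_I n" "homogeneous (min_deg n) g" "g \<noteq> 0"
  obtains c where "f = cscale c g"
proof -
  let ?m = "\<lambda>f. ren (id(3 := 1)) (ren (id(2 := 1)) f)"
  obtain a where a: "?m f = cscale a (star_prod 3 4 n)" using merge123_eq_cscale[OF n f] .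
  obtain b where b: "?m g = cscale b (star_prod 3 4 n)" using merge123_eq_cscale[OF n g(1,2)] .
  have "?m g \<noteq> 0" using merge123_nonzero[OF n g(1,3,2)] by simp
  then have "b \<noteq> 0" using b by auto
  let ?h = "f - cscale (a / b) g"
  have "?m ?h = 0" using a b \<open>b \<noteq> 0\<close> by simp
  moreover have "?h \<in> ideal_I n" using f(1) g(1) by (intro ideal_I_diff ideal_I_cscale)
  moreover have "homogeneous (min_deg n) ?h"
    using f(2) g(2) by (intro homogeneous_diff homogeneous_cscale)
  ultimately have "?h = 0" using merge123_nonzero[OF n] by blast
  then show ?thesis using that[of "a / b"] by simp
qed

section \<open>Leading monomials for the dominance order\<close>

definition pre :: "nat \<Rightarrow> monomial \<Rightarrow> nat" where
  "pre r m = (\<Sum>i\<le>r. lookup m i)"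

text \<open>
  \<open>d\<close> dominates every exponent of \<open>F\<close>; since exponents are compared by their prefix sums in the
  given order of the variables, such a \<open>d\<close> is multiplicative in \<open>F\<close>.
\<close>

definition lead :: "monomial \<Rightarrow> complex \<Rightarrow> mpoly \<Rightarrow> bool" where
  "lead d c F \<longleftrightarrow> lookup F d = c \<and> (\<forall>m\<in>keys F. \<forall>r. pre r m \<le> pre r d)"

lemma pre_add: "pre r (m + k) = pre r m + pre r k"
  by (simp add: pre_def lookup_add sum.distrib)

lemma pre_zero [simp]: "pre r 0 = 0"
  by (simp add: pre_def)

lemma pre_single [simp]: "pre r (single i k) = (if i \<le> r then k else 0)"
  by (simp add: pre_def lookup_single when_def sum.delta)

lemma pre_sum: "pre r (sum F A) = (\<Sum>a\<in>A. pre r (F a))"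
  by (induction A rule: infinite_finite_induct) (auto simp: pre_add)

lemma pre_Suc: "pre (Suc r) m = pre r m + lookup m (Suc r)"
  by (simp add: pre_def)

lemma pre_inject:
  assumes "\<And>r. pre r m = pre r k"
  shows "m = k"
proof (rule poly_mapping_eqI)
  fix i
  show "lookup m i = lookup k i"
  proof (cases i)
    case 0
    then show ?thesis using assms[of 0] by (simp add: pre_def)
  next
    case (Suc j)
    then show ?thesis using assms[of j] assms[of i] by (simp add: pre_Suc)
  qed
qed

text \<open>Two inequalities whose sum is an equality are equalities, and prefix sums determine the
  exponent. Hence exactly one pair of monomials can produce the leading exponent of a
  product.\<close>

lemma pre_add_eq_cancel:
  assumes "k + m = d + e" "\<And>r. pre r k \<le> pre r d" "\<And>r. pre r m \<le> pre r e"
  shows "k = d" "m = e"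
proof -
  have "pre r k = pre r d \<and> pre r m = pre r e" for r
    using assms(2,3)[of r] arg_cong[OF assms(1), of "pre r"] by (simp add: pre_add)
  then show "k = d" "m = e" by (auto intro: pre_inject)
qed

lemma mult_eq_sum_single:
  fixes F G :: mpoly
  shows "F * G = (\<Sum>k\<in>keys F. \<Sum>m\<in>keys G. single (k + m) (lookup F k * lookup G m))"
proof -
  have "F * G = (\<Sum>k\<in>keys F. single k (lookup F k)) * (\<Sum>m\<in>keys G. single m (lookup G m))"
    by (simp flip: poly_mapping_eq_sum_single)
  then show ?thesis by (simp add: sum_product mult_single)
qed

text \<open>The factor \<open>w\<close> is carried along so that one computation serves both
  ordinary products and the weighted products \<open>Phi\<close>.\<close>

lemma sum_keys_unique:
  fixes F G :: mpoly
  assumes "\<And>k m. k \<in> keys F \<Longrightarrow> m \<in> keys G \<Longrightarrow> k + m = d + e \<Longrightarrow> k = d \<and> m = e"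
  shows "(\<Sum>k\<in>keys F. \<Sum>m\<in>keys G. if k + m = d + e then lookup F k * lookup G m * w k m else 0)
     = lookup F d * lookup G e * w d e"
proof -
  have "(\<Sum>k\<in>keys F. \<Sum>m\<in>keys G. if k + m = d + e then lookup F k * lookup G m * w k m else 0)
     = (\<Sum>k\<in>keys F. \<Sum>m\<in>keys G. if m = e then if k = d then lookup F k * lookup G m * w k m else 0 else 0)"
    using assms by (intro sum.cong refl) auto
  then show ?thesis by (cases "lookup G e = 0") (auto simp: sum.delta in_keys_iff)
qed

lemma lead_mult:
  assumes "lead d c F" "lead e b G"
  shows "lead (d + e) (c * b) (F * G)"
proof -
  have "lookup (F * G) (d + e)
     = (\<Sum>k\<in>keys F. \<Sum>m\<in>keys G. if k + m = d + e then lookup F k * lookup G m * 1 else 0)"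
    by (simp add: mult_eq_sum_single lookup_sum lookup_single when_def cong: if_cong)
  also have "\<dots> = lookup F d * lookup G e * 1"
  proof (rule sum_keys_unique)
    fix k m assume "k \<in> keys F" "m \<in> keys G" "k + m = d + e"
    then show "k = d \<and> m = e" using pre_add_eq_cancel[of k m d e] assms by (simp add: lead_def)
  qed
  finally have "lookup (F * G) (d + e) = c * b" using assms by (simp add: lead_def)
  moreover have "pre r m \<le> pre r (d + e)" if m: "m \<in> keys (F * G)" for m r
  proof -
    obtain k l where "m = k + l" "k \<in> keys F" "l \<in> keys G" using m keys_mult[of F G] by blast
    then show ?thesis using assms by (auto simp: lead_def pre_add intro: add_mono)
  qed
  ultimately show ?thesis by (simp add: lead_def)
qed

lemma lead_one: "lead 0 1 1"
  by (auto simp: lead_def lookup_one)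

lemma lead_prod:
  "(\<And>a. a \<in> A \<Longrightarrow> lead (d a) (c a) (F a)) \<Longrightarrow> lead (sum d A) (prod c A) (prod F A)"
  by (induction A rule: infinite_finite_induct) (auto intro: lead_mult lead_one)

lemma lookup_var: "lookup (var i) (single j 1) = (if i = j then 1 else 0)"
  by (simp add: var_def lookup_single when_def) (metis lookup_single_eq lookup_single_not_eq zero_neq_one)

lemma keys_var [simp]: "keys (var i) = {single i 1}"
  by (simp add: var_def)

lemma lead_diff_var:
  assumes "a \<noteq> b"
  shows "lead (single (min a b) 1) (if a < b then 1 else - 1) (var a - var b)"
  unfolding lead_def
proof (intro conjI ballI allI)
  show "lookup (var a - var b) (single (min a b) 1) = (if a < b then 1 else - 1)"
    using assms by (auto simp: lookup_minus lookup_var min_def)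
  fix m r assume "m \<in> keys (var a - var b)"
  then have "m = single a 1 \<or> m = single b 1" using keys_diff[of "var a" "var b"] by auto
  then show "pre r m \<le> pre r (single (min a b) 1)" by auto
qed

section \<open>The Vandermonde polynomial\<close>

definition vdm :: "nat \<Rightarrow> mpoly" where
  "vdm n = (\<Prod>p\<in>upper_pairs {1..n}. var (fst p) - var (snd p))"

definition delta :: "nat \<Rightarrow> monomial" where
  "delta n = (\<Sum>i\<in>{1..n}. single i (n - i))"

lemma lookup_delta: "lookup (delta n) i = (if i \<in> {1..n} then n - i else 0)"
  by (simp add: delta_def lookup_sum lookup_single when_def sum.delta)

text \<open>Every factor leads with the variable of smaller index, and i is the smaller index of n -
  i pairs.\<close>

lemma lead_vdm: "lead (delta n) 1 (vdm n)"
proof -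
  have "lead (\<Sum>p\<in>upper_pairs {1..n}. single (fst p) 1) (\<Prod>p\<in>upper_pairs {1..n}. 1) (vdm n)"
    unfolding vdm_def
  proof (rule lead_prod)
    fix p assume "p \<in> upper_pairs {1..n}"
    then have "fst p < snd p" by (auto simp: upper_pairs_def)
    then show "lead (single (fst p) 1) 1 (var (fst p) - var (snd p))"
      using lead_diff_var[of "fst p" "snd p"] by (simp add: min_def)
  qed
  moreover have "(\<Sum>p\<in>upper_pairs {1..n}. single (fst p) 1) = delta n"
  proof -
    have "upper_pairs {1..n} = (SIGMA k:{1..n}. {k<..n})" by (auto simp: upper_pairs_def)
    then have "(\<Sum>p\<in>upper_pairs {1..n}. single (fst p) (1::nat)) = (\<Sum>k\<in>{1..n}. \<Sum>l\<in>{k<..n}. single k (1::nat))"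
      by (subst sum.Sigma) (auto simp: case_prod_unfold)
    also have "\<dots> = delta n" unfolding delta_def
    proof (intro sum.cong refl)
      fix k :: nat
      have "(\<Sum>l\<in>A. single k (1::nat)) = single k (card A)" if "finite A" for A :: "nat set"
        using that by (induction A) (simp_all del: sum_constant add: single_add[symmetric] plus_1_eq_Suc)
      from this[of "{k<..n}"] show "(\<Sum>l\<in>{k<..n}. single k 1) = single k (n - k)" by (simp del: sum_constant)
    qed
    finally show ?thesis .
  qed
  ultimately show ?thesis by simp
qed

lemma lookup_vdm_delta: "lookup (vdm n) (delta n) = 1"
  and pre_vdm: "m \<in> keys (vdm n) \<Longrightarrow> pre r m \<le> pre r (delta n)"
  using lead_vdm by (auto simp: lead_def)

lemma vdm_nonzero [simp]: "vdm n \<noteq> 0"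
  using lookup_vdm_delta[of n] by auto

lemma mpolys_vdm: "vdm n \<in> mpolys n"
  unfolding vdm_def by (intro mpolys_prod mpolys_diff mpolys_var) (auto simp: upper_pairs_def)

lemma homogeneous_vdm: "homogeneous (card (upper_pairs {1..n})) (vdm n)"
  using homogeneous_prod[of "upper_pairs {1..n}" "\<lambda>_. 1" "\<lambda>p. var (fst p) - var (snd p)"]
    homogeneous_diff_var_power[of 1]
  by (simp add: vdm_def)

text \<open>A permutation permutes the squared factors among themselves, and equal squares in an
  integral domain leave only the sign open.\<close>

lemma ren_vdm:
  assumes s: "s permutes {1..n}"
  shows "ren s (vdm n) = vdm n \<or> ren s (vdm n) = - vdm n"
proof -
  let ?U = "upper_pairs {1..n}"
  define h where "h p = (min (s (fst p)) (s (snd p)), max (s (fst p)) (s (snd p)))" for p :: "nat \<times> nat"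
  have inj: "inj s" using s by (rule permutes_inj)
  have "inj_on h ?U"
    by (auto simp: inj_on_def h_def upper_pairs_def min_def max_def inj_eq[OF inj] split: if_splits)
  moreover have "h ` ?U \<subseteq> ?U"
  proof (rule image_subsetI)
    fix p assume "p \<in> ?U"
    then have "s (fst p) \<in> {1..n}" "s (snd p) \<in> {1..n}" "s (fst p) \<noteq> s (snd p)"
      unfolding permutes_in_image[OF s] inj_eq[OF inj] by (auto simp: upper_pairs_def)
    then show "h p \<in> ?U" by (auto simp: h_def upper_pairs_def min_def max_def)
  qed
  ultimately have "bij_betw h ?U ?U"
    by (simp add: bij_betw_def endo_inj_surj)
  then have "(\<Prod>p\<in>?U. (var (fst (h p)) - var (snd (h p))) ^ 2) = (\<Prod>p\<in>?U. (var (fst p) - var (snd p)) ^ 2)"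
    by (rule prod.reindex_bij_betw)
  moreover have "(var (fst (h p)) - var (snd (h p))) ^ 2 = ren s (var (fst p) - var (snd p)) ^ 2" for p
    by (auto simp: h_def min_def max_def power2_commute)
  ultimately have "ren s (vdm n) ^ 2 = vdm n ^ 2"
    unfolding vdm_def ren_prod by (simp only: prod_power_distrib)
  then show ?thesis by (simp add: power2_eq_iff)
qed

lemma ren_diff_var_prod_nonzero:
  assumes "\<And>p. p \<in> P \<Longrightarrow> r (fst p) \<noteq> r (snd p)"
  shows "ren r (\<Prod>p\<in>P. var (fst p) - var (snd p)) \<noteq> 0"
proof (cases "finite P")
  case True
  then show ?thesis using assms by (simp add: ren_prod)
qed simp

lemma vdm_split:
  assumes "(i, j) \<in> upper_pairs {1..n}"
  obtains Y where "vdm n = (var i - var j) * Y" "ren (id(j := i)) Y \<noteq> 0"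
proof (rule that)
  show "vdm n = (var i - var j) * (\<Prod>p\<in>upper_pairs {1..n} - {(i, j)}. var (fst p) - var (snd p))"
    unfolding vdm_def using assms by (subst prod.remove) auto
  show "ren (id(j := i)) (\<Prod>p\<in>upper_pairs {1..n} - {(i, j)}. var (fst p) - var (snd p)) \<noteq> 0"
    using assms by (intro ren_diff_var_prod_nonzero) (auto simp: upper_pairs_def split: if_splits)
qed

text \<open>With the other sign, the cofactor of x_i - x_j would be antisymmetric and vanish at x_i
  = x_j, although none of its own factors does.\<close>

lemma ren_transpose_vdm:
  assumes "(i, j) \<in> upper_pairs {1..n}"
  shows "ren (swap i j) (vdm n) = - vdm n"
proof (rule ccontr)
  let ?t = "swap i j"
  assume "ren ?t (vdm n) \<noteq> - vdm n"
  moreover have ij: "i \<in> {1..n}" "j \<in> {1..n}" "i < j" using assms by (auto simp: upper_pairs_def)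
  ultimately have eq: "ren ?t (vdm n) = vdm n" using ren_vdm[OF transpose_permutes] by blast
  obtain Y where Y: "vdm n = (var i - var j) * Y" "ren (id(j := i)) Y \<noteq> 0"
    using vdm_split[OF assms] .
  have "(var i - var j) * (- ren ?t Y) = (var i - var j) * Y"
    using eq unfolding Y(1) by (simp add: ren_mult algebra_simps)
  then have "- ren ?t Y = Y" using ij(3) by (metis mult_left_cancel right_minus_eq var_eq_iff less_irrefl)
  then have "ren (id(j := i)) Y = - ren (id(j := i)) (ren ?t Y)" by (metis ren_uminus)
  then show False using Y(2) mpoly_eq_uminus_self by (simp add: ren_ren merge_comp_transpose)
qed

section \<open>The polynomial Q\<close>

definition Q_pairs :: "nat \<Rightarrow> (nat \<times> nat) set" where
  "Q_pairs n = {1, 2, 3} \<times> {4..n}"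

definition Q_summand :: "nat \<Rightarrow> mpoly" where
  "Q_summand n = (\<Prod>p\<in>Q_pairs n. var (fst p) - var (snd p)) *
     (\<Prod>p\<in>upper_pairs {4..n}. (var (fst p) - var (snd p)) ^ 2)"

lemma Q_poly_eq: "Q_poly n = (\<Sum>s | s permutes {1..n}. ren s (Q_summand n))"
proof -
  have "(\<Prod>p\<in>Q_pairs n. var (fst p) - var (snd p))
     = (\<Prod>j\<in>{4..n}. \<Prod>i\<in>{1, 2, 3}. var i - var j)"
    unfolding Q_pairs_def by (subst prod.swap) (simp add: prod.cartesian_product case_prod_unfold)
  also have "\<dots> = (\<Prod>j\<in>{4..n}. (var 1 - var j) * (var 2 - var j) * (var 3 - var j))"
    by (simp add: mult.assoc)
  finally have 1: "(\<Prod>j\<in>{4..n}. (var 1 - var j) * (var 2 - var j) * (var 3 - var j))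
     = (\<Prod>p\<in>Q_pairs n. var (fst p) - var (snd p))" ..
  have "{(k, l). 4 \<le> k \<and> k < l \<and> l \<le> n} = upper_pairs {4..n}" by (auto simp: upper_pairs_def)
  then have 2: "(\<Prod>(k, l)\<in>{(k, l). 4 \<le> k \<and> k < l \<and> l \<le> n}. (var k - var l) ^ 2)
     = (\<Prod>p\<in>upper_pairs {4..n}. (var (fst p) - var (snd p)) ^ 2)" by (simp add: case_prod_unfold)
  show ?thesis unfolding Q_poly_def Symm_def 1 2 Q_summand_def[symmetric]
    by (intro sum.cong) (auto simp: perm_poly_permutes)
qed

lemma finite_Q_pairs [simp]: "finite (Q_pairs n)"
  by (simp add: Q_pairs_def)

lemma min_deg_eq_card: "n \<ge> 4 \<Longrightarrow> min_deg n = card (Q_pairs n) + 2 * card (upper_pairs {4..n})"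
proof -
  assume "n \<ge> 4"
  then obtain k where "n = k + 4" by (metis add.commute le_Suc_ex)
  then show ?thesis by (simp add: card_upper_pairs min_deg_def Q_pairs_def card_cartesian_product algebra_simps)
qed

lemma mpolys_Q_summand: "n \<ge> 4 \<Longrightarrow> Q_summand n \<in> mpolys n"
  unfolding Q_summand_def
  by (intro mpolys_mult mpolys_prod mpolys_power mpolys_diff mpolys_var)
    (auto simp: upper_pairs_def Q_pairs_def)

lemma homogeneous_Q_poly: "n \<ge> 4 \<Longrightarrow> homogeneous (min_deg n) (Q_poly n)"
proof -
  assume n: "n \<ge> 4"
  have "homogeneous ((\<Sum>p\<in>Q_pairs n. 1) + (\<Sum>p\<in>upper_pairs {4..n}. 2)) (Q_summand n)"
    unfolding Q_summand_def
    by (intro homogeneous_mult homogeneous_prod homogeneous_diff_var_power)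
      (use homogeneous_diff_var_power[of 1] in auto)
  then have "homogeneous (min_deg n) (Q_summand n)" using n by (simp add: min_deg_eq_card mult.commute)
  then show ?thesis unfolding Q_poly_eq by (intro homogeneous_sum homogeneous_ren)
qed

lemma sym_polys_Q_poly:
  assumes "n \<ge> 4"
  shows "Q_poly n \<in> sym_polys n"
  unfolding sym_polys_iff
proof (intro conjI allI impI)
  show "Q_poly n \<in> mpolys n" unfolding Q_poly_eq
    using assms by (intro mpolys_sum) (auto intro: mpolys_ren_permutes mpolys_Q_summand)
  fix u assume u: "u permutes {1..n}"
  have "ren u (Q_poly n) = (\<Sum>s | s permutes {1..n}. ren (u \<circ> s) (Q_summand n))"
    unfolding Q_poly_eq by (simp add: ren_sum ren_ren)
  also have "\<dots> = Q_poly n" unfolding Q_poly_eq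
    by (rule sum.reindex_bij_witness[of _ "\<lambda>s. inv_into UNIV u \<circ> s" "\<lambda>s. u \<circ> s"])
      (use u in \<open>auto simp: permutes_compose permutes_inv permutes_inv_o o_assoc\<close>)
  finally show "ren u (Q_poly n) = Q_poly n" .
qed

text \<open>
  Every summand vanishes: the two coinciding pairs of variables cannot both lie among the three
  variables between which \<open>Q\<close> has no factor.
\<close>

lemma ren_Q_summand_zero:
  assumes "a \<in> {1..n}" "b \<in> {4..n}" "a < b" "r a = r b"
  shows "ren r (Q_summand n) = 0"
proof (cases "a \<le> 3")
  case True
  then have "(a, b) \<in> Q_pairs n" using assms(1,2) by (auto simp: Q_pairs_def)
  then have "ren r (\<Prod>p\<in>Q_pairs n. var (fst p) - var (snd p)) = 0"
    using assms(4) by (force simp: ren_prod)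
  then show ?thesis by (simp add: Q_summand_def ren_mult)
next
  case False
  then have "(a, b) \<in> upper_pairs {4..n}" using assms by (auto simp: upper_pairs_def)
  then have "ren r (\<Prod>p\<in>upper_pairs {4..n}. (var (fst p) - var (snd p)) ^ 2) = 0"
    using assms(4) by (force simp: ren_prod ren_power)
  then show ?thesis by (simp add: Q_summand_def ren_mult)
qed

lemma Q_poly_ideal_I:
  assumes n: "n \<ge> 4"
  shows "Q_poly n \<in> ideal_I n"
  unfolding ideal_I_iff
proof
  show "Q_poly n \<in> sym_polys n" using n by (rule sym_polys_Q_poly)
  let ?l = "id(2 := 1, 4 := 3) :: nat \<Rightarrow> nat"
  have "ren (?l \<circ> s) (Q_summand n) = 0" if s: "s permutes {1..n}" for s
  proof -
    \<comment> \<open>Variable i of the renamed summand comes from the index \<open>t i\<close>. A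
      pair of indices avoids all factors of the summand only if both lie in {1, 2, 3}.\<close>
    define t where "t = inv_into UNIV s"
    have st: "s (t i) = i" for i using permutes_inverses(1)[OF s] by (simp add: t_def)
    have t: "t i \<in> {1..n}" if "i \<in> {1..n}" for i
      using that permutes_in_image[OF permutes_inv[OF s]] by (simp add: t_def)
    have inj: "t i \<noteq> t j" if "i \<noteq> j" for i j using that st by metis
    have key: "ren (?l \<circ> s) (Q_summand n) = 0"
      if "max (t i) (t j) \<ge> 4" "?l i = ?l j" "i \<in> {1..n}" "j \<in> {1..n}" "i \<noteq> j" for i j
    proof (rule ren_Q_summand_zero)
      show "min (t i) (t j) \<in> {1..n}" "max (t i) (t j) \<in> {4..n}"
        using t[OF that(3)] t[OF that(4)] that(1) by (auto simp: min_def max_def)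
      show "min (t i) (t j) < max (t i) (t j)" using inj[OF that(5)] by auto
      show "(?l \<circ> s) (min (t i) (t j)) = (?l \<circ> s) (max (t i) (t j))"
        using that(2) by (auto simp: min_def max_def st)
    qed
    show ?thesis
    proof (rule ccontr)
      assume nz: "ren (?l \<circ> s) (Q_summand n) \<noteq> 0"
      have "\<not> max (t 1) (t 2) \<ge> 4" using key[of 1 2] nz n by auto
      moreover have "\<not> max (t 3) (t 4) \<ge> 4" using key[of 3 4] nz n by auto
      ultimately have "t ` {1, 2, 3, 4} \<subseteq> {1..3}" using t n by fastforce
      then have "card (t ` {1, 2, 3, 4}) \<le> 3" using card_mono[of "{1..3::nat}"] by fastforce
      moreover have "card (t ` {1, 2, 3, 4}) = 4"
        using inj by (subst card_image) (auto simp: inj_on_def)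
      ultimately show False by simp
    qed
  qed
  then show "ren ?l (Q_poly n) = 0" by (simp add: Q_poly_eq ren_sum ren_ren)
qed

section \<open>The leading exponent of the symmetrized product\<close>

definition mon_of :: "nat \<Rightarrow> nat list \<Rightarrow> monomial" where
  "mon_of n mu = (\<Sum>i\<in>{1..n}. single i (mu ! (i - 1)))"

lemma lookup_mon_of: "lookup (mon_of n mu) i = (if i \<in> {1..n} then mu ! (i - 1) else 0)"
  by (simp add: mon_of_def lookup_sum lookup_single when_def sum.delta)

lemma jack_lambda_nth:
  assumes "n \<ge> 4" "i \<in> {1..n}"
  shows "jack_lambda n ! (i - 1) = (if i \<le> n - 3 then 2 * (n - i) - 3 else 0)"
proof -
  obtain k where k: "n = k + 4" using assms(1) by (metis add.commute le_Suc_ex)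
  show ?thesis
  proof (cases "i \<le> n - 3")
    case True
    then show ?thesis using assms(2) by (auto simp: jack_lambda_def nth_append k)
  next
    case False
    then have "i = k + 2 \<or> i = k + 3 \<or> i = k + 4" using assms(2) k by auto
    then show ?thesis by (auto simp: jack_lambda_def nth_append k nth_Cons')
  qed
qed

lemma length_jack_lambda: "n \<ge> 4 \<Longrightarrow> length (jack_lambda n) = n"
  by (simp add: jack_lambda_def)

text \<open>The parts of \<lambda> after the r-th sum to (n - r - 3)(n - r - 1). Truncated
  subtraction makes this 0 from r = n - 3 on, where only zeros remain.\<close>

lemma pre_jack_lambda:
  assumes n: "n \<ge> 4"
  shows "pre r (mon_of n (jack_lambda n)) + (n - r - 3) * (n - r - 1) = min_deg n"
proof (induction r)
  case 0
  then show ?case by (simp add: pre_def lookup_mon_of min_deg_def mult.commute)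
next
  case (Suc r)
  have l: "lookup (mon_of n (jack_lambda n)) (Suc r) = (if r + 4 \<le> n then 2 * (n - r) - 5 else 0)"
    using jack_lambda_nth[OF n, of "Suc r"] n by (auto simp: lookup_mon_of)
  show ?case
  proof (cases "r + 4 \<le> n")
    case True
    then obtain k where "n = r + 4 + k" by (metis le_Suc_ex)
    then show ?thesis using Suc.IH l by (simp add: pre_Suc algebra_simps)
  next
    case False
    then show ?thesis using Suc.IH l by (simp add: pre_Suc)
  qed
qed

text \<open>A factor x_a - x_b leads with the variable of smaller index, taken here after renaming
  by \<open>s\<close>; the squared factors give the exponent 2.\<close>

definition Q_exponent :: "nat \<Rightarrow> (nat \<Rightarrow> nat) \<Rightarrow> monomial" where
  "Q_exponent n s = (\<Sum>p\<in>Q_pairs n. single (min (s (fst p)) (s (snd p))) 1) +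
     (\<Sum>p\<in>upper_pairs {4..n}. single (min (s (fst p)) (s (snd p))) 2)"

lemma lead_Q_summand:
  assumes s: "s permutes {1..n}"
  shows "lead (Q_exponent n s) (\<Prod>p\<in>Q_pairs n. if s (fst p) < s (snd p) then 1 else - 1) (ren s (Q_summand n))"
proof -
  have ne: "s a \<noteq> s b" if "a \<noteq> b" for a b using permutes_inj[OF s] that by (auto dest: injD)
  have "lead (\<Sum>p\<in>Q_pairs n. single (min (s (fst p)) (s (snd p))) 1)
      (\<Prod>p\<in>Q_pairs n. if s (fst p) < s (snd p) then 1 else - 1) (\<Prod>p\<in>Q_pairs n. var (s (fst p)) - var (s (snd p)))"
    by (rule lead_prod, rule lead_diff_var, rule ne) (auto simp: Q_pairs_def)
  moreover have "lead (\<Sum>p\<in>upper_pairs {4..n}. single (min (s (fst p)) (s (snd p))) 2)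
      (\<Prod>p\<in>upper_pairs {4..n}. 1) (\<Prod>p\<in>upper_pairs {4..n}. (var (s (fst p)) - var (s (snd p))) ^ 2)"
  proof (rule lead_prod)
    fix p assume "p \<in> upper_pairs {4..n}"
    then have l: "lead (single (min (s (fst p)) (s (snd p))) 1) (if s (fst p) < s (snd p) then 1 else - 1)
        (var (s (fst p)) - var (s (snd p)))"
      by (intro lead_diff_var ne) (auto simp: upper_pairs_def)
    have "single (min (s (fst p)) (s (snd p))) 1 + single (min (s (fst p)) (s (snd p))) 1
       = single (min (s (fst p)) (s (snd p))) (2::nat)" by (simp flip: single_add)
    then show "lead (single (min (s (fst p)) (s (snd p))) 2) 1 ((var (s (fst p)) - var (s (snd p))) ^ 2)"
      using lead_mult[OF l l] by (simp add: power2_eq_square split: if_splits)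
  qed
  ultimately have "lead (Q_exponent n s) ((\<Prod>p\<in>Q_pairs n. if s (fst p) < s (snd p) then 1 else - 1) * (\<Prod>p\<in>upper_pairs {4..n}. 1))
     ((\<Prod>p\<in>Q_pairs n. var (s (fst p)) - var (s (snd p))) * (\<Prod>p\<in>upper_pairs {4..n}. (var (s (fst p)) - var (s (snd p))) ^ 2))"
    unfolding Q_exponent_def by (rule lead_mult)
  then show ?thesis by (simp add: Q_summand_def ren_mult ren_prod ren_power)
qed

lemma card_permutes_gt:
  assumes s: "s permutes {1..n}"
  shows "card {i \<in> {1..n}. s i > r} = n - r"
proof -
  have "s ` {i \<in> {1..n}. s i > r} = s ` {1..n} \<inter> {r<..}" by auto
  then have "s ` {i \<in> {1..n}. s i > r} = {r<..n} \<inter> {1..n}"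
    unfolding permutes_image[OF s] by auto
  moreover have "{r<..n} \<inter> {1..n} = {r<..n}" by auto
  moreover have "card (s ` {i \<in> {1..n}. s i > r}) = card {i \<in> {1..n}. s i > r}"
    using permutes_inj[OF s] by (intro card_image) (auto intro: inj_on_subset)
  ultimately show ?thesis by (metis card_greaterThanAtMost)
qed

text \<open>A factor contributes to the prefix r unless \<open>s\<close> sends both its indices
  beyond r. There are d c such factors of the first kind and c (c - 1) / 2 of the second, the latter
  counted with weight 2.\<close>

lemma pre_Q_exponent:
  fixes r n :: nat and s :: "nat \<Rightarrow> nat"
  assumes n: "n \<ge> 4" and s: "s permutes {1..n}"
  defines "c \<equiv> card {j \<in> {4..n}. s j > r}" and "d \<equiv> card {i \<in> {1, 2, 3}. s i > r}"
  shows "pre r (Q_exponent n s) + (d * c + c * (c - 1)) = min_deg n" "c + d = n - r" "d \<le> 3"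
proof -
  let ?C = "{j \<in> {4..n}. s j > r}" and ?D = "{i \<in> {1, 2, 3}. s i > r}"
  have "(\<Sum>p\<in>Q_pairs n. if min (s (fst p)) (s (snd p)) \<le> r then 1 else 0) + d * c = card (Q_pairs n)"
  proof -
    have "d * c = card (?D \<times> ?C)" by (simp add: c_def d_def card_cartesian_product)
    also have "?D \<times> ?C = {p \<in> Q_pairs n. \<not> min (s (fst p)) (s (snd p)) \<le> r}" by (auto simp: Q_pairs_def)
    also have "card \<dots> = (\<Sum>p\<in>Q_pairs n. if min (s (fst p)) (s (snd p)) \<le> r then 0 else 1)"
      by (simp add: sum.If_cases Int_def)
    finally have "(\<Sum>p\<in>Q_pairs n. if min (s (fst p)) (s (snd p)) \<le> r then 1 else 0) + d * c
       = (\<Sum>p\<in>Q_pairs n. (if min (s (fst p)) (s (snd p)) \<le> r then 1 else 0) + (if min (s (fst p)) (s (snd p)) \<le> r then 0 else 1))"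
      by (simp add: sum.distrib)
    also have "\<dots> = (\<Sum>p\<in>Q_pairs n. 1)" by (rule sum.cong) auto
    finally show ?thesis by simp
  qed
  moreover have "(\<Sum>p\<in>upper_pairs {4..n}. if min (s (fst p)) (s (snd p)) \<le> r then 2 else 0) + c * (c - 1)
     = 2 * card (upper_pairs {4..n})"
  proof -
    have "c * (c - 1) = 2 * card (upper_pairs ?C)" by (simp add: c_def card_upper_pairs)
    also have "upper_pairs ?C = {p \<in> upper_pairs {4..n}. \<not> min (s (fst p)) (s (snd p)) \<le> r}"
      by (auto simp: upper_pairs_def)
    also have "2 * card \<dots> = (\<Sum>p\<in>upper_pairs {4..n}. if min (s (fst p)) (s (snd p)) \<le> r then 0 else 2)"
      by (simp add: sum.If_cases Int_def)
    finally have "(\<Sum>p\<in>upper_pairs {4..n}. if min (s (fst p)) (s (snd p)) \<le> r then 2 else 0) + c * (c - 1)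
       = (\<Sum>p\<in>upper_pairs {4..n}. (if min (s (fst p)) (s (snd p)) \<le> r then 2 else 0) + (if min (s (fst p)) (s (snd p)) \<le> r then 0 else 2))"
      by (simp add: sum.distrib)
    also have "\<dots> = (\<Sum>p\<in>upper_pairs {4..n}. 2)" by (rule sum.cong) auto
    finally show ?thesis by simp
  qed
  ultimately show "pre r (Q_exponent n s) + (d * c + c * (c - 1)) = min_deg n"
    using min_deg_eq_card[OF n] by (simp add: Q_exponent_def pre_add pre_sum)
  have "{i \<in> {1..n}. s i > r} = ?C \<union> ?D" using n by auto
  moreover have "card (?C \<union> ?D) = c + d" unfolding c_def d_def by (rule card_Un_disjoint) auto
  ultimately show "c + d = n - r" using card_permutes_gt[OF s, of r] by simp
  have "card ?D \<le> card {1, 2, 3::nat}" by (rule card_mono) auto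
  then show "d \<le> 3" by (simp add: d_def)
qed

text \<open>Since c + d = n - r, the deficit d c + c (c - 1) equals c (n - r - 1), and d \<le> 3
  forces c \<ge> n - r - 3. The deficit of \<lambda> is this extreme value.\<close>

lemma pre_Q_exponent_le:
  assumes n: "n \<ge> 4" and s: "s permutes {1..n}"
  shows "pre r (Q_exponent n s) \<le> pre r (mon_of n (jack_lambda n))"
proof -
  let ?c = "card {j \<in> {4..n}. s j > r}" and ?d = "card {i \<in> {1, 2, 3}. s i > r}"
  note * = pre_Q_exponent[OF n s, of r]
  have "?d * ?c + ?c * (?c - 1) = ?c * (n - r - 1)"
    unfolding *(2)[symmetric] by (cases ?c) (auto simp: algebra_simps)
  moreover have "(n - r - 3) * (n - r - 1) \<le> ?c * (n - r - 1)" using *(2,3) by (intro mult_right_mono) auto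
  ultimately show ?thesis using *(1) pre_jack_lambda[OF n, of r] by linarith
qed

text \<open>Equality in all prefix bounds means that 4..n occupies the first n - 3 places. Every
  factor between the two blocks is then inverted, so the sign is the same for all such
  permutations.\<close>

lemma lookup_Q_summand_jack_lambda:
  assumes n: "n \<ge> 4" and s: "s permutes {1..n}"
  shows "lookup (ren s (Q_summand n)) (mon_of n (jack_lambda n))
     = (if s ` {4..n} \<subseteq> {1..n - 3} then (- 1) ^ card (Q_pairs n) else 0)"
proof (cases "s ` {4..n} \<subseteq> {1..n - 3}")
  case False
  then obtain j where j: "j \<in> {4..n}" "s j \<notin> {1..n - 3}" by blast
  moreover have "s j \<in> {1..n}" using permutes_in_image[OF s] j(1) by auto
  ultimately have "j \<in> {j \<in> {4..n}. s j > n - 3}" by auto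
  moreover have "finite {j \<in> {4..n}. s j > n - 3}" by simp
  ultimately have c: "card {j \<in> {4..n}. s j > n - 3} > 0" using card_gt_0_iff by blast
  have "mon_of n (jack_lambda n) \<notin> keys (ren s (Q_summand n))"
  proof
    assume "mon_of n (jack_lambda n) \<in> keys (ren s (Q_summand n))"
    then have le: "pre (n - 3) (mon_of n (jack_lambda n)) \<le> pre (n - 3) (Q_exponent n s)"
      using lead_Q_summand[OF s] by (auto simp: lead_def)
    let ?c = "card {j \<in> {4..n}. s j > n - 3}" and ?d = "card {i \<in> {1, 2, 3}. s i > n - 3}"
    have "(n - (n - 3) - 3) * (n - (n - 3) - 1) = 0" using n by simp
    \<comment> \<open>Beyond the prefix n - 3 the exponent \<lambda> has only zeros, so no factor
      may have both variables there; with three places left and c > 0 this is impossible.\<close>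
    then have 1: "?d * ?c + ?c * (?c - 1) = 0"
      using pre_Q_exponent(1)[OF n s, of "n - 3"] pre_jack_lambda[OF n, of "n - 3"] le by linarith
    have 2: "?c + ?d = 3" using pre_Q_exponent(2)[OF n s, of "n - 3"] n by linarith
    have "False" if "d * c + c * (c - 1) = 0" "c + d = 3" "c > 0" for c d :: nat using that by auto
    from this[OF 1 2 c] show False .
  qed
  then show ?thesis using False by (simp add: in_keys_iff)
next
  case True
  have im: "s ` {4..n} = {1..n - 3}"
  proof (rule card_subset_eq)
    show "card (s ` {4..n}) = card {1..n - 3}"
      using permutes_inj[OF s] by (subst card_image) (auto intro: inj_on_subset)
  qed (use True in auto)
  have gt: "s i > n - 3" if i: "i \<in> {1, 2, 3}" for i
  proof (rule ccontr)
    assume le: "\<not> s i > n - 3"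
    have "i \<in> {1..n}" using i n by auto
    then have "s i \<in> {1..n}" unfolding permutes_in_image[OF s] .
    with le have "s i \<in> s ` {4..n}" using im by simp
    then show False using i by (auto simp: inj_eq[OF permutes_inj[OF s]])
  qed
  have "Q_exponent n s = mon_of n (jack_lambda n)"
  proof (rule pre_inject)
    fix r
    let ?c = "card {j \<in> {4..n}. s j > r}" and ?d = "card {i \<in> {1, 2, 3}. s i > r}"
    note * = pre_Q_exponent[OF n s, of r]
    have "?d * ?c + ?c * (?c - 1) = (n - r - 3) * (n - r - 1)"
    proof (cases "r \<le> n - 3")
      case True
      then have "{i \<in> {1, 2, 3}. s i > r} = {1, 2, 3}" using gt by fastforce
      then have d: "?d = 3" by simp
      then obtain c where "?c = c" "n - r = c + 3" using *(2) by auto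
      then show ?thesis using d by (cases c) (auto simp: algebra_simps)
    next
      case False
      have "s j \<le> r" if "j \<in> {4..n}" for j
      proof -
        have "s j \<in> {1..n - 3}" using im that by blast
        then show ?thesis using False by simp
      qed
      then have "{j \<in> {4..n}. s j > r} = {}" by force
      then have "?c = 0" by (metis card.empty)
      then show ?thesis using False by simp
    qed
    then show "pre r (Q_exponent n s) = pre r (mon_of n (jack_lambda n))"
      using *(1) pre_jack_lambda[OF n, of r] by linarith
  qed
  moreover have "(\<Prod>p\<in>Q_pairs n. if s (fst p) < s (snd p) then 1 else - 1) = (\<Prod>p\<in>Q_pairs n. - 1 :: complex)"
  proof (intro prod.cong refl)
    fix p assume "p \<in> Q_pairs n"
    then have p: "fst p \<in> {1, 2, 3}" "snd p \<in> {4..n}" by (auto simp: Q_pairs_def)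
    then have "s (snd p) \<in> {1..n - 3}" using im by blast
    then show "(if s (fst p) < s (snd p) then 1 else - 1) = (- 1 :: complex)" using gt[OF p(1)] by simp
  qed
  ultimately show ?thesis using lead_Q_summand[OF s] True by (simp add: lead_def)
qed

text \<open>The contributing permutations all carry the same sign, so nothing cancels; the shift of
  4..n down by 3 extends to one of them.\<close>

lemma lookup_Q_poly_jack_lambda:
  assumes n: "n \<ge> 4"
  shows "lookup (Q_poly n) (mon_of n (jack_lambda n)) \<noteq> 0"
proof -
  let ?P = "{s. s permutes {1..n}}" and ?G = "{s. s permutes {1..n} \<and> s ` {4..n} \<subseteq> {1..n - 3}}"
  have fin: "finite ?P" by (simp add: finite_permutations)
  have "lookup (Q_poly n) (mon_of n (jack_lambda n))
     = (\<Sum>s\<in>?P. if s ` {4..n} \<subseteq> {1..n - 3} then (- 1) ^ card (Q_pairs n) else 0)"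
    unfolding Q_poly_eq lookup_sum by (intro sum.cong refl lookup_Q_summand_jack_lambda[OF n]) auto
  also have "\<dots> = of_nat (card ?G) * (- 1) ^ card (Q_pairs n)"
    using fin by (simp add: sum.If_cases Int_def Collect_conj_eq[symmetric])
  finally have eq: "lookup (Q_poly n) (mon_of n (jack_lambda n)) = of_nat (card ?G) * (- 1) ^ card (Q_pairs n)" .
  have "inj_on (\<lambda>j. j - 3) {4..n}" "(\<lambda>j. j - 3) ` {4..n} \<subseteq> {1..n}" "{4..n} \<subseteq> {1..n}"
    by (auto simp: inj_on_def)
  then obtain s where s: "s permutes {1..n}" "\<And>j. j \<in> {4..n} \<Longrightarrow> s j = j - 3"
    using permutes_extend[of "{1..n}" "{4..n}" "\<lambda>j. j - 3"] by blast
  then have "s \<in> ?G" by auto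
  moreover have "finite ?G" using fin by (rule rev_finite_subset) auto
  ultimately have "card ?G \<noteq> 0" by auto
  then show ?thesis using eq by simp
qed

lemma pre_Q_poly:
  assumes "n \<ge> 4" "m \<in> keys (Q_poly n)"
  shows "pre r m \<le> pre r (mon_of n (jack_lambda n))"
proof -
  obtain s where "s permutes {1..n}" "m \<in> keys (ren s (Q_summand n))"
    using assms(2) keys_sum[of "\<lambda>s. ren s (Q_summand n)" "{s. s permutes {1..n}}"]
    unfolding Q_poly_eq by auto
  then show ?thesis using lead_Q_summand[of s n] pre_Q_exponent_le[OF assms(1), of s r]
    by (auto simp: lead_def intro: order_trans)
qed

section \<open>Weighted products\<close>

text \<open>
  Let \<open>F\<close> be the Vandermonde polynomial. The weight \<open>e(k, m) = \<Sum>\<^sub>i t\<^bsup>k\<^sub>i\<^esup> q\<^bsup>m\<^sub>i\<^esup>\<close> gives Macdonald's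
  operator multiplied by \<open>F\<close>, and its second-order limit for \<open>q \<rightarrow> 1\<close> has the weight
  \<open>e(k, m) = \<Sum>\<^sub>i (\<theta> k\<^sub>i + m\<^sub>i)\<^sup>2\<close>.
\<close>

definition Phi :: "(monomial \<Rightarrow> monomial \<Rightarrow> complex) \<Rightarrow> mpoly \<Rightarrow> mpoly \<Rightarrow> mpoly" where
  "Phi e F G = (\<Sum>k\<in>keys F. \<Sum>m\<in>keys G. single (k + m) (lookup F k * lookup G m * e k m))"

lemma Phi_add_left: "Phi e (F + F') G = Phi e F G + Phi e F' G"
  unfolding Phi_def
  by (rule setsum_keys_plus_distrib) (auto simp: single_add algebra_simps sum.distrib)

lemma Phi_add_right: "Phi e F (G + G') = Phi e F G + Phi e F G'"
  unfolding Phi_def sum.distrib[symmetric]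
  by (intro sum.cong refl setsum_keys_plus_distrib) (auto simp: single_add algebra_simps)

lemma Phi_zero_right [simp]: "Phi e F 0 = 0" and Phi_zero_left [simp]: "Phi e 0 G = 0"
  by (simp_all add: Phi_def)

lemma Phi_single [simp]: "Phi e (single k c) (single m d) = single (k + m) (c * d * e k m)"
  by (cases "c = 0"; cases "d = 0") (auto simp: Phi_def)

lemma Phi_sum_right: "Phi e F (sum G A) = (\<Sum>a\<in>A. Phi e F (G a))"
  by (rule additive_sum) (rule Phi_add_right)

lemma biadditive_induct:
  fixes P :: "mpoly \<Rightarrow> mpoly \<Rightarrow> bool"
  assumes "\<And>F. P F 0" "\<And>G. P 0 G" "\<And>F F' G. P F G \<Longrightarrow> P F' G \<Longrightarrow> P (F + F') G"
    "\<And>F G G'. P F G \<Longrightarrow> P F G' \<Longrightarrow> P F (G + G')" "\<And>k c m d. P (single k c) (single m d)"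
  shows "P F G"
proof (induction F rule: poly_mapping_additive_induct)
  case (single k c)
  show ?case by (induction G rule: poly_mapping_additive_induct) (auto intro: assms)
qed (auto intro: assms)

lemma cscale_single [simp]: "cscale c (single m d) = single m (c * d)"
  by (simp add: cscale_def mult_single)

lemma cscale_zero [simp]: "cscale c 0 = 0" "cscale 0 f = 0"
  by simp_all

lemma Phi_cscale_right: "Phi e F (cscale c G) = cscale c (Phi e F G)"
  by (induction F G rule: biadditive_induct) (auto simp: Phi_add_left Phi_add_right cscale_add algebra_simps)

lemma Phi_uminus_left: "Phi e (- F) G = - Phi e F G"
  by (metis Phi_add_left Phi_zero_left add.right_inverse add_eq_0_iff)

lemma Phi_diff_weight: "Phi (\<lambda>k m. e k m - E) F G = Phi e F G - cscale E (F * G)"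
proof (induction F G rule: biadditive_induct)
  case (5 k c m d)
  then show ?case by (simp add: mult_single algebra_simps flip: single_diff)
qed (auto simp: Phi_add_left Phi_add_right cscale_add algebra_simps)

lemma Phi_ren:
  assumes "\<And>k m. e (mren s k) (mren s m) = e k m"
  shows "ren s (Phi e F G) = Phi e (ren s F) (ren s G)"
  by (induction F G rule: biadditive_induct)
    (auto simp: Phi_add_left Phi_add_right ren_add mren_add assms)

lemma lookup_Phi:
  "lookup (Phi e F G) N
   = (\<Sum>k\<in>keys F. \<Sum>m\<in>keys G. if k + m = N then lookup F k * lookup G m * e k m else 0)"
  by (simp add: Phi_def lookup_sum lookup_single when_def)

lemma keys_Phi:
  assumes "N \<in> keys (Phi e F G)"
  obtains k m where "k \<in> keys F" "m \<in> keys G" "N = k + m"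
proof (rule ccontr)
  assume "\<not> thesis"
  then have "k + m \<noteq> N" if "k \<in> keys F" "m \<in> keys G" for k m
    using \<open>k \<in> keys F\<close> \<open>m \<in> keys G\<close> \<open>\<And>k m. k \<in> keys F \<Longrightarrow> m \<in> keys G \<Longrightarrow> N = k + m \<Longrightarrow> thesis\<close> by blast
  then have "lookup (Phi e F G) N = 0" by (simp add: lookup_Phi)
  then show False using assms by (simp add: in_keys_iff)
qed

lemma homogeneous_Phi:
  assumes "homogeneous d F" "homogeneous d' G"
  shows "homogeneous (d + d') (Phi e F G)"
  unfolding homogeneous_def
proof
  fix N assume "N \<in> keys (Phi e F G)"
  then obtain k m where "k \<in> keys F" "m \<in> keys G" "N = k + m" by (rule keys_Phi)
  then show "mon_degree N = d + d'" using assms by (simp add: homogeneous_def mon_degree_add)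
qed

lemma mpolys_Phi:
  assumes "F \<in> mpolys n" "G \<in> mpolys n"
  shows "Phi e F G \<in> mpolys n"
proof -
  have "keys N \<subseteq> {1..n}" if N: "N \<in> keys (Phi e F G)" for N
  proof -
    obtain k m where "k \<in> keys F" "m \<in> keys G" "N = k + m" using N by (rule keys_Phi)
    then show ?thesis using assms keys_add[of k m] unfolding mpolys_def by blast
  qed
  then show ?thesis by (simp add: mpolys_def)
qed

definition sum_weight ::
    "nat \<Rightarrow> (nat \<Rightarrow> nat \<Rightarrow> complex) \<Rightarrow> monomial \<Rightarrow> monomial \<Rightarrow> complex" where
  "sum_weight n w k m = (\<Sum>i\<in>{1..n}. w (lookup k i) (lookup m i))"

lemma sum_weight_mren:
  assumes "s permutes {1..n}"
  shows "sum_weight n w (mren s k) (mren s m) = sum_weight n w k m"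
proof -
  have "sum_weight n w (mren s k) (mren s m)
     = (\<Sum>i\<in>{1..n}. w (lookup (mren s k) (s i)) (lookup (mren s m) (s i)))"
    unfolding sum_weight_def using sum.permute[OF assms, of "\<lambda>i. w (lookup (mren s k) i) (lookup (mren s m) i)"]
    by (simp add: comp_def)
  then show ?thesis by (simp add: sum_weight_def lookup_mren_bij permutes_bij[OF assms])
qed

section \<open>Monomial symmetric functions and the dominance order\<close>

definition orb :: "nat \<Rightarrow> nat list \<Rightarrow> monomial set" where
  "orb n mu = {m. keys m \<subseteq> {1..n} \<and> mset (map (lookup m) [1..<Suc n]) = mset mu}"

lemma mset_map_upt: "mset (map f [1..<Suc n]) = image_mset f (mset_set {1..n})"
  by (simp add: atLeastLessThanSuc_atLeastAtMost del: upt_Suc)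

lemma in_orb_iff:
  "m \<in> orb n mu \<longleftrightarrow> keys m \<subseteq> {1..n} \<and> image_mset (lookup m) (mset_set {1..n}) = mset mu"
  unfolding orb_def mset_map_upt by simp

lemma mset_list_nth: "length mu = n \<Longrightarrow> mset mu = image_mset (lookup (mon_of n mu)) (mset_set {1..n})"
proof -
  assume l: "length mu = n"
  have "map (lookup (mon_of n mu)) [1..<Suc n] = mu"
    using l by (intro nth_equalityI) (auto simp: lookup_mon_of simp del: upt_Suc)
  then show ?thesis using mset_map_upt[of "lookup (mon_of n mu)" n] by simp
qed

lemma keys_mon_of: "keys (mon_of n mu) \<subseteq> {1..n}"
  by (auto simp: in_keys_iff lookup_mon_of split: if_splits)

lemma lookup_mren_permutes:
  "s permutes {1..n} \<Longrightarrow> lookup (mren s m) (s i) = lookup m i"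
  by (simp add: lookup_mren_bij permutes_bij)

lemma keys_mren_permutes:
  assumes "s permutes {1..n}" "keys m \<subseteq> {1..n}"
  shows "keys (mren s m) \<subseteq> {1..n}"
  using keys_mren_subset[of s m] assms permutes_image[OF assms(1)] by blast

lemma orb_iff:
  assumes l: "length mu = n"
  shows "m \<in> orb n mu \<longleftrightarrow> (\<exists>s. s permutes {1..n} \<and> m = mren s (mon_of n mu))"
proof
  assume m: "m \<in> orb n mu"
  then have "image_mset (lookup (mon_of n mu)) (mset_set {1..n}) = image_mset (lookup m) (mset_set {1..n})"
    using l by (simp add: in_orb_iff mset_list_nth)
  then obtain s where s: "s permutes {1..n}" "\<forall>i\<in>{1..n}. lookup (mon_of n mu) i = lookup m (s i)"
    by (rule image_mset_eq_implies_permutes[rotated]) auto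
  have "mren s (mon_of n mu) = m"
  proof (rule poly_mapping_eqI)
    fix j
    obtain i where j: "j = s i" using permutes_bij[OF s(1)] by (metis bij_pointE)
    show "lookup (mren s (mon_of n mu)) j = lookup m j"
    proof (cases "i \<in> {1..n}")
      case True
      then show ?thesis using s by (simp add: j lookup_mren_permutes)
    next
      case False
      then have "s i = i" using s(1) by (simp add: permutes_def)
      then have "i \<notin> keys m" using m False by (auto simp: orb_def)
      then show ?thesis using False \<open>s i = i\<close> lookup_mren_permutes[OF s(1), of "mon_of n mu" i]
        by (auto simp: j lookup_mon_of in_keys_iff)
    qed
  qed
  then show "\<exists>s. s permutes {1..n} \<and> m = mren s (mon_of n mu)" using s(1) by blast
next
  assume "\<exists>s. s permutes {1..n} \<and> m = mren s (mon_of n mu)"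
  then obtain s where s: "s permutes {1..n}" "m = mren s (mon_of n mu)" by blast
  have "image_mset (lookup m) (mset_set {1..n}) = image_mset (lookup m) (image_mset s (mset_set {1..n}))"
    by (simp only: permutes_image_mset[OF s(1)])
  also have "\<dots> = image_mset (lookup (mon_of n mu)) (mset_set {1..n})"
    by (simp add: image_mset.compositionality comp_def s(2) lookup_mren_permutes[OF s(1)])
  finally show "m \<in> orb n mu" using s l keys_mren_permutes[OF s(1) keys_mon_of]
    by (simp add: in_orb_iff mset_list_nth)
qed

lemma mon_of_in_orb: "length mu = n \<Longrightarrow> mon_of n mu \<in> orb n mu"
  unfolding orb_iff by (rule exI[of _ id]) (simp add: permutes_id del: id_apply)

lemma orb_mren:
  assumes "length mu = n" "s permutes {1..n}"
  shows "mren s m \<in> orb n mu \<longleftrightarrow> m \<in> orb n mu"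
proof
  assume "m \<in> orb n mu"
  then obtain u where "u permutes {1..n}" "m = mren u (mon_of n mu)" using orb_iff[OF assms(1)] by blast
  then show "mren s m \<in> orb n mu"
    using orb_iff[OF assms(1)] assms(2) by (metis mren_mren permutes_compose)
next
  let ?i = "inv_into UNIV s"
  assume "mren s m \<in> orb n mu"
  then obtain u where u: "u permutes {1..n}" "mren s m = mren u (mon_of n mu)" using orb_iff[OF assms(1)] by blast
  have "m = mren ?i (mren s m)" unfolding mren_mren permutes_inv_o(2)[OF assms(2)] by simp
  also have "\<dots> = mren (?i \<circ> u) (mon_of n mu)" by (simp only: u(2) mren_mren)
  finally show "m \<in> orb n mu"
    using orb_iff[OF assms(1)] permutes_compose[OF u(1) permutes_inv[OF assms(2)]] by blast
qed

lemma finite_orb: "length mu = n \<Longrightarrow> finite (orb n mu)"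
proof -
  assume l: "length mu = n"
  have "orb n mu \<subseteq> (\<lambda>s. mren s (mon_of n mu)) ` {s. s permutes {1..n}}" using orb_iff[OF l] by auto
  then show ?thesis by (rule finite_subset) (simp add: finite_permutations)
qed

lemma msym_eq_orb: "msym n mu = (\<Sum>m\<in>orb n mu. single m 1)"
  by (simp add: msym_def orb_def)

lemma lookup_msym: "length mu = n \<Longrightarrow> lookup (msym n mu) m = (if m \<in> orb n mu then 1 else 0)"
  by (simp add: msym_eq_orb lookup_sum lookup_single when_def finite_orb sum.delta)

lemma keys_msym: "length mu = n \<Longrightarrow> keys (msym n mu) = orb n mu"
  by (auto simp: in_keys_iff lookup_msym split: if_splits)

lemma ren_eqI_lookup:
  assumes "bij s" "\<And>m. lookup f (mren s m) = lookup f m"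
  shows "ren s f = f"
proof (rule poly_mapping_eqI)
  fix N
  have "N = mren s (Poly_Mapping.map_key s N)" by (simp add: mren_map_key[OF assms(1)])
  then show "lookup (ren s f) N = lookup f N" using lookup_ren_bij[OF assms(1)] assms(2) by metis
qed

lemma ren_msym: "length mu = n \<Longrightarrow> s permutes {1..n} \<Longrightarrow> ren s (msym n mu) = msym n mu"
  by (rule ren_eqI_lookup) (auto simp: permutes_bij lookup_msym orb_mren)

lemma mpolys_msym: "length mu = n \<Longrightarrow> msym n mu \<in> mpolys n"
  by (auto simp: mpolys_def keys_msym orb_def)

lemma lookup_sym_orb:
  assumes "\<And>s. s permutes {1..n} \<Longrightarrow> ren s f = f" "length mu = n" "m \<in> orb n mu"
  shows "lookup f m = lookup f (mon_of n mu)"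
proof -
  obtain s where s: "s permutes {1..n}" "m = mren s (mon_of n mu)" using assms(2,3) orb_iff by blast
  then show ?thesis using assms(1)[OF s(1)] lookup_ren_bij[OF permutes_bij[OF s(1)], of f "mon_of n mu"] by simp
qed

lemma ex_partition_orb:
  assumes "keys m \<subseteq> {1..n}"
  obtains mu where "is_partition n mu" "m \<in> orb n mu"
proof -
  let ?l = "rev (sort (map (lookup m) [1..<Suc n]))"
  have "is_partition n ?l" by (simp add: is_partition_def sorted_wrt_rev del: upt_Suc)
  moreover have "m \<in> orb n ?l" using assms by (simp add: orb_def del: upt_Suc)
  ultimately show ?thesis by (rule that)
qed

lemma partition_orb_unique:
  assumes "is_partition n mu" "is_partition n nu" "m \<in> orb n mu" "m \<in> orb n nu"
  shows "mu = nu"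
proof -
  have "sort nu = rev mu"
    by (rule properties_for_sort) (use assms in \<open>auto simp: orb_def is_partition_def sorted_wrt_rev\<close>)
  moreover have "sort nu = rev nu"
    by (rule properties_for_sort) (use assms in \<open>auto simp: is_partition_def sorted_wrt_rev\<close>)
  ultimately show ?thesis by simp
qed

lemma partition_antimono:
  assumes "is_partition n mu" "1 \<le> i" "i \<le> j"
  shows "lookup (mon_of n mu) j \<le> lookup (mon_of n mu) i"
proof (cases "i < j \<and> j \<le> n")
  case True
  then have "mu ! (j - 1) \<le> mu ! (i - 1)"
    using assms sorted_wrt_nth_less[of "(\<ge>)" mu "i - 1" "j - 1"] by (auto simp: is_partition_def)
  then show ?thesis using True assms(2) by (simp add: lookup_mon_of)
next
  case False
  then show ?thesis using assms(2,3) by (auto simp: lookup_mon_of)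
qed

text \<open>The indices of K beyond r are exchanged for the equally many indices up to r that K
  misses; the value \<open>a r\<close> separates the two groups.\<close>

lemma sum_le_sum_top:
  fixes a :: "nat \<Rightarrow> nat"
  assumes anti: "\<And>i j. 1 \<le> i \<Longrightarrow> i \<le> j \<Longrightarrow> a j \<le> a i"
    and K: "finite K" "K \<subseteq> {1..}" "card K = r"
  shows "sum a K \<le> sum a {1..r}"
proof -
  let ?R = "{1..r}"
  have "card (K - ?R) = card K - card (K \<inter> ?R)" using K(1) by (simp add: card_Diff_subset_Int)
  moreover have "card (?R - K) = card ?R - card (K \<inter> ?R)" by (simp add: card_Diff_subset_Int Int_commute)
  ultimately have c: "card (K - ?R) = card (?R - K)" using K(3) by simp
  have "sum a (K - ?R) \<le> of_nat (card (K - ?R)) * a r"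
  proof (rule sum_bounded_above)
    fix i assume i: "i \<in> K - ?R"
    then have "r \<ge> 1" using K by (cases r) auto
    moreover have "i \<ge> 1" using i K(2) by auto
    ultimately show "a i \<le> a r" using i by (intro anti) auto
  qed
  also have "\<dots> \<le> sum a (?R - K)" unfolding c by (rule sum_bounded_below) (auto intro: anti)
  finally have "sum a (K \<inter> ?R) + sum a (K - ?R) \<le> sum a (?R \<inter> K) + sum a (?R - K)" by (simp add: Int_commute)
  then show ?thesis using K(1) by (simp add: sum.Int_Diff[symmetric])
qed

lemma pre_eq_sum: "keys m \<subseteq> {1..n} \<Longrightarrow> pre r m = (\<Sum>i\<in>{1..r}. lookup m i)"
proof -
  assume k: "keys m \<subseteq> {1..n}"
  then have "0 \<notin> keys m" by auto
  then have "lookup m 0 = 0" by (simp add: in_keys_iff)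
  moreover have "{..r} = insert 0 {1..r}" by auto
  ultimately show ?thesis by (simp add: pre_def)
qed

lemma pre_eq_mon_degree: "keys m \<subseteq> {1..n} \<Longrightarrow> pre n m = mon_degree m"
  unfolding pre_eq_sum mon_degree_def
  by (rule sum.mono_neutral_right) (auto simp: in_keys_iff)

lemma pre_orb:
  assumes mu: "is_partition n mu" and m: "m \<in> orb n mu"
  shows "pre r m \<le> pre r (mon_of n mu)" "mon_degree m = mon_degree (mon_of n mu)"
proof -
  obtain s where s: "s permutes {1..n}" "m = mren s (mon_of n mu)"
    using m orb_iff[of mu n] mu by (auto simp: is_partition_def)
  then show "mon_degree m = mon_degree (mon_of n mu)" by simp
  let ?p = "inv_into UNIV s"
  have p: "?p permutes {1..n}" using s(1) by (rule permutes_inv)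
  have "lookup m i = lookup (mon_of n mu) (?p i)" for i
    using lookup_mren_permutes[OF s(1), of "mon_of n mu" "?p i"] s permutes_inverses(1)[OF s(1)] by simp
  then have "pre r m = (\<Sum>i\<in>{1..r}. lookup (mon_of n mu) (?p i))"
    using m by (simp add: pre_eq_sum[of m n] orb_def)
  also have "\<dots> = sum (lookup (mon_of n mu)) (?p ` {1..r})"
    using permutes_inj[OF p] by (subst sum.reindex) (auto intro: inj_on_subset)
  also have "\<dots> \<le> sum (lookup (mon_of n mu)) {1..r}"
  proof (rule sum_le_sum_top)
    show "card (?p ` {1..r}) = r" using permutes_inj[OF p] by (subst card_image) (auto intro: inj_on_subset)
    show "?p ` {1..r} \<subseteq> {1..}"
    proof (rule image_subsetI)
      fix i assume "i \<in> {1..r}"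
      then have "?p i \<noteq> ?p 0" unfolding inj_eq[OF permutes_inj[OF p]] by simp
      moreover have "?p 0 = 0" by (rule permutes_not_in[OF p]) simp
      ultimately have "?p i \<noteq> 0" by metis
      then show "?p i \<in> {1..}" by (simp add: Suc_le_eq One_nat_def)
    qed
  qed (use partition_antimono[OF mu] in auto)
  also have "\<dots> = pre r (mon_of n mu)" by (simp add: pre_eq_sum[OF keys_mon_of])
  finally show "pre r m \<le> pre r (mon_of n mu)" .
qed

lemma pre_mon_of: "length mu = n \<Longrightarrow> pre r (mon_of n mu) = sum_list (take r mu)"
proof (induction r)
  case 0
  then show ?case by (simp add: pre_def lookup_mon_of)
next
  case (Suc r)
  then show ?case by (cases "r < n") (auto simp: pre_Suc lookup_mon_of take_Suc_conv_app_nth)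
qed

lemma dominated_iff:
  assumes "length mu = n" "length nu = n"
  shows "dominated nu mu \<longleftrightarrow> mon_degree (mon_of n nu) = mon_degree (mon_of n mu)
     \<and> (\<forall>r. pre r (mon_of n nu) \<le> pre r (mon_of n mu))"
proof -
  have "sum_list mu = mon_degree (mon_of n mu)" if "length mu = n" for mu
    using pre_mon_of[OF that, of n] pre_eq_mon_degree[OF keys_mon_of, of n mu] that by simp
  then show ?thesis using assms by (simp add: dominated_def pre_mon_of)
qed

lemma dominated_trans: "dominated a b \<Longrightarrow> dominated b c \<Longrightarrow> dominated a c"
  by (auto simp: dominated_def intro: order_trans)

lemma dominated_refl: "dominated a a"
  by (simp add: dominated_def)

lemma mon_of_inject: "length mu = n \<Longrightarrow> length nu = n \<Longrightarrow> mon_of n mu = mon_of n nu \<longleftrightarrow> mu = nu"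
proof
  assume l: "length mu = n" "length nu = n" and eq: "mon_of n mu = mon_of n nu"
  show "mu = nu"
  proof (rule nth_equalityI)
    fix i assume "i < length mu"
    then show "mu ! i = nu ! i" using l arg_cong[OF eq, of "\<lambda>m. lookup m (Suc i)"] by (simp add: lookup_mon_of)
  qed (use l in simp)
qed simp

definition below :: "nat \<Rightarrow> nat list \<Rightarrow> nat list set" where
  "below n lam = {mu. is_partition n mu \<and> dominated mu lam}"

lemma finite_below: "finite (below n lam)"
proof (rule finite_subset)
  show "below n lam \<subseteq> {mu. set mu \<subseteq> {..sum_list lam} \<and> length mu = n}"
  proof
    fix mu assume "mu \<in> below n lam"
    then have l: "length mu = n" and s: "sum_list mu = sum_list lam"
      by (simp_all add: below_def is_partition_def dominated_def)
    have "set mu \<subseteq> {..sum_list mu}" by (auto intro: member_le_sum_list)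
    then show "mu \<in> {mu. set mu \<subseteq> {..sum_list lam} \<and> length mu = n}" using l s by simp
  qed
qed (simp add: finite_lists_length_eq)

lemma below_partition: "mu \<in> below n lam \<Longrightarrow> is_partition n mu"
  and below_length: "mu \<in> below n lam \<Longrightarrow> length mu = n"
  by (auto simp: below_def is_partition_def)

text \<open>A number that strictly increases along the dominance order, so that triangularity for a
  partial order becomes recursion along a natural number.\<close>

definition height :: "nat \<Rightarrow> nat list \<Rightarrow> nat" where
  "height n mu = (\<Sum>r\<le>n. pre r (mon_of n mu))"

lemma pre_ge: "keys m \<subseteq> {1..n} \<Longrightarrow> n \<le> r \<Longrightarrow> pre r m = pre n m"
  unfolding pre_eq_sum by (rule sum.mono_neutral_right) (auto simp: in_keys_iff)

lemma height_less:
  assumes "is_partition n mu" "is_partition n nu" "dominated nu mu" "nu \<noteq> mu"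
  shows "height n nu < height n mu"
  unfolding height_def
proof (rule sum_strict_mono_ex1)
  have l: "length mu = n" "length nu = n" using assms by (auto simp: is_partition_def)
  then show "\<forall>r\<in>{..n}. pre r (mon_of n nu) \<le> pre r (mon_of n mu)"
    using assms(3) dominated_iff[OF l] by blast
  show "\<exists>r\<in>{..n}. pre r (mon_of n nu) < pre r (mon_of n mu)"
  proof (rule ccontr)
    assume "\<not> ?thesis"
    then have eq: "pre r (mon_of n nu) = pre r (mon_of n mu)" if "r \<le> n" for r
      using that assms(3) dominated_iff[OF l] by (metis atMost_iff le_neq_implies_less)
    have "pre r (mon_of n nu) = pre r (mon_of n mu)" for r
      using eq pre_ge[OF keys_mon_of] by (cases "r \<le> n") (metis, metis nle_le)
    then have "mon_of n nu = mon_of n mu" by (rule pre_inject)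
    then show False using mon_of_inject[OF l(2,1)] assms(4) by simp
  qed
qed simp

section \<open>Triangularity\<close>

abbreviation eigenvalue :: "nat \<Rightarrow> (nat \<Rightarrow> nat \<Rightarrow> complex) \<Rightarrow> nat list \<Rightarrow> complex" where
  "eigenvalue n w mu \<equiv> sum_weight n w (delta n) (mon_of n mu)"

lemma keys_delta: "keys (delta n) \<subseteq> {1..n}"
  by (auto simp: in_keys_iff lookup_delta split: if_splits)

lemma mon_degree_vdm: "k \<in> keys (vdm n) \<Longrightarrow> mon_degree k = mon_degree (delta n)"
proof -
  assume "k \<in> keys (vdm n)"
  moreover have "delta n \<in> keys (vdm n)" by (simp add: in_keys_iff lookup_vdm_delta)
  ultimately show ?thesis using homogeneous_vdm[of n] by (simp add: homogeneous_def)
qed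

text \<open>In every prefix sum the monomials of V stay below \<delta> and those of the orbit below
  \<mu>, so k + m = \<delta> + \<nu> forces \<nu> below \<mu>.\<close>

lemma lookup_Phi_msym_dominated:
  assumes "is_partition n mu" "is_partition n nu"
    and nz: "lookup (Phi e (vdm n) (msym n mu)) (delta n + mon_of n nu) \<noteq> 0"
  shows "dominated nu mu"
proof -
  have l: "length mu = n" "length nu = n" using assms(1,2) by (auto simp: is_partition_def)
  from nz have "delta n + mon_of n nu \<in> keys (Phi e (vdm n) (msym n mu))" by (simp add: in_keys_iff)
  then obtain k m where km: "k \<in> keys (vdm n)" "m \<in> keys (msym n mu)" "delta n + mon_of n nu = k + m"
    by (rule keys_Phi)
  then have m: "m \<in> orb n mu" by (simp add: keys_msym l)
  have "mon_degree (mon_of n nu) = mon_degree (mon_of n mu)"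
    using arg_cong[OF km(3), of mon_degree] mon_degree_vdm[OF km(1)] pre_orb(2)[OF assms(1) m]
    by (simp add: mon_degree_add)
  moreover have "pre r (mon_of n nu) \<le> pre r (mon_of n mu)" for r
    using arg_cong[OF km(3), of "pre r"] pre_vdm[OF km(1), of r] pre_orb(1)[OF assms(1) m, of r]
    by (simp add: pre_add)
  ultimately show ?thesis by (simp add: dominated_iff l)
qed

lemma lookup_Phi_msym_diagonal:
  assumes nu: "is_partition n nu"
  shows "lookup (Phi e (vdm n) (msym n nu)) (delta n + mon_of n nu) = e (delta n) (mon_of n nu)"
proof -
  have l: "length nu = n" using nu by (simp add: is_partition_def)
  have "lookup (Phi e (vdm n) (msym n nu)) (delta n + mon_of n nu)
     = lookup (vdm n) (delta n) * lookup (msym n nu) (mon_of n nu) * e (delta n) (mon_of n nu)"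
    unfolding lookup_Phi
  proof (rule sum_keys_unique)
    fix k m assume "k \<in> keys (vdm n)" "m \<in> keys (msym n nu)" "k + m = delta n + mon_of n nu"
    then show "k = delta n \<and> m = mon_of n nu"
      using pre_add_eq_cancel[of k m] pre_vdm[of k n] pre_orb(1)[OF nu, of m] by (simp add: keys_msym l)
  qed
  then show ?thesis using l by (simp add: lookup_vdm_delta lookup_msym mon_of_in_orb)
qed

section \<open>The eigenvalue equation as a linear system\<close>

definition msum :: "nat \<Rightarrow> nat list \<Rightarrow> (nat list \<Rightarrow> complex) \<Rightarrow> mpoly" where
  "msum n lam u = (\<Sum>mu\<in>below n lam. cscale (u mu) (msym n mu))"

text \<open>Coefficients are compared only at exponents \<delta> + \<nu> with \<nu> a partition,
  because an antisymmetric polynomial is determined by these.\<close>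

definition system_coeff ::
    "nat \<Rightarrow> (nat \<Rightarrow> nat \<Rightarrow> complex) \<Rightarrow> complex \<Rightarrow> nat list \<Rightarrow> nat list \<Rightarrow> complex" where
  "system_coeff n w E nu mu =
     lookup (Phi (\<lambda>k m. sum_weight n w k m - E) (vdm n) (msym n mu)) (delta n + mon_of n nu)"

lemma ren_msum: "s permutes {1..n} \<Longrightarrow> ren s (msum n lam u) = msum n lam u"
  unfolding msum_def ren_sum by (intro sum.cong refl) (auto simp: ren_msym below_length)

lemma mpolys_msum: "msum n lam u \<in> mpolys n"
  unfolding msum_def by (intro mpolys_sum mpolys_cscale mpolys_msym) (auto simp: below_length)

lemma lookup_Phi_msum:
  "lookup (Phi (\<lambda>k m. sum_weight n w k m - E) (vdm n) (msum n lam u)) (delta n + mon_of n nu)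
   = (\<Sum>mu\<in>below n lam. u mu * system_coeff n w E nu mu)"
  by (simp add: msum_def Phi_sum_right Phi_cscale_right lookup_sum system_coeff_def)

lemma ren_Phi_vdm:
  assumes s: "s permutes {1..n}" and P: "ren s P = P"
  shows "ren s (Phi (\<lambda>k m. sum_weight n w k m - E) (vdm n) P)
     = Phi (\<lambda>k m. sum_weight n w k m - E) (ren s (vdm n)) P"
proof -
  have "ren s (Phi (\<lambda>k m. sum_weight n w k m - E) (vdm n) P)
     = Phi (\<lambda>k m. sum_weight n w k m - E) (ren s (vdm n)) (ren s P)"
    by (rule Phi_ren) (simp add: sum_weight_mren[OF s])
  then show ?thesis by (simp add: P)
qed

text \<open>An exponent with two equal entries is fixed by a transposition that negates its
  coefficient. Any other exponent is sorted by a permutation into a strictly decreasing one, and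
  that is \<delta> plus a partition.\<close>

lemma antisymmetric_eq_zeroI:
  assumes X: "X \<in> mpolys n"
    and swap: "\<And>i j. (i, j) \<in> upper_pairs {1..n} \<Longrightarrow> ren (swap i j) X = - X"
    and sgn: "\<And>s. s permutes {1..n} \<Longrightarrow> ren s X = X \<or> ren s X = - X"
    and dom: "\<And>nu. is_partition n nu \<Longrightarrow> lookup X (delta n + mon_of n nu) = 0"
  shows "X = 0"
proof (rule poly_mapping_eqI)
  fix N
  have "lookup X N = 0" if N: "keys N \<subseteq> {1..n}"
  proof (cases "\<exists>i j. (i, j) \<in> upper_pairs {1..n} \<and> lookup N i = lookup N j")
    case True
    then obtain i j where ij: "(i, j) \<in> upper_pairs {1..n}" "lookup N i = lookup N j" by blast
    let ?t = "swap i j"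
    have "mren ?t N = N"
    proof (rule poly_mapping_eqI)
      fix k
      have "lookup (mren ?t N) (?t (?t k)) = lookup N (?t k)" by (rule lookup_mren_bij) simp
      then show "lookup (mren ?t N) k = lookup N k" using ij(2) by (auto simp: Transposition.transpose_def split: if_splits)
    qed
    then have "lookup X N = lookup (ren ?t X) N" using lookup_ren_bij[of ?t X N] by simp
    then show ?thesis using swap[OF ij(1)] by simp
  next
    case False
    obtain mu where mu: "is_partition n mu" "N \<in> orb n mu" using ex_partition_orb[OF N] .
    then have l: "length mu = n" by (simp add: is_partition_def)
    obtain s where s: "s permutes {1..n}" "N = mren s (mon_of n mu)" using mu(2) orb_iff[OF l] by blast
    let ?a = "lookup (mon_of n mu)"
    have strict: "?a j < ?a i" if ij: "i \<in> {1..n}" "j \<in> {1..n}" "i < j" for i j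
    proof -
      have "s i \<in> {1..n}" "s j \<in> {1..n}" using ij unfolding permutes_in_image[OF s(1)] by auto
      moreover have "s i \<noteq> s j" using ij(3) unfolding inj_eq[OF permutes_inj[OF s(1)]] by simp
      ultimately have "(s i, s j) \<in> upper_pairs {1..n} \<or> (s j, s i) \<in> upper_pairs {1..n}"
        by (auto simp: upper_pairs_def)
      then have "lookup N (s i) \<noteq> lookup N (s j)" using False by metis
      then have "?a i \<noteq> ?a j" by (simp add: s(2) lookup_mren_permutes[OF s(1)])
      then show ?thesis using partition_antimono[OF mu(1), of i j] ij by simp
    qed
    have step: "?a (Suc i) < ?a i" if "i \<in> {1..<n}" for i
      using that by (intro strict) auto
    \<comment> \<open>Going down from the last entry, each step of a strictly decreasing sequence
      gains at least 1.\<close>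
    have ge: "n - i \<le> ?a i" if "1 \<le> i" "i \<le> n" for i
      using that(2,1)
    proof (induction i rule: inc_induct)
      case (step m)
      then show ?case using strict[of m "Suc m"] by fastforce
    qed simp
    \<comment> \<open>Removing the staircase \<delta> from a strictly decreasing exponent leaves a
      weakly decreasing one; \<open>ge\<close> makes the truncated subtraction exact.\<close>
    define nu where "nu = map (\<lambda>i. ?a (Suc i) - (n - Suc i)) [0..<n]"
    have nu_nth: "nu ! (i - 1) = ?a i - (n - i)" if "i \<in> {1..n}" for i
      using that by (cases i) (auto simp: nu_def)
    have "is_partition n nu"
      unfolding is_partition_def
    proof
      show "sorted_wrt (\<ge>) nu" unfolding sorted_wrt_iff_nth_less
      proof (intro allI impI)
        fix i j assume "i < j" "j < length nu"
        then have "j < n" by (simp add: nu_def)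
        have "k < n \<longrightarrow> nu ! k \<le> nu ! i" if "i \<le> k" for k
          using that
        proof (induction k rule: dec_induct)
          case (step k)
          show ?case
          proof
            assume "Suc k < n"
            then have "?a (Suc (Suc k)) < ?a (Suc k)" by (intro strict) auto
            then have "nu ! Suc k \<le> nu ! k" using \<open>Suc k < n\<close> by (simp add: nu_def)
            then show "nu ! Suc k \<le> nu ! i" using step.IH \<open>Suc k < n\<close> by simp
          qed
        qed simp
        then have "nu ! j \<le> nu ! i" using \<open>i < j\<close> \<open>j < n\<close> by simp
        then show "nu ! i \<ge> nu ! j" .
      qed
    qed (simp add: nu_def)
    moreover have "mon_of n mu = delta n + mon_of n nu"
    proof (rule poly_mapping_eqI)
      fix i
      show "?a i = lookup (delta n + mon_of n nu) i"
        using ge[of i] nu_nth[of i] by (auto simp: lookup_add lookup_delta lookup_mon_of)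
    qed
    ultimately have "lookup X (mon_of n mu) = 0" using dom by simp
    then have "lookup (ren s X) N = 0"
      unfolding s(2) lookup_ren_bij[OF permutes_bij[OF s(1)]] .
    then show ?thesis using sgn[OF s(1)] by auto
  qed
  then show "lookup X N = lookup 0 N"
    using X by (cases "N \<in> keys X") (auto simp: mpolys_def not_in_keys_iff_lookup_eq_zero)
qed

text \<open>The left side is antisymmetric, so its coefficients at \<delta> + \<nu> decide. For
  \<nu> outside \<open>below n lam\<close> they vanish by triangularity and transitivity of
  dominance.\<close>

lemma Phi_msum_eq_zero_iff:
  "Phi (\<lambda>k m. sum_weight n w k m - E) (vdm n) (msum n lam u) = 0 \<longleftrightarrow>
   (\<forall>nu\<in>below n lam. (\<Sum>mu\<in>below n lam. u mu * system_coeff n w E nu mu) = 0)"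
  (is "?X = 0 \<longleftrightarrow> ?R")
proof
  assume "?X = 0"
  then have "lookup ?X (delta n + mon_of n nu) = 0" for nu by simp
  then show ?R unfolding lookup_Phi_msum by blast
next
  assume R: ?R
  show "?X = 0"
  proof (rule antisymmetric_eq_zeroI)
    show "?X \<in> mpolys n" by (intro mpolys_Phi mpolys_vdm mpolys_msum)
    show "ren s ?X = ?X \<or> ren s ?X = - ?X" if "s permutes {1..n}" for s
      using ren_vdm[OF that] ren_Phi_vdm[OF that ren_msum[OF that]] by (auto simp: Phi_uminus_left)
    show "ren (swap i j) ?X = - ?X" if ij: "(i, j) \<in> upper_pairs {1..n}" for i j
    proof -
      have t: "swap i j permutes {1..n}"
        using ij by (intro transpose_permutes) (auto simp: upper_pairs_def)
      show ?thesis unfolding ren_Phi_vdm[OF t ren_msum[OF t]] ren_transpose_vdm[OF ij]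
        by (rule Phi_uminus_left)
    qed
    fix nu assume nu: "is_partition n nu"
    show "lookup ?X (delta n + mon_of n nu) = 0"
    proof (cases "nu \<in> below n lam")
      case True
      then show ?thesis using R unfolding lookup_Phi_msum by blast
    next
      case False
      have "system_coeff n w E nu mu = 0" if "mu \<in> below n lam" for mu
        using that False nu lookup_Phi_msym_dominated[of n mu nu] dominated_trans
        unfolding system_coeff_def below_def by blast
      then show ?thesis unfolding lookup_Phi_msum by simp
    qed
  qed
qed

lemma system_coeff_diagonal:
  "is_partition n nu \<Longrightarrow> system_coeff n w E nu nu = eigenvalue n w nu - E"
  by (simp add: system_coeff_def lookup_Phi_msym_diagonal)

lemma system_row:
  assumes "nu \<in> below n lam"
  shows "(\<Sum>mu\<in>below n lam. u mu * system_coeff n w E nu mu) = u nu * system_coeff n w E nu nu +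
     (\<Sum>mu\<in>{mu \<in> below n lam. height n nu < height n mu}. u mu * system_coeff n w E nu mu)"
proof -
  have "(\<Sum>mu\<in>below n lam. u mu * system_coeff n w E nu mu)
     = (\<Sum>mu\<in>insert nu {mu \<in> below n lam. height n nu < height n mu}. u mu * system_coeff n w E nu mu)"
  proof (rule sum.mono_neutral_right)
    show "\<forall>mu\<in>below n lam - insert nu {mu \<in> below n lam. height n nu < height n mu}. u mu * system_coeff n w E nu mu = 0"
      using assms height_less lookup_Phi_msym_dominated[of n _ nu]
      by (auto simp: system_coeff_def below_def)
  qed (use assms finite_below in auto)
  then show ?thesis using finite_below by (simp add: rev_finite_subset[OF finite_below])
qed

section \<open>Solving triangular systems\<close>

text \<open>Back substitution: row i yields the unknown i from those of larger \<open>h\<close>. The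
  value 1 at \<open>l\<close> is the normalization; elsewhere it is a default. The explicit
  recursion lets limits and rationality pass through the solution by induction.\<close>

function tri ::
    "'i set \<Rightarrow> ('i \<Rightarrow> nat) \<Rightarrow> 'i \<Rightarrow> ('i \<Rightarrow> 'i \<Rightarrow> 'a::field) \<Rightarrow> 'i \<Rightarrow> 'a" where
  "tri W h l B i = (if finite W \<and> i \<in> W \<and> i \<noteq> l
     then - (\<Sum>j\<in>{j \<in> W. h i < h j}. tri W h l B j * B i j) / B i i else 1)"
  by pat_completeness auto
termination
proof (relation "Wellfounded.measure (\<lambda>(W, h, l, B, i). card {j \<in> W. h i < h j})", goal_cases)
  case (2 W h l B i j)
  then have "{j' \<in> W. h j < h j'} \<subset> {j' \<in> W. h i < h j'}" by auto
  then show ?case using 2 by (auto intro: psubset_card_mono)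
qed simp

declare tri.simps [simp del]

lemma height_induct [consumes 2, case_names step]:
  fixes h :: "'i \<Rightarrow> nat"
  assumes "finite W" "i \<in> W"
    and step: "\<And>i. i \<in> W \<Longrightarrow> (\<And>j. j \<in> W \<Longrightarrow> h i < h j \<Longrightarrow> P j) \<Longrightarrow> P i"
  shows "P i"
  using assms(2)
proof (induction "card {j \<in> W. h i < h j}" arbitrary: i rule: less_induct)
  case less
  show ?case
  proof (rule step[OF less.prems])
    fix j assume j: "j \<in> W" "h i < h j"
    then have "{j' \<in> W. h j < h j'} \<subset> {j' \<in> W. h i < h j'}" by auto
    then have "card {j' \<in> W. h j < h j'} < card {j' \<in> W. h i < h j'}"
      using assms(1) by (auto intro: psubset_card_mono)
    then show "P j" using less.hyps j(1) by blast
  qed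
qed

lemma tri_row:
  assumes "finite W" "i \<in> W" "i \<noteq> l" "B i i \<noteq> 0"
  shows "tri W h l B i * B i i + (\<Sum>j\<in>{j \<in> W. h i < h j}. tri W h l B j * B i j) = 0"
  using assms by (subst tri.simps) simp

lemma tri_unique:
  assumes "finite W" "i \<in> W" "u l = 1"
    and rows: "\<And>i. i \<in> W \<Longrightarrow> i \<noteq> l \<Longrightarrow>
      B i i \<noteq> 0 \<and> u i * B i i + (\<Sum>j\<in>{j \<in> W. h i < h j}. u j * B i j) = 0"
  shows "u i = tri W h l B i"
  using assms(1,2)
proof (induction i rule: height_induct[where h = h])
  case (step i)
  show ?case
  proof (cases "i = l")
    case True
    then show ?thesis using assms(3) by (simp add: tri.simps)
  next
    case False
    have "(\<Sum>j\<in>{j \<in> W. h i < h j}. u j * B i j) = (\<Sum>j\<in>{j \<in> W. h i < h j}. tri W h l B j * B i j)"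
      using step by (intro sum.cong) auto
    then have "u i * B i i = tri W h l B i * B i i"
      using rows[OF step(1) False] tri_row[OF assms(1) step(1) False, of B h] by (metis add_right_cancel)
    then show ?thesis using rows[OF step(1) False] by simp
  qed
qed

definition solution ::
    "nat \<Rightarrow> nat list \<Rightarrow> (nat \<Rightarrow> nat \<Rightarrow> complex) \<Rightarrow> nat list \<Rightarrow> complex" where
  "solution n lam w = tri (below n lam) (height n) lam
     (system_coeff n w (eigenvalue n w lam))"

definition nondegenerate :: "nat \<Rightarrow> nat list \<Rightarrow> (nat \<Rightarrow> nat \<Rightarrow> complex) \<Rightarrow> bool" where
  "nondegenerate n lam w \<longleftrightarrow> (\<forall>nu\<in>below n lam. nu \<noteq> lam \<longrightarrow>
     eigenvalue n w nu \<noteq> eigenvalue n w lam)"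

lemma self_in_below: "is_partition n lam \<Longrightarrow> lam \<in> below n lam"
  by (simp add: below_def dominated_refl)

lemma solution_self [simp]: "solution n lam w lam = 1"
  by (simp add: solution_def tri.simps)

lemma Phi_solution:
  assumes lam: "is_partition n lam" and nd: "nondegenerate n lam w"
  defines "E \<equiv> eigenvalue n w lam"
  shows "Phi (\<lambda>k m. sum_weight n w k m - E) (vdm n) (msum n lam (solution n lam w)) = 0"
  unfolding Phi_msum_eq_zero_iff
proof
  fix nu assume nu: "nu \<in> below n lam"
  show "(\<Sum>mu\<in>below n lam. solution n lam w mu * system_coeff n w E nu mu) = 0"
  proof (cases "nu = lam")
    case True
    \<comment> \<open>The row of \<open>lam\<close> has pivot 0 because E is its own eigenvalue, and
      nothing lies above it, so it imposes no condition.\<close>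
    have "{mu \<in> below n lam. height n lam < height n mu} = {}"
      using height_less[OF lam] by (force simp: below_def)
    then show ?thesis unfolding system_row[OF nu] unfolding True
      using lam by (simp only: sum.empty system_coeff_diagonal E_def) simp
  next
    case False
    then have "system_coeff n w E nu nu \<noteq> 0"
      using nd nu by (simp add: system_coeff_diagonal[OF below_partition[OF nu]] nondegenerate_def E_def)
    then show ?thesis unfolding system_row[OF nu] solution_def E_def
      by (intro tri_row[OF finite_below nu False])
  qed
qed

lemma Phi_eq_zero_imp_solution:
  assumes nd: "nondegenerate n lam w"
  defines "E \<equiv> eigenvalue n w lam"
  assumes "Phi (\<lambda>k m. sum_weight n w k m - E) (vdm n) (msum n lam u) = 0"
    and "u lam = 1" "nu \<in> below n lam"
  shows "u nu = solution n lam w nu"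
  unfolding solution_def E_def[symmetric]
proof (rule tri_unique[where u = u, OF finite_below assms(5,4)])
  fix nu assume nu: "nu \<in> below n lam" "nu \<noteq> lam"
  have "(\<Sum>mu\<in>below n lam. u mu * system_coeff n w E nu mu) = 0"
    using assms(3) nu(1) unfolding Phi_msum_eq_zero_iff by blast
  moreover have "system_coeff n w E nu nu \<noteq> 0"
    using nd nu by (simp add: system_coeff_diagonal[OF below_partition[OF nu(1)]] nondegenerate_def E_def)
  ultimately show "system_coeff n w E nu nu \<noteq> 0 \<and> u nu * system_coeff n w E nu nu +
     (\<Sum>mu\<in>{mu \<in> below n lam. height n nu < height n mu}. u mu * system_coeff n w E nu mu) = 0"
    unfolding system_row[OF nu(1)] by simp
qed

lemma lookup_msum:
  assumes "is_partition n mu" "m \<in> orb n mu"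
  shows "lookup (msum n lam u) m = (if mu \<in> below n lam then u mu else 0)"
proof -
  have "lookup (msum n lam u) m = (\<Sum>nu\<in>below n lam. if nu = mu then u nu else 0)"
    unfolding msum_def lookup_sum
  proof (intro sum.cong refl)
    fix nu assume nu: "nu \<in> below n lam"
    have "m \<in> orb n nu \<longleftrightarrow> nu = mu"
      using partition_orb_unique[OF below_partition[OF nu] assms(1) _ assms(2)] assms(2) by blast
    then show "lookup (cscale (u nu) (msym n nu)) m = (if nu = mu then u nu else 0)"
      by (simp add: lookup_msym below_length[OF nu])
  qed
  then show ?thesis using finite_below by (simp add: sum.delta)
qed

lemma lookup_msum_outside: "\<not> keys m \<subseteq> {1..n} \<Longrightarrow> lookup (msum n lam u) m = 0"
  using mpolys_msum[of n lam u] by (auto simp: mpolys_def in_keys_iff)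

lemma msum_cong: "(\<And>mu. mu \<in> below n lam \<Longrightarrow> u mu = v mu) \<Longrightarrow> msum n lam u = msum n lam v"
  by (simp add: msum_def)

lemma sym_eq_msum:
  assumes f: "f \<in> sym_polys n" and lam: "is_partition n lam"
    and d: "homogeneous (mon_degree (mon_of n lam)) f"
    and dom: "\<And>m r. m \<in> keys f \<Longrightarrow> pre r m \<le> pre r (mon_of n lam)"
  shows "f = msum n lam (\<lambda>mu. lookup f (mon_of n mu))"
proof (rule poly_mapping_eqI)
  fix m
  show "lookup f m = lookup (msum n lam (\<lambda>mu. lookup f (mon_of n mu))) m"
  proof (cases "keys m \<subseteq> {1..n}")
    case False
    then show ?thesis using f lookup_msum_outside[OF False] by (auto simp: sym_polys_iff mpolys_def in_keys_iff)
  next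
    case True
    then obtain mu where mu: "is_partition n mu" "m \<in> orb n mu" by (rule ex_partition_orb)
    then have l: "length mu = n" "length lam = n" using lam by (auto simp: is_partition_def)
    have eq: "lookup f m = lookup f (mon_of n mu)"
      using f mu(2) l(1) by (intro lookup_sym_orb) (auto simp: sym_polys_iff)
    have "mu \<in> below n lam" if "mon_of n mu \<in> keys f"
      using that mu(1) dom d by (simp add: below_def dominated_iff[OF l(2,1)] homogeneous_def)
    then show ?thesis using eq lookup_msum[OF mu] by (auto simp: in_keys_iff)
  qed
qed

section \<open>Macdonald's operator\<close>

lemma meval_vdm: "meval (vdm n) x = (\<Prod>p\<in>upper_pairs {1..n}. x (fst p) - x (snd p))"
  by (simp add: vdm_def meval_prod)

lemma meval_vdm_nonzero: "inj_on x {1..n} \<Longrightarrow> meval (vdm n) x \<noteq> 0"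
proof -
  assume inj: "inj_on x {1..n}"
  have "x (fst p) - x (snd p) \<noteq> 0" if "p \<in> upper_pairs {1..n}" for p
    using that inj_onD[OF inj, of "fst p" "snd p"] by (auto simp: upper_pairs_def)
  then show ?thesis by (simp add: meval_vdm)
qed

lemma meval_vdm_not_inj:
  assumes "\<not> inj_on x {1..n}"
  shows "meval (vdm n) x = 0"
proof -
  obtain a b where ab: "a \<in> {1..n}" "b \<in> {1..n}" "a \<noteq> b" "x a = x b" using assms by (auto simp: inj_on_def)
  then have "(min a b, max a b) \<in> upper_pairs {1..n}" by (auto simp: upper_pairs_def min_def max_def)
  moreover have "x (min a b) = x (max a b)" using ab(4) by (auto simp: min_def max_def)
  ultimately show ?thesis unfolding meval_vdm
    by (intro prod_zero bexI[of _ "(min a b, max a b)"]) auto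
qed

text \<open>As a polynomial in x_i alone, V is a constant times the product of the y - x_j; the
  unnamed constant absorbs the signs that come from the ordering of pairs.\<close>

lemma meval_vdm_update:
  assumes i: "i \<in> {1..n}"
  obtains c where "\<And>y. meval (vdm n) (x(i := y)) = c * (\<Prod>j\<in>{1..n} - {i}. y - x j)"
proof -
  let ?U = "upper_pairs {1..n}"
  let ?A = "Pair i ` {i<..n}" and ?B = "(\<lambda>j. (j, i)) ` {1..<i}"
  let ?C = "?U - (?A \<union> ?B)"
  have "meval (vdm n) (x(i := y)) = ((- 1) ^ card {1..<i} * (\<Prod>p\<in>?C. x (fst p) - x (snd p))) * (\<Prod>j\<in>{1..n} - {i}. y - x j)" for y
  proof -
    let ?g = "\<lambda>p. (x(i := y)) (fst p) - (x(i := y)) (snd p)"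
    have AB: "?A \<union> ?B \<subseteq> ?U" using i by (auto simp: upper_pairs_def)
    have "meval (vdm n) (x(i := y)) = prod ?g ?C * prod ?g (?A \<union> ?B)"
      unfolding meval_vdm by (rule prod.subset_diff[OF AB]) simp
    also have "prod ?g (?A \<union> ?B) = prod ?g ?A * prod ?g ?B" by (rule prod.union_disjoint) auto
    also have "prod ?g ?A = (\<Prod>j\<in>{i<..n}. y - x j)"
      by (subst prod.reindex) (auto intro!: inj_onI prod.cong)
    also have "prod ?g ?B = (\<Prod>j\<in>{1..<i}. - 1 * (y - x j))"
      by (subst prod.reindex) (auto intro!: inj_onI prod.cong)
    also have "\<dots> = (- 1) ^ card {1..<i} * (\<Prod>j\<in>{1..<i}. y - x j)"
      unfolding prod.distrib by simp
    also have "prod ?g ?C = (\<Prod>p\<in>?C. x (fst p) - x (snd p))"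
    proof (intro prod.cong refl)
      fix p assume p: "p \<in> ?C"
      then have "fst p \<noteq> i" "snd p \<noteq> i"
        by (cases p; auto simp: upper_pairs_def image_iff)+
      then show "?g p = x (fst p) - x (snd p)" by simp
    qed
    finally have "meval (vdm n) (x(i := y)) = (\<Prod>p\<in>?C. x (fst p) - x (snd p)) *
        ((\<Prod>j\<in>{i<..n}. y - x j) * ((- 1) ^ card {1..<i} * (\<Prod>j\<in>{1..<i}. y - x j)))" .
    moreover have "(\<Prod>j\<in>{1..n} - {i}. y - x j) = (\<Prod>j\<in>{1..<i}. y - x j) * (\<Prod>j\<in>{i<..n}. y - x j)"
    proof -
      have eq: "{1..n} - {i} = {1..<i} \<union> {i<..n}" using i by auto
      show ?thesis unfolding eq by (rule prod.union_disjoint) auto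
    qed
    ultimately show ?thesis by simp
  qed
  then show ?thesis by (rule that)
qed

text \<open>The product in Macdonald's operator is a quotient of two values of V in which the
  constant of \<open>meval_vdm_update\<close> cancels. This is why V clears the
  denominators.\<close>

lemma meval_vdm_shift:
  assumes "i \<in> {1..n}" "inj_on x {1..n}"
  shows "(\<Prod>j\<in>{1..n} - {i}. (t * x i - x j) / (x i - x j)) * meval (vdm n) x = meval (vdm n) (x(i := t * x i))"
proof -
  obtain c where c: "\<And>y. meval (vdm n) (x(i := y)) = c * (\<Prod>j\<in>{1..n} - {i}. y - x j)"
    using meval_vdm_update[OF assms(1), where x = x] by blast
  have "x i - x j \<noteq> 0" if "j \<in> {1..n} - {i}" for j
    using that inj_onD[OF assms(2), of i j] assms(1) by auto
  then have "(\<Prod>j\<in>{1..n} - {i}. x i - x j) \<noteq> 0" by simp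
  then show ?thesis using c[of "x i"] c[of "t * x i"] by (simp add: prod_dividef)
qed

lemma mon_eval_update: "mon_eval m (x(i := c * x i)) = c ^ lookup m i * mon_eval m x"
proof -
  let ?A = "insert i (keys m)"
  have "mon_eval m (x(i := c * x i)) = (\<Prod>j\<in>?A. (x(i := c * x i)) j ^ lookup m j)"
    by (rule mon_eval_superset) auto
  also have "\<dots> = (c * x i) ^ lookup m i * (\<Prod>j\<in>?A - {i}. (x(i := c * x i)) j ^ lookup m j)"
    by (subst prod.remove[of _ i]) auto
  also have "(\<Prod>j\<in>?A - {i}. (x(i := c * x i)) j ^ lookup m j) = (\<Prod>j\<in>?A - {i}. x j ^ lookup m j)"
    by (intro prod.cong) auto
  also have "(c * x i) ^ lookup m i * \<dots> = c ^ lookup m i * (\<Prod>j\<in>?A. x j ^ lookup m j)"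
    by (subst (2) prod.remove[of _ i]) (auto simp: power_mult_distrib)
  also have "(\<Prod>j\<in>?A. x j ^ lookup m j) = mon_eval m x"
    by (rule mon_eval_superset[symmetric]) auto
  finally show ?thesis .
qed

lemma meval_Phi_macdonald:
  "meval (Phi (sum_weight n (\<lambda>a b. t ^ a * q ^ b)) F G) x
   = (\<Sum>i\<in>{1..n}. meval F (x(i := t * x i)) * meval G (x(i := q * x i)))"
proof (induction F G rule: biadditive_induct)
  case (5 k c m d)
  show ?case unfolding Phi_single meval_single mon_eval_update mon_eval_add sum_weight_def sum_distrib_left sum_distrib_right
    by (intro sum.cong refl) (simp only: mult_ac)
qed (auto simp: Phi_add_left Phi_add_right meval_add sum.distrib algebra_simps)

lemma macdonald_op_eq:
  assumes "inj_on x {1..n}"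
  shows "macdonald_op n q t (meval P) x * meval (vdm n) x
     = meval (Phi (sum_weight n (\<lambda>a b. t ^ a * q ^ b)) (vdm n) P) x"
  unfolding meval_Phi_macdonald macdonald_op_def sum_distrib_right
proof (intro sum.cong refl)
  fix i assume "i \<in> {1..n}"
  then show "(\<Prod>j\<in>{1..n} - {i}. (t * x i - x j) / (x i - x j)) * meval P (x(i := q * x i)) * meval (vdm n) x
     = meval (vdm n) (x(i := t * x i)) * meval P (x(i := q * x i))"
    using meval_vdm_shift[OF _ assms, of i t] by (simp add: algebra_simps)
qed

lemma meval_cscale [simp]: "meval (cscale c f) x = c * meval f x"
  by (simp add: cscale_def meval_mult)

text \<open>V is nonzero at points with distinct coordinates, so there the two equations are
  equivalent. At all other points V vanishes; hence V times the polynomial on the right is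
  identically 0, and V is cancelled.\<close>

lemma macdonald_eigen_iff:
  "(\<forall>x. inj_on x {1..n} \<longrightarrow> macdonald_op n q t (meval P) x = E * meval P x) \<longleftrightarrow>
   Phi (\<lambda>k m. sum_weight n (\<lambda>a b. t ^ a * q ^ b) k m - E) (vdm n) P = 0"
  (is "?L \<longleftrightarrow> ?X = 0")
proof -
  have X: "meval ?X x = (macdonald_op n q t (meval P) x - E * meval P x) * meval (vdm n) x"
    if "inj_on x {1..n}" for x
    using macdonald_op_eq[OF that, of q t P] by (simp add: Phi_diff_weight meval_mult algebra_simps)
  show ?thesis
  proof
    assume L: ?L
    have "vdm n * ?X = 0"
    proof (rule meval_eq_zeroD)
      fix x
      show "meval (vdm n * ?X) x = 0"
        using X[of x] L meval_vdm_not_inj[of x n] by (cases "inj_on x {1..n}") (auto simp: meval_mult)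
    qed
    then show "?X = 0" by simp
  next
    assume "?X = 0"
    then have "(macdonald_op n q t (meval P) x - E * meval P x) * meval (vdm n) x = 0"
      if "inj_on x {1..n}" for x using X[OF that] by simp
    then show ?L using meval_vdm_nonzero by fastforce
  qed
qed

lemma msum_eq:
  assumes "is_partition n lam"
  shows "msum n lam u = cscale (u lam) (msym n lam) +
     (\<Sum>mu | is_partition n mu \<and> dominated mu lam \<and> mu \<noteq> lam. cscale (u mu) (msym n mu))"
proof -
  have "{mu. is_partition n mu \<and> dominated mu lam \<and> mu \<noteq> lam} = below n lam - {lam}"
    by (auto simp: below_def)
  then show ?thesis unfolding msum_def
    using sum.remove[OF finite_below self_in_below[OF assms]] by simp
qed

lemma macdonald_eq_solution:
  assumes lam: "is_partition n lam" and nd: "nondegenerate n lam (\<lambda>a b. t ^ a * q ^ b)"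
  shows "macdonald n q t lam = msum n lam (solution n lam (\<lambda>a b. t ^ a * q ^ b))"
proof -
  let ?w = "\<lambda>a b. t ^ a * q ^ b"
  let ?E = "eigenvalue n ?w lam"
  have E: "(\<Sum>i\<in>{1..n}. t ^ (n - i) * q ^ (lam ! (i - 1))) = ?E"
    by (simp add: sum_weight_def lookup_delta lookup_mon_of)
  \<comment> \<open>The expansion in \<open>is_macdonald\<close> leaves the value of its coefficient
    function at \<open>lam\<close> free; setting it to 1 supplies the normalization on which
    uniqueness rests.\<close>
  have form: "P = msum n lam (v(lam := 1)) \<longleftrightarrow> P = msym n lam +
      (\<Sum>mu | is_partition n mu \<and> dominated mu lam \<and> mu \<noteq> lam. cscale (v mu) (msym n mu))" for P v
  proof -
    have "(\<Sum>mu | is_partition n mu \<and> dominated mu lam \<and> mu \<noteq> lam. cscale ((v(lam := 1)) mu) (msym n mu))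
       = (\<Sum>mu | is_partition n mu \<and> dominated mu lam \<and> mu \<noteq> lam. cscale (v mu) (msym n mu))"
      by (intro sum.cong) auto
    then show ?thesis by (simp add: msum_eq[OF lam])
  qed
  show ?thesis unfolding macdonald_def
  proof (rule the_equality)
    let ?s = "solution n lam ?w"
    have "msum n lam ?s = msum n lam (?s(lam := 1))" by (rule msum_cong) simp
    then show "is_macdonald n q t lam (msum n lam ?s)"
      unfolding is_macdonald_def E macdonald_eigen_iff
      using Phi_solution[OF lam nd] form[of "msum n lam ?s" ?s] by blast
  next
    fix P assume P: "is_macdonald n q t lam P"
    then obtain v where v: "P = msum n lam (v(lam := 1))"
      unfolding is_macdonald_def form[symmetric] by blast
    have "Phi (\<lambda>k m. sum_weight n ?w k m - ?E) (vdm n) P = 0"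
      using P unfolding is_macdonald_def E macdonald_eigen_iff by blast
    then have "(v(lam := 1)) nu = solution n lam ?w nu" if "nu \<in> below n lam" for nu
      using Phi_eq_zero_imp_solution[OF nd, of "v(lam := 1)"] that v by simp
    then show "P = msum n lam (solution n lam ?w)" unfolding v by (rule msum_cong)
  qed
qed

section \<open>The limit \<open>q \<rightarrow> 1\<close>\<close>

definition macdonald_weight :: "real \<Rightarrow> real \<Rightarrow> nat \<Rightarrow> nat \<Rightarrow> complex" where
  "macdonald_weight \<theta> q a b = complex_of_real (q powr \<theta>) ^ a * complex_of_real q ^ b"

definition jack_weight :: "complex \<Rightarrow> nat \<Rightarrow> nat \<Rightarrow> complex" where
  "jack_weight \<theta> a b = (\<theta> * of_nat a + of_nat b) ^ 2"

lemma macdonald_weight_eq: "q > 0 \<Longrightarrow> macdonald_weight \<theta> q a b = complex_of_real (q powr (\<theta> * a + b))"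
  by (simp add: macdonald_weight_def powr_add powr_powr powr_realpow flip: of_real_power of_real_mult)
    (metis mult.commute powr_powr powr_realpow powr_gt_zero less_irrefl)

lemma powr_second_order:
  "((\<lambda>q::real. (q powr a - 1 - a * (q - 1)) / (1 - q) ^ 2) \<longlongrightarrow> a * (a - 1) / 2) (at_left 1)"
  by real_asymp

text \<open>The terms of order 0 cancel because both sums run over I. The hypothesis cancels those
  of order 1 and the linear parts of a (a - 1) / 2, leaving only squares.\<close>

lemma powr_sum_limit:
  fixes a b :: "'i \<Rightarrow> real"
  assumes eq: "(\<Sum>i\<in>I. a i) = (\<Sum>i\<in>I. b i)"
  shows "((\<lambda>q. ((\<Sum>i\<in>I. q powr a i) - (\<Sum>i\<in>I. q powr b i)) / (1 - q) ^ 2)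
     \<longlongrightarrow> ((\<Sum>i\<in>I. a i ^ 2) - (\<Sum>i\<in>I. b i ^ 2)) / 2) (at_left 1)"
proof -
  let ?f = "\<lambda>a q. (q powr a - 1 - a * (q - 1)) / (1 - q) ^ 2 :: real"
  have "((\<lambda>q. (\<Sum>i\<in>I. ?f (a i) q) - (\<Sum>i\<in>I. ?f (b i) q))
     \<longlongrightarrow> (\<Sum>i\<in>I. a i * (a i - 1) / 2) - (\<Sum>i\<in>I. b i * (b i - 1) / 2)) (at_left 1)"
    by (intro tendsto_intros powr_second_order)
  moreover have "(\<Sum>i\<in>I. ?f (a i) q) - (\<Sum>i\<in>I. ?f (b i) q)
     = ((\<Sum>i\<in>I. q powr a i) - (\<Sum>i\<in>I. q powr b i)) / (1 - q) ^ 2" for q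
  proof -
    have "(\<Sum>i\<in>I. ?f (a i) q) = ((\<Sum>i\<in>I. q powr a i) - (\<Sum>i\<in>I. 1) - (\<Sum>i\<in>I. a i) * (q - 1)) / (1 - q) ^ 2" for a
      by (simp only: sum_divide_distrib[symmetric] sum_subtractf sum_distrib_right)
    then show ?thesis using eq by (simp add: diff_divide_distrib[symmetric])
  qed
  moreover have "(\<Sum>i\<in>I. a i * (a i - 1) / 2) - (\<Sum>i\<in>I. b i * (b i - 1) / 2)
     = ((\<Sum>i\<in>I. a i ^ 2) - (\<Sum>i\<in>I. b i ^ 2)) / 2"
  proof -
    have "(\<Sum>i\<in>I. a i * (a i - 1) / 2) = ((\<Sum>i\<in>I. a i ^ 2) - (\<Sum>i\<in>I. a i)) / 2" for a :: "'i \<Rightarrow> real"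
      by (simp only: sum_divide_distrib[symmetric] sum_subtractf[symmetric] power2_eq_square right_diff_distrib mult_1_right)
    then show ?thesis using eq by (simp add: diff_divide_distrib[symmetric])
  qed
  ultimately show ?thesis by simp
qed

lemma mon_degree_eq_sum: "keys m \<subseteq> {1..n} \<Longrightarrow> mon_degree m = (\<Sum>i\<in>{1..n}. lookup m i)"
  using pre_eq_mon_degree[of m n] pre_eq_sum[of m n n] by simp

lemma eventually_at_left_1: "eventually (\<lambda>q::real. 0 < q \<and> q < 1) (at_left 1)"
  using eventually_at_left_real[of 0 1] by (auto elim: eventually_mono)

text \<open>For q > 0 the weights are sums of powers of q with exponents \<theta> k_i + m_i. Equal
  degrees make the exponent sums agree, as \<open>powr_sum_limit\<close> requires.\<close>

lemma sum_weight_limit: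
  assumes k: "keys k \<subseteq> {1..n}" "keys k' \<subseteq> {1..n}" "mon_degree k = mon_degree k'"
    and m: "keys m \<subseteq> {1..n}" "keys m' \<subseteq> {1..n}" "mon_degree m = mon_degree m'"
  shows "((\<lambda>q. (sum_weight n (macdonald_weight \<theta> q) k m - sum_weight n (macdonald_weight \<theta> q) k' m')
        / complex_of_real ((1 - q) ^ 2))
     \<longlongrightarrow> (sum_weight n (jack_weight (complex_of_real \<theta>)) k m - sum_weight n (jack_weight (complex_of_real \<theta>)) k' m') / 2) (at_left 1)"
proof -
  define a where "a i = \<theta> * lookup k i + lookup m i" for i
  define b where "b i = \<theta> * lookup k' i + lookup m' i" for i
  have "(\<Sum>i\<in>{1..n}. real (lookup k i)) = (\<Sum>i\<in>{1..n}. real (lookup k' i))"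
    "(\<Sum>i\<in>{1..n}. real (lookup m i)) = (\<Sum>i\<in>{1..n}. real (lookup m' i))"
    using k m by (simp_all add: mon_degree_eq_sum flip: of_nat_sum)
  then have "(\<Sum>i\<in>{1..n}. a i) = (\<Sum>i\<in>{1..n}. b i)"
    by (simp add: a_def b_def sum.distrib sum_distrib_left[symmetric])
  from tendsto_of_real[OF powr_sum_limit[OF this], where ?'a = complex]
  have lim: "((\<lambda>q. complex_of_real (((\<Sum>i\<in>{1..n}. q powr a i) - (\<Sum>i\<in>{1..n}. q powr b i)) / (1 - q) ^ 2))
     \<longlongrightarrow> complex_of_real (((\<Sum>i\<in>{1..n}. a i ^ 2) - (\<Sum>i\<in>{1..n}. b i ^ 2)) / 2)) (at_left 1)" .
  have "eventually (\<lambda>q. complex_of_real (((\<Sum>i\<in>{1..n}. q powr a i) - (\<Sum>i\<in>{1..n}. q powr b i)) / (1 - q) ^ 2)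
     = (sum_weight n (macdonald_weight \<theta> q) k m - sum_weight n (macdonald_weight \<theta> q) k' m') / complex_of_real ((1 - q) ^ 2)) (at_left 1)"
    using eventually_at_left_1
    by eventually_elim (simp add: sum_weight_def macdonald_weight_eq a_def b_def)
  from Lim_transform_eventually[OF lim this]
  show ?thesis by (simp add: sum_weight_def jack_weight_def a_def b_def)
qed

lemma system_coeff_limit:
  assumes mu: "is_partition n mu" and lam: "is_partition n lam" and "mon_degree (mon_of n mu) = mon_degree (mon_of n lam)"
  shows "((\<lambda>q. system_coeff n (macdonald_weight \<theta> q) (eigenvalue n (macdonald_weight \<theta> q) lam) nu mu
        / complex_of_real ((1 - q) ^ 2))
     \<longlongrightarrow> system_coeff n (jack_weight (complex_of_real \<theta>)) (eigenvalue n (jack_weight (complex_of_real \<theta>)) lam) nu mu / 2) (at_left 1)"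
proof -
  have l: "length mu = n" using mu by (simp add: is_partition_def)
  have *: "((\<lambda>q. if P then c * (sum_weight n (macdonald_weight \<theta> q) k m - eigenvalue n (macdonald_weight \<theta> q) lam)
        / complex_of_real ((1 - q) ^ 2) else 0)
     \<longlongrightarrow> (if P then c * (sum_weight n (jack_weight (complex_of_real \<theta>)) k m - eigenvalue n (jack_weight (complex_of_real \<theta>)) lam) / 2 else 0)) (at_left 1)"
    if k: "k \<in> keys (vdm n)" and m: "m \<in> keys (msym n mu)" for k m P and c :: complex
  proof -
    have m': "m \<in> orb n mu" using m l by (simp add: keys_msym)
    have "keys k \<subseteq> {1..n}" using k mpolys_vdm[of n] by (auto simp: mpolys_def)
    moreover have "keys m \<subseteq> {1..n}" using m' by (simp add: orb_def)
    moreover have "mon_degree m = mon_degree (mon_of n lam)" using pre_orb(2)[OF mu m'] assms(3) by simp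
    ultimately show ?thesis
      using tendsto_mult_left[OF sum_weight_limit[OF _ keys_delta mon_degree_vdm[OF k] _ keys_mon_of[of n lam]], of m c \<theta>]
      by (cases P) auto
  qed
  show ?thesis unfolding system_coeff_def lookup_Phi sum_divide_distrib if_distrib[of "\<lambda>x. x / _"] div_0
    by (intro tendsto_sum *)
qed

lemma solution_limit:
  assumes lam: "is_partition n lam" and nd: "nondegenerate n lam (jack_weight (complex_of_real \<theta>))"
    and nu: "nu \<in> below n lam"
  shows "((\<lambda>q. solution n lam (macdonald_weight \<theta> q) nu)
     \<longlongrightarrow> solution n lam (jack_weight (complex_of_real \<theta>)) nu) (at_left 1)"
  using finite_below nu
proof (induction nu rule: height_induct[where h = "height n"])
  case (step nu)
  show ?case
  proof (cases "nu = lam")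
    case False
    let ?M = "\<lambda>q. system_coeff n (macdonald_weight \<theta> q) (eigenvalue n (macdonald_weight \<theta> q) lam)"
    let ?J = "system_coeff n (jack_weight (complex_of_real \<theta>)) (eigenvalue n (jack_weight (complex_of_real \<theta>)) lam)"
    let ?W = "{mu \<in> below n lam. height n nu < height n mu}"
    let ?c = "\<lambda>q. complex_of_real ((1 - q) ^ 2)"
    \<comment> \<open>A common factor of all entries of a row does not affect its unknown;
      \<open>c\<close> is (1 - q)^2 for Macdonald's weight and 2 for the limit weight.\<close>
    have row: "solution n lam w nu = - (\<Sum>mu\<in>?W. solution n lam w mu *
        (system_coeff n w (eigenvalue n w lam) nu mu / c)) /
        (system_coeff n w (eigenvalue n w lam) nu nu / c)" if "c \<noteq> 0" for w c
      unfolding solution_def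
      by (subst tri.simps) (use that False step(1) finite_below in \<open>simp add: sum_divide_distrib[symmetric]\<close>)
    have deg: "mon_degree (mon_of n mu) = mon_degree (mon_of n lam)" if "mu \<in> below n lam" for mu
      using that lam dominated_iff[of lam n mu] by (auto simp: below_def is_partition_def)
    have lim: "((\<lambda>q. ?M q nu mu / ?c q) \<longlongrightarrow> ?J nu mu / 2) (at_left 1)" if "mu \<in> below n lam" for mu
      by (rule system_coeff_limit[OF below_partition[OF that] lam deg[OF that]])
    have "?J nu nu \<noteq> 0"
      using nd step(1) False by (simp add: system_coeff_diagonal[OF below_partition[OF step(1)]] nondegenerate_def)
    then have "((\<lambda>q. - (\<Sum>mu\<in>?W. solution n lam (macdonald_weight \<theta> q) mu * (?M q nu mu / ?c q)) / (?M q nu nu / ?c q))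
       \<longlongrightarrow> - (\<Sum>mu\<in>?W. solution n lam (jack_weight (complex_of_real \<theta>)) mu * (?J nu mu / 2)) / (?J nu nu / 2)) (at_left 1)"
      using step by (intro tendsto_intros lim step) auto
    moreover have "eventually (\<lambda>q. - (\<Sum>mu\<in>?W. solution n lam (macdonald_weight \<theta> q) mu * (?M q nu mu / ?c q)) / (?M q nu nu / ?c q)
       = solution n lam (macdonald_weight \<theta> q) nu) (at_left 1)"
      using eventually_at_left_1 by eventually_elim (rule row[symmetric], simp)
    ultimately have "((\<lambda>q. solution n lam (macdonald_weight \<theta> q) nu)
       \<longlongrightarrow> - (\<Sum>mu\<in>?W. solution n lam (jack_weight (complex_of_real \<theta>)) mu * (?J nu mu / 2)) / (?J nu nu / 2)) (at_left 1)"
      by (rule Lim_transform_eventually)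
    then show ?thesis using row[of 2 "jack_weight (complex_of_real \<theta>)"] by simp
  qed simp
qed

lemma eventually_nondegenerate:
  assumes lam: "is_partition n lam" and nd: "nondegenerate n lam (jack_weight (complex_of_real \<theta>))"
  shows "eventually (\<lambda>q. nondegenerate n lam (macdonald_weight \<theta> q)) (at_left 1)"
  unfolding nondegenerate_def
proof (rule eventually_ball_finite[OF finite_below], rule ballI)
  fix nu assume nu: "nu \<in> below n lam"
  let ?d = "\<lambda>w. eigenvalue n w nu - eigenvalue n w lam"
  show "eventually (\<lambda>q. nu \<noteq> lam \<longrightarrow> eigenvalue n (macdonald_weight \<theta> q) nu
     \<noteq> eigenvalue n (macdonald_weight \<theta> q) lam) (at_left 1)"
  proof (cases "nu = lam")
    case False
    have "mon_degree (mon_of n nu) = mon_degree (mon_of n lam)"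
      using nu lam dominated_iff[of lam n nu] by (auto simp: below_def is_partition_def)
    from sum_weight_limit[OF keys_delta keys_delta refl keys_mon_of keys_mon_of this]
    have "((\<lambda>q. ?d (macdonald_weight \<theta> q) / complex_of_real ((1 - q) ^ 2)) \<longlongrightarrow> ?d (jack_weight (complex_of_real \<theta>)) / 2) (at_left 1)" .
    moreover have "?d (jack_weight (complex_of_real \<theta>)) / 2 \<noteq> 0" using nd nu False by (simp add: nondegenerate_def)
    ultimately have "eventually (\<lambda>q. ?d (macdonald_weight \<theta> q) / complex_of_real ((1 - q) ^ 2) \<noteq> 0) (at_left 1)"
      by (rule tendsto_imp_eventually_ne)
    then show ?thesis by eventually_elim auto
  qed simp
qed

lemma macdonald_limit:
  assumes lam: "is_partition n lam" and nd: "nondegenerate n lam (jack_weight (complex_of_real \<theta>))"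
  shows "((\<lambda>q. lookup (macdonald n (complex_of_real q) (complex_of_real (q powr \<theta>)) lam) m)
     \<longlongrightarrow> lookup (msum n lam (solution n lam (jack_weight (complex_of_real \<theta>)))) m) (at_left 1)"
proof -
  have "((\<lambda>q. lookup (msum n lam (solution n lam (macdonald_weight \<theta> q))) m)
     \<longlongrightarrow> lookup (msum n lam (solution n lam (jack_weight (complex_of_real \<theta>)))) m) (at_left 1)"
    unfolding msum_def lookup_sum lookup_cscale
    by (intro tendsto_intros solution_limit[OF lam nd])
  moreover have "eventually (\<lambda>q. lookup (msum n lam (solution n lam (macdonald_weight \<theta> q))) m
     = lookup (macdonald n (complex_of_real q) (complex_of_real (q powr \<theta>)) lam) m) (at_left 1)"
    using eventually_nondegenerate[OF lam nd]
  proof eventually_elim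
    case (elim q)
    have w: "macdonald_weight \<theta> q = (\<lambda>a b. complex_of_real (q powr \<theta>) ^ a * complex_of_real q ^ b)"
      by (simp add: macdonald_weight_def fun_eq_iff)
    show ?case using macdonald_eq_solution[OF lam elim[unfolded w]] by (simp add: w)
  qed
  ultimately show ?thesis by (rule Lim_transform_eventually)
qed

section \<open>Rational dependence on \<open>\<theta>\<close>\<close>

text \<open>A single fraction serves all of T and has no pole in T. With T made of
  \<open>\<theta>0\<close> and the positive reals, it carries values found as limits over to
  \<open>\<theta>0\<close>.\<close>

definition rational_on :: "complex set \<Rightarrow> (complex \<Rightarrow> complex) \<Rightarrow> bool" where
  "rational_on T F \<longleftrightarrow> (\<exists>a b. \<forall>\<theta>\<in>T. poly b \<theta> \<noteq> 0 \<and> F \<theta> = poly a \<theta> / poly b \<theta>)"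

lemma rational_on_const: "rational_on T (\<lambda>_. c)"
  unfolding rational_on_def by (rule exI[of _ "[:c:]"], rule exI[of _ 1]) simp

lemma rational_on_id: "rational_on T (\<lambda>\<theta>. \<theta>)"
  unfolding rational_on_def by (rule exI[of _ "[:0, 1:]"], rule exI[of _ 1]) simp

lemma rational_on_add:
  assumes "rational_on T F" "rational_on T G"
  shows "rational_on T (\<lambda>\<theta>. F \<theta> + G \<theta>)"
proof -
  obtain a b c d where "\<forall>\<theta>\<in>T. poly b \<theta> \<noteq> 0 \<and> F \<theta> = poly a \<theta> / poly b \<theta>"
    "\<forall>\<theta>\<in>T. poly d \<theta> \<noteq> 0 \<and> G \<theta> = poly c \<theta> / poly d \<theta>" using assms unfolding rational_on_def by blast
  then show ?thesis unfolding rational_on_def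
    by (intro exI[of _ "a * d + c * b"] exI[of _ "b * d"]) (auto simp: add_frac_eq)
qed

lemma rational_on_mult:
  assumes "rational_on T F" "rational_on T G"
  shows "rational_on T (\<lambda>\<theta>. F \<theta> * G \<theta>)"
proof -
  obtain a b c d where "\<forall>\<theta>\<in>T. poly b \<theta> \<noteq> 0 \<and> F \<theta> = poly a \<theta> / poly b \<theta>"
    "\<forall>\<theta>\<in>T. poly d \<theta> \<noteq> 0 \<and> G \<theta> = poly c \<theta> / poly d \<theta>" using assms unfolding rational_on_def by blast
  then show ?thesis unfolding rational_on_def
    by (intro exI[of _ "a * c"] exI[of _ "b * d"]) auto
qed

lemma rational_on_inverse:
  assumes "rational_on T F" "\<And>\<theta>. \<theta> \<in> T \<Longrightarrow> F \<theta> \<noteq> 0"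
  shows "rational_on T (\<lambda>\<theta>. inverse (F \<theta>))"
proof -
  obtain a b where "\<forall>\<theta>\<in>T. poly b \<theta> \<noteq> 0 \<and> F \<theta> = poly a \<theta> / poly b \<theta>"
    using assms unfolding rational_on_def by blast
  then show ?thesis using assms(2) unfolding rational_on_def
    by (intro exI[of _ b] exI[of _ a]) auto
qed

lemma rational_on_uminus: "rational_on T F \<Longrightarrow> rational_on T (\<lambda>\<theta>. - F \<theta>)"
  using rational_on_mult[OF rational_on_const[of T "- 1"]] by simp

lemma rational_on_diff: "rational_on T F \<Longrightarrow> rational_on T G \<Longrightarrow> rational_on T (\<lambda>\<theta>. F \<theta> - G \<theta>)"
  using rational_on_add[OF _ rational_on_uminus] by simp

lemma rational_on_sum: "(\<And>i. i \<in> I \<Longrightarrow> rational_on T (F i)) \<Longrightarrow> rational_on T (\<lambda>\<theta>. \<Sum>i\<in>I. F i \<theta>)"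
  by (induction I rule: infinite_finite_induct) (auto intro: rational_on_add rational_on_const)

lemma rational_on_sum_weight: "rational_on T (\<lambda>\<theta>. sum_weight n (jack_weight \<theta>) k m)"
  unfolding sum_weight_def jack_weight_def power2_eq_square
  by (intro rational_on_sum rational_on_mult rational_on_add rational_on_id rational_on_const)

lemma rational_on_system_coeff:
  "rational_on T (\<lambda>\<theta>. system_coeff n (jack_weight \<theta>) (eigenvalue n (jack_weight \<theta>) lam) nu mu)"
proof -
  have *: "rational_on T (\<lambda>\<theta>. if P then c * (sum_weight n (jack_weight \<theta>) k m - sum_weight n (jack_weight \<theta>) k' m') else 0)" for P c k m k' m'
    by (cases P) (auto intro!: rational_on_mult rational_on_diff rational_on_const rational_on_sum_weight)
  show ?thesis unfolding system_coeff_def lookup_Phi by (intro rational_on_sum *)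
qed

lemma rational_on_solution:
  assumes nd: "\<And>\<theta>. \<theta> \<in> T \<Longrightarrow> nondegenerate n lam (jack_weight \<theta>)" and nu: "nu \<in> below n lam"
  shows "rational_on T (\<lambda>\<theta>. solution n lam (jack_weight \<theta>) nu)"
  using finite_below nu
proof (induction nu rule: height_induct[where h = "height n"])
  case (step nu)
  show ?case
  proof (cases "nu = lam")
    case True
    then show ?thesis using rational_on_const[of T 1] by simp
  next
    case False
    let ?J = "\<lambda>\<theta>. system_coeff n (jack_weight \<theta>) (eigenvalue n (jack_weight \<theta>) lam)"
    have "solution n lam (jack_weight \<theta>) nu = - (\<Sum>mu\<in>{mu \<in> below n lam. height n nu < height n mu}.
        solution n lam (jack_weight \<theta>) mu * ?J \<theta> nu mu) * inverse (?J \<theta> nu nu)" for \<theta>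
      unfolding solution_def
      by (subst tri.simps) (use False step(1) finite_below in \<open>simp add: divide_inverse\<close>)
    moreover have "?J \<theta> nu nu \<noteq> 0" if "\<theta> \<in> T" for \<theta>
      using nd[OF that] step(1) False by (simp add: system_coeff_diagonal[OF below_partition[OF step(1)]] nondegenerate_def)
    ultimately show ?thesis
      using step by (auto intro!: rational_on_mult rational_on_uminus rational_on_sum rational_on_inverse rational_on_system_coeff)
  qed
qed

lemma rational_on_lookup_msum:
  assumes nd: "\<And>\<theta>. \<theta> \<in> T \<Longrightarrow> nondegenerate n lam (jack_weight \<theta>)"
  shows "rational_on T (\<lambda>\<theta>. lookup (msum n lam (solution n lam (jack_weight \<theta>))) m)"
  unfolding msum_def lookup_sum lookup_cscale
  by (intro rational_on_sum rational_on_mult rational_on_const rational_on_solution nd)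

lemma jack_coeff_fraction_unique:
  assumes "jack_coeff_fraction n lam m a b" "poly b \<theta>0 \<noteq> 0"
    and "jack_coeff_fraction n lam m a' b'" "poly b' \<theta>0 \<noteq> 0"
  shows "poly a \<theta>0 / poly b \<theta>0 = poly a' \<theta>0 / poly b' \<theta>0"
proof -
  \<comment> \<open>The factor \<open>b * b'\<close> makes the polynomial vanish also at those
    \<theta> > 0 where a denominator does, so every positive real is a root.\<close>
  let ?p = "(a * b' - a' * b) * (b * b')"
  have z: "poly ?p (complex_of_real \<theta>) = 0" if "\<theta> > 0" for \<theta>
  proof (cases "poly b (complex_of_real \<theta>) \<noteq> 0 \<and> poly b' (complex_of_real \<theta>) \<noteq> 0")
    case True
    let ?f = "\<lambda>q::real. lookup (macdonald n (complex_of_real q) (complex_of_real (q powr \<theta>)) lam) m"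
    have "(?f \<longlongrightarrow> poly a (complex_of_real \<theta>) / poly b (complex_of_real \<theta>)) (at_left 1)"
      using assms(1) True that unfolding jack_coeff_fraction_def by blast
    moreover have "(?f \<longlongrightarrow> poly a' (complex_of_real \<theta>) / poly b' (complex_of_real \<theta>)) (at_left 1)"
      using assms(3) True that unfolding jack_coeff_fraction_def by blast
    ultimately have "poly a (complex_of_real \<theta>) / poly b (complex_of_real \<theta>)
       = poly a' (complex_of_real \<theta>) / poly b' (complex_of_real \<theta>)"
      by (rule tendsto_unique[rotated]) simp
    then show ?thesis using True by (simp add: frac_eq_eq)
  qed auto
  have "?p = 0"
  proof (rule ccontr)
    assume "?p \<noteq> 0"
    then have "finite {x. poly ?p x = 0}" by (rule poly_roots_finite)
    moreover have "complex_of_real ` {0<..} \<subseteq> {x. poly ?p x = 0}" using z by auto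
    ultimately have "finite (complex_of_real ` {0<..})" by (rule rev_finite_subset)
    then have "finite {0::real<..}" by (rule finite_imageD) (auto intro: inj_onI)
    then show False by (simp add: infinite_Ioi)
  qed
  moreover have "b \<noteq> 0" "b' \<noteq> 0" using assms(2,4) by auto
  ultimately have "a * b' = a' * b" by simp
  then have "poly a \<theta>0 * poly b' \<theta>0 = poly a' \<theta>0 * poly b \<theta>0" by (metis poly_mult)
  then show ?thesis using assms(2,4) by (simp add: frac_eq_eq)
qed

lemma jack_eq_solution:
  assumes lam: "is_partition n lam"
    and pos: "\<And>\<theta>::real. \<theta> > 0 \<Longrightarrow> nondegenerate n lam (jack_weight (complex_of_real \<theta>))"
    and nd: "nondegenerate n lam (jack_weight \<theta>0)"
  shows "jack_well_defined n lam \<theta>0" "jack n lam \<theta>0 = msum n lam (solution n lam (jack_weight \<theta>0))"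
proof -
  let ?J = "\<lambda>\<theta>. msum n lam (solution n lam (jack_weight \<theta>))"
  let ?T = "insert \<theta>0 (complex_of_real ` {0<..})"
  have ex: "\<exists>a b. jack_coeff_fraction n lam m a b \<and> poly b \<theta>0 \<noteq> 0 \<and> lookup (?J \<theta>0) m = poly a \<theta>0 / poly b \<theta>0" for m
  proof -
    have "rational_on ?T (\<lambda>\<theta>. lookup (?J \<theta>) m)"
      using pos nd by (intro rational_on_lookup_msum) auto
    then obtain a b where ab: "\<forall>\<theta>\<in>?T. poly b \<theta> \<noteq> 0 \<and> lookup (?J \<theta>) m = poly a \<theta> / poly b \<theta>"
      unfolding rational_on_def by blast
    have "jack_coeff_fraction n lam m a b" unfolding jack_coeff_fraction_def
    proof (intro conjI allI impI)
      show "b \<noteq> 0" using ab by auto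
      fix \<theta> :: real assume "\<theta> > 0 \<and> poly b (complex_of_real \<theta>) \<noteq> 0"
      then show "((\<lambda>q. lookup (macdonald n (complex_of_real q) (complex_of_real (q powr \<theta>)) lam) m)
         \<longlongrightarrow> poly a (complex_of_real \<theta>) / poly b (complex_of_real \<theta>)) (at_left 1)"
        using macdonald_limit[OF lam pos, of \<theta> m] ab by simp
    qed
    then show ?thesis using ab by blast
  qed
  then show "jack_well_defined n lam \<theta>0" unfolding jack_well_defined_def by blast
  show "jack n lam \<theta>0 = ?J \<theta>0" unfolding jack_def
  proof (rule the_equality)
    fix J assume J: "\<forall>m. \<exists>a b. jack_coeff_fraction n lam m a b \<and> poly b \<theta>0 \<noteq> 0 \<and> lookup J m = poly a \<theta>0 / poly b \<theta>0"
    show "J = ?J \<theta>0"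
    proof (rule poly_mapping_eqI)
      fix m
      obtain a b where "jack_coeff_fraction n lam m a b" "poly b \<theta>0 \<noteq> 0" "lookup J m = poly a \<theta>0 / poly b \<theta>0"
        using J by blast
      moreover obtain a' b' where "jack_coeff_fraction n lam m a' b'" "poly b' \<theta>0 \<noteq> 0"
        "lookup (?J \<theta>0) m = poly a' \<theta>0 / poly b' \<theta>0" using ex by blast
      ultimately show "lookup J m = lookup (?J \<theta>0) m" by (metis jack_coeff_fraction_unique)
    qed
  qed (use ex in blast)
qed

section \<open>Separation of the eigenvalues\<close>

text \<open>Abel summation: it turns differences of parts into differences of prefix sums, the
  quantities controlled by the dominance order.\<close>

lemma sum_mult_by_parts:
  fixes d g :: "nat \<Rightarrow> real"
  shows "(\<Sum>i\<in>{1..n}. d i * g i)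
     = (\<Sum>r\<in>{1..<n}. (\<Sum>i\<in>{1..r}. d i) * (g r - g (Suc r))) + (\<Sum>i\<in>{1..n}. d i) * g n"
proof (induction n)
  case (Suc n)
  then show ?case by (cases n) (auto simp: atLeastLessThanSuc algebra_simps)
qed simp

definition pre_diff :: "nat \<Rightarrow> nat list \<Rightarrow> nat list \<Rightarrow> nat \<Rightarrow> real" where
  "pre_diff n lam nu r = real (pre r (mon_of n lam)) - real (pre r (mon_of n nu))"

text \<open>Each difference of squares factors as (\<lambda>_i - \<nu>_i)(\<lambda>_i + \<nu>_i + 2
  \<theta> \<delta>_i). In the summation by parts the boundary term vanishes since the sizes agree,
  and the drop of \<delta> by 1 per step yields 2 \<theta>.\<close>

lemma jack_weight_diff:
  assumes lam: "is_partition n lam" and nu: "nu \<in> below n lam"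
  shows "eigenvalue n (jack_weight (complex_of_real \<theta>)) lam
       - eigenvalue n (jack_weight (complex_of_real \<theta>)) nu
     = complex_of_real (\<Sum>r\<in>{1..<n}. pre_diff n lam nu r *
         ((real (lookup (mon_of n lam) r) - lookup (mon_of n lam) (Suc r)) +
          (real (lookup (mon_of n nu) r) - lookup (mon_of n nu) (Suc r)) + 2 * \<theta>))"
proof -
  let ?l = "\<lambda>i. real (lookup (mon_of n lam) i)" and ?v = "\<lambda>i. real (lookup (mon_of n nu) i)"
  let ?e = "\<lambda>i. real (lookup (delta n) i)"
  let ?d = "\<lambda>i. ?l i - ?v i" and ?g = "\<lambda>i. ?l i + ?v i + 2 * \<theta> * ?e i"
  have D: "(\<Sum>i\<in>{1..r}. ?d i) = pre_diff n lam nu r" for r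
    by (simp add: pre_diff_def pre_eq_sum[OF keys_mon_of] sum_subtractf)
  have "mon_degree (mon_of n nu) = mon_degree (mon_of n lam)"
    using nu lam dominated_iff[of lam n nu] by (auto simp: below_def is_partition_def)
  then have Dn: "pre_diff n lam nu n = 0" by (simp add: pre_diff_def pre_eq_mon_degree[OF keys_mon_of])
  have "eigenvalue n (jack_weight (complex_of_real \<theta>)) lam
       - eigenvalue n (jack_weight (complex_of_real \<theta>)) nu
     = complex_of_real (\<Sum>i\<in>{1..n}. ?d i * ?g i)"
    by (simp add: sum_weight_def jack_weight_def power2_eq_square algebra_simps flip: sum_subtractf)
  also have "(\<Sum>i\<in>{1..n}. ?d i * ?g i) = (\<Sum>r\<in>{1..<n}. pre_diff n lam nu r * (?g r - ?g (Suc r)))"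
    unfolding sum_mult_by_parts D Dn by simp
  also have "\<dots> = (\<Sum>r\<in>{1..<n}. pre_diff n lam nu r * ((?l r - ?l (Suc r)) + (?v r - ?v (Suc r)) + 2 * \<theta>))"
  proof (intro sum.cong refl)
    fix r assume "r \<in> {1..<n}"
    then have "?e r - ?e (Suc r) = 1" by (auto simp: lookup_delta)
    then have e: "?e r = ?e (Suc r) + 1" by simp
    show "pre_diff n lam nu r * (?g r - ?g (Suc r)) = pre_diff n lam nu r * ((?l r - ?l (Suc r)) + (?v r - ?v (Suc r)) + 2 * \<theta>)"
      unfolding e by (simp add: algebra_simps)
  qed
  finally show ?thesis .
qed

lemma pre_diff_nonneg: "is_partition n lam \<Longrightarrow> nu \<in> below n lam \<Longrightarrow> pre_diff n lam nu r \<ge> 0"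
  using dominated_iff[of lam n nu] by (auto simp: below_def is_partition_def pre_diff_def)

lemma ex_pre_diff_pos:
  assumes lam: "is_partition n lam" and nu: "nu \<in> below n lam" "nu \<noteq> lam"
  obtains r where "r \<in> {1..<n}" "pre_diff n lam nu r > 0"
proof -
  have l: "length lam = n" "length nu = n" using lam nu by (auto simp: below_def is_partition_def)
  have "\<exists>r. pre r (mon_of n nu) \<noteq> pre r (mon_of n lam)"
    using pre_inject[of "mon_of n nu" "mon_of n lam"] mon_of_inject[OF l(2,1)] nu(2) by blast
  then obtain r where r: "pre r (mon_of n nu) \<noteq> pre r (mon_of n lam)" by blast
  have "pre n (mon_of n nu) = pre n (mon_of n lam)"
    using nu dominated_iff[OF l] by (simp add: below_def pre_eq_mon_degree[OF keys_mon_of])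
  then have "r < n" using r pre_ge[OF keys_mon_of, of n r] by (metis not_le_imp_less)
  moreover have "r \<noteq> 0" using r by (cases r) (auto simp: pre_def lookup_mon_of)
  moreover have "pre_diff n lam nu r > 0"
    using pre_diff_nonneg[OF lam nu(1), of r] r by (simp add: pre_diff_def)
  ultimately show ?thesis using that[of r] by (simp add: One_nat_def)
qed

lemma nondegenerate_pos:
  assumes lam: "is_partition n lam" and "\<theta> > 0"
  shows "nondegenerate n lam (jack_weight (complex_of_real \<theta>))"
  unfolding nondegenerate_def
proof (intro ballI impI)
  fix nu assume nu: "nu \<in> below n lam" "nu \<noteq> lam"
  obtain r where r: "r \<in> {1..<n}" "pre_diff n lam nu r > 0" using ex_pre_diff_pos[OF lam nu] .
  let ?t = "\<lambda>r. (real (lookup (mon_of n lam) r) - lookup (mon_of n lam) (Suc r)) +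
          (real (lookup (mon_of n nu) r) - lookup (mon_of n nu) (Suc r)) + 2 * \<theta>"
  have t: "?t r > 0" if "r \<in> {1..<n}" for r
    using that partition_antimono[OF lam, of r "Suc r"] partition_antimono[OF below_partition[OF nu(1)], of r "Suc r"] assms(2)
    by simp
  have "0 < (\<Sum>r\<in>{1..<n}. pre_diff n lam nu r * ?t r)"
  proof (rule sum_pos2[OF _ r(1)])
    show "0 < pre_diff n lam nu r * ?t r" using r(2) t[OF r(1)] by (rule mult_pos_pos)
    show "0 \<le> pre_diff n lam nu i * ?t i" if "i \<in> {1..<n}" for i
      using t[OF that] by (intro mult_nonneg_nonneg pre_diff_nonneg[OF lam nu(1)]) simp
  qed simp
  then have "complex_of_real (\<Sum>r\<in>{1..<n}. pre_diff n lam nu r * ?t r) \<noteq> 0" unfolding of_real_eq_0_iff by simp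
  then show "eigenvalue n (jack_weight (complex_of_real \<theta>)) nu \<noteq>
      eigenvalue n (jack_weight (complex_of_real \<theta>)) lam"
    unfolding jack_weight_diff[OF lam nu(1), symmetric] by simp
qed

lemma is_partition_jack_lambda:
  assumes n: "n \<ge> 4"
  shows "is_partition n (jack_lambda n)"
proof -
  have "jack_lambda n ! j \<le> jack_lambda n ! i" if "i < j" "j < n" for i j
    using jack_lambda_nth[OF n, of "Suc i"] jack_lambda_nth[OF n, of "Suc j"] that by auto
  then show ?thesis using n by (simp add: is_partition_def sorted_wrt_iff_nth_less length_jack_lambda)
qed

text \<open>
  At \<open>\<theta> = -1/2\<close> the coefficient of the last two prefix sums may be negative, since the last three
  parts of \<open>\<lambda>\<close> coincide; the gap \<open>3\<close> before them compensates.
\<close>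

lemma nondegenerate_jack_lambda:
  assumes n: "n \<ge> 4"
  shows "nondegenerate n (jack_lambda n) (jack_weight (- 1 / 2))"
  unfolding nondegenerate_def
proof (intro ballI impI)
  let ?lam = "jack_lambda n"
  fix nu assume nu: "nu \<in> below n ?lam" "nu \<noteq> ?lam"
  note lam = is_partition_jack_lambda[OF n]
  obtain k where k: "n = k + 4" using n by (metis add.commute le_Suc_ex)
  let ?l = "\<lambda>i. real (lookup (mon_of n ?lam) i)" and ?v = "\<lambda>i. real (lookup (mon_of n nu) i)"
  let ?D = "pre_diff n ?lam nu"
  let ?t = "\<lambda>r. (?l r - ?l (Suc r)) + (?v r - ?v (Suc r)) + 2 * (- 1 / 2)"
  have l: "?l i = (if i \<in> {1..k + 1} then 2 * real (k + 4 - i) - 3 else 0)" for i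
    using jack_lambda_nth[OF n, of i] by (auto simp: lookup_mon_of k)
  have D0: "?D r \<ge> 0" for r by (rule pre_diff_nonneg[OF lam nu(1)])
  have Dstep: "?D (Suc r) = ?D r + ?l (Suc r) - ?v (Suc r)" for r by (simp add: pre_diff_def pre_Suc)
  have v: "?v (Suc r) \<le> ?v r" if "r \<ge> 1" for r
    using that partition_antimono[OF below_partition[OF nu(1)], of r "Suc r"] by simp
  have "pre n (mon_of n nu) = pre n (mon_of n ?lam)"
    using nu(1) dominated_iff[of ?lam n nu] n
    by (simp add: below_def is_partition_def pre_eq_mon_degree[OF keys_mon_of] length_jack_lambda)
  then have Dn: "?D (k + 4) = 0" by (simp add: pre_diff_def k)
  have S: "Suc (k + 1) = k + 2" "Suc (k + 2) = k + 3" "Suc (k + 3) = k + 4" by simp_all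
  have l': "?l (k + 1) = 3" "?l (k + 2) = 0" "?l (k + 3) = 0" "?l (k + 4) = 0" by (simp_all add: l)
  have v': "?v (k + 2) \<le> ?v (k + 1)" "?v (k + 3) \<le> ?v (k + 2)" "?v (k + 4) \<le> ?v (k + 3)"
    using v[of "k + 1"] v[of "k + 2"] v[of "k + 3"] unfolding S by simp_all
  define a b c where "a = ?v (k + 2)" and "b = ?v (k + 3)" and "c = ?v (k + 4)"
  have abc: "0 \<le> c" "c \<le> b" "b \<le> a"
    using v' by (auto simp: a_def b_def c_def)
  \<comment> \<open>The sizes agree and the last three parts of \<lambda> are 0, so the final prefix
    differences are tail sums of \<nu>.\<close>
  have D3: "?D (k + 3) = c" using Dstep[of "k + 3"] unfolding S Dn l' c_def by linarith
  have D2: "?D (k + 2) = b + c" using Dstep[of "k + 2"] unfolding S D3 l' b_def by linarith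
  have D1: "?D (k + 1) = a + b + c" using Dstep[of "k + 1"] unfolding S D2 l' a_def by linarith
  have "{1..<n} = insert (k + 1) (insert (k + 2) (insert (k + 3) {1..<k + 1}))" by (auto simp: k)
  then have split: "(\<Sum>r\<in>{1..<n}. ?D r * ?t r)
     = ?D (k + 1) * ?t (k + 1) + ?D (k + 2) * ?t (k + 2) + ?D (k + 3) * ?t (k + 3) + (\<Sum>r\<in>{1..<k + 1}. ?D r * ?t r)"
    by (simp only:) simp
  \<comment> \<open>The gap 3 of \<lambda> minus 1 leaves 2. The last three terms together are then
    at least 2 (a + b + c) - (b + c) - c = 2 a + b.\<close>
  have "?t (k + 1) \<ge> 2" using v' unfolding S l' by linarith
  then have "?D (k + 1) * ?t (k + 1) \<ge> (a + b + c) * 2" unfolding D1 using abc by (intro mult_left_mono) auto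
  moreover have "?t (k + 2) \<ge> - 1" using v' unfolding S l' by linarith
  then have "?D (k + 2) * ?t (k + 2) \<ge> (b + c) * (- 1)" unfolding D2 using abc by (intro mult_left_mono) auto
  moreover have "?t (k + 3) \<ge> - 1" using v' unfolding S l' by linarith
  then have "?D (k + 3) * ?t (k + 3) \<ge> c * (- 1)" unfolding D3 using abc by (intro mult_left_mono) auto
  moreover have "(\<Sum>r\<in>{1..<k + 1}. ?D r * ?t r) \<ge> (\<Sum>r\<in>{1..<k + 1}. ?D r)"
  proof (rule sum_mono)
    fix r assume r: "r \<in> {1..<k + 1}"
    then have "?l r - ?l (Suc r) = 2" by (auto simp: l of_nat_diff)
    then have "?t r \<ge> 1" using v[of r] r by simp
    then show "?D r \<le> ?D r * ?t r" using D0[of r] mult_left_mono[of 1 "?t r" "?D r"] by simp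
  qed
  ultimately have ge: "(\<Sum>r\<in>{1..<n}. ?D r * ?t r) \<ge> 2 * a + (\<Sum>r\<in>{1..<k + 1}. ?D r)"
    unfolding split using abc by (simp add: algebra_simps)
  obtain r where r: "r \<in> {1..<n}" "?D r > 0" using ex_pre_diff_pos[OF lam nu] .
  have "0 < (\<Sum>r\<in>{1..<n}. ?D r * ?t r)"
  proof (cases "r < k + 1")
    case True
    then have "?D r \<le> (\<Sum>r\<in>{1..<k + 1}. ?D r)" using r D0 by (intro member_le_sum) auto
    then show ?thesis using ge r abc by linarith
  next
    case False
    then have "r = k + 1 \<or> r = k + 2 \<or> r = k + 3" using r(1) k by auto
    \<comment> \<open>Since a bounds b and c, a positive tail sum forces a > 0.\<close>
    then have "a > 0" using r(2) D1 D2 D3 abc by auto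
    moreover have "(\<Sum>r\<in>{1..<k + 1}. ?D r) \<ge> 0" by (intro sum_nonneg D0)
    ultimately show ?thesis using ge by linarith
  qed
  then have "complex_of_real (\<Sum>r\<in>{1..<n}. ?D r * ?t r) \<noteq> 0" unfolding of_real_eq_0_iff by simp
  then have "sum_weight n (jack_weight (complex_of_real (- 1 / 2))) (delta n) (mon_of n ?lam) -
      sum_weight n (jack_weight (complex_of_real (- 1 / 2))) (delta n) (mon_of n nu) \<noteq> 0"
    unfolding jack_weight_diff[OF lam nu(1)] .
  then show "eigenvalue n (jack_weight (- 1 / 2)) nu \<noteq>
      eigenvalue n (jack_weight (- 1 / 2)) ?lam" by simp
qed

section \<open>The operator at \<open>\<theta> = -1/2\<close> preserves the ideal\<close>

text \<open>Expand the square (\<theta> k_i + m_i)^2; k_i and m_i are the eigenvalues of D i on the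
  monomials of the two factors.\<close>

lemma Phi_jack_weight:
  "Phi (sum_weight n (jack_weight \<theta>)) F G = (\<Sum>i\<in>{1..n}. cscale (\<theta> ^ 2) (D i (D i F) * G) +
     cscale (2 * \<theta>) (D i F * D i G) + F * D i (D i G))"
proof (induction F G rule: biadditive_induct)
  case (5 k c m d)
  have sum_single: "(\<Sum>i\<in>I. single N (g i)) = single N (sum g I)" for N :: monomial and g :: "nat \<Rightarrow> complex" and I
    by (induction I rule: infinite_finite_induct) (auto simp: single_add)
  show ?case
    by (simp add: mult_single sum_single sum_weight_def jack_weight_def sum_distrib_left
        power2_eq_square algebra_simps flip: single_add sum.distrib)
qed (simp_all add: Phi_add_left Phi_add_right D_add cscale_add algebra_simps sum.distrib)

section \<open>First and second derivatives on the locus\<close>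

abbreviation (input) locus :: "nat \<Rightarrow> nat" where
  "locus \<equiv> id(2 := 1, 4 := 3)"

lemma D_ren_locus:
  "D 1 (ren locus f) = ren locus (D 1 f + D 2 f)"
  "D 3 (ren locus f) = ren locus (D 3 f + D 4 f)"
  "j \<notin> {1, 2, 3, 4} \<Longrightarrow> D j (ren locus f) = ren locus (D j f)"
proof -
  show "D 1 (ren locus f) = ren locus (D 1 f + D 2 f)"
  proof (induction f rule: mpoly_induct)
    case (var i)
    then show ?case by (auto simp: D_var ren_add)
  qed (auto simp: D_add ren_add ren_mult D_mult algebra_simps)
  show "D 3 (ren locus f) = ren locus (D 3 f + D 4 f)"
  proof (induction f rule: mpoly_induct)
    case (var i)
    then show ?case by (auto simp: D_var ren_add)
  qed (auto simp: D_add ren_add ren_mult D_mult algebra_simps)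
  show "D j (ren locus f) = ren locus (D j f)" if "j \<notin> {1, 2, 3, 4}"
  proof (induction f rule: mpoly_induct)
    case (var i)
    then show ?case using that by (auto simp: D_var ren_add)
  qed (auto simp: D_add ren_add ren_mult D_mult algebra_simps)
qed

text \<open>D 1 + D 2, D 3 + D 4 and D j for the other j are tangent to the locus, so they kill what
  vanishes on it.\<close>

lemma ren_locus_tangent:
  assumes "ren locus g = 0"
  shows "ren locus (D 2 g) = - ren locus (D 1 g)" "ren locus (D 4 g) = - ren locus (D 3 g)"
    "j \<notin> {1, 2, 3, 4} \<Longrightarrow> ren locus (D j g) = 0"
  using D_ren_locus(1)[of g] D_ren_locus(2)[of g] D_ren_locus(3)[of j g] assms
  by (simp_all add: ren_add add_eq_0_iff)

lemma ren_locus_transpose: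
  assumes "t = swap 1 2 \<or> t = swap 3 4"
  shows "ren locus (ren t g) = ren locus g"
proof -
  have "locus \<circ> t = locus"
  proof
    show "(locus \<circ> t) x = locus x" for x
      using assms by (elim disjE) (simp_all add: Transposition.transpose_def)
  qed
  then show ?thesis by (simp add: ren_ren)
qed

text \<open>These transpositions fix the locus pointwise, so symmetry of g relates its derivatives
  at one and the same point. The constant c is 1 for elements of the ideal and -1 for V.\<close>

lemma ren_locus_D_transpose:
  assumes t: "t = swap 1 2 \<or> t = swap 3 4" and "ren t g = cscale c g"
  shows "cscale c (ren locus (D (t i) g)) = ren locus (D i g)"
    "cscale c (ren locus (D (t i) (D (t j) g))) = ren locus (D i (D j g))"
proof -
  have b: "bij t" using t by auto
  have e: "cscale c (D (t i) g) = ren t (D i g)" for i using D_ren_bij[OF b, of i g] assms(2) by simp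
  then show "cscale c (ren locus (D (t i) g)) = ren locus (D i g)"
    using ren_locus_transpose[OF t, of "D i g"] by (metis ren_cscale)
  have "cscale c (D (t i) (D (t j) g)) = ren t (D i (D j g))"
    using e[of j] D_ren_bij[OF b, of i "D j g"] by (metis D_cscale)
  then show "cscale c (ren locus (D (t i) (D (t j) g))) = ren locus (D i (D j g))"
    using ren_locus_transpose[OF t, of "D i (D j g)"] by (metis ren_cscale)
qed

lemma cscale_minus_one: "cscale (- 1) f = - f"
  by (rule poly_mapping_eqI) simp

lemma mpoly_eq_uminus_iff: "(f :: mpoly) = - f \<longleftrightarrow> f = 0" "- f = f \<longleftrightarrow> f = 0"
  using mpoly_eq_uminus_self[of f] by auto

text \<open>
  On the locus \<open>x\<^sub>1 = x\<^sub>2\<close>, \<open>x\<^sub>3 = x\<^sub>4\<close> both an element of the ideal and the Vandermonde polynomial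
  vanish to second order, and symmetry determines their Hessians up to two, respectively one, entries.
\<close>

lemma ideal_I_hessian:
  assumes f: "f \<in> ideal_I n" and n: "n \<ge> 4"
  shows "ren locus (D j f) = 0"
    "j \<notin> {1, 2, 3, 4} \<Longrightarrow> ren locus (D i (D j f)) = 0"
    "ren locus (D 1 (D 3 f)) = 0" "ren locus (D 1 (D 4 f)) = 0" "ren locus (D 2 (D 3 f)) = 0" "ren locus (D 2 (D 4 f)) = 0"
    "ren locus (D 2 (D 2 f)) = ren locus (D 1 (D 1 f))" "ren locus (D 1 (D 2 f)) = - ren locus (D 1 (D 1 f))"
    "ren locus (D 4 (D 4 f)) = ren locus (D 3 (D 3 f))" "ren locus (D 3 (D 4 f)) = - ren locus (D 3 (D 3 f))"
proof -
  let ?t = "swap 1 2" and ?u = "swap 3 4"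
  have f0: "ren locus f = 0" using f by (simp add: ideal_I_iff)
  have "ren ?t f = cscale 1 f" "ren ?u f = cscale 1 f"
    using ideal_I_ren[OF n f transpose_permutes] n by simp_all
  note T = ren_locus_D_transpose[of ?t, OF _ this(1), simplified] and U = ren_locus_D_transpose[of ?u, OF _ this(2), simplified]
  have f1: "ren locus (D j f) = 0" for j
    using ren_locus_tangent[OF f0] T(1)[of 1] U(1)[of 3]
    by (cases "j \<in> {1, 2, 3, 4}") (auto simp: mpoly_eq_uminus_iff)
  then show "ren locus (D j f) = 0" .
  note H = ren_locus_tangent[OF f1]
  show "ren locus (D i (D j f)) = 0" if "j \<notin> {1, 2, 3, 4}" using H(3)[OF that, of i] by (simp add: D_commute)
  \<comment> \<open>Symmetry under exchanging 1 and 2 equates the mixed derivatives D 1 D 3 and D 2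
    D 3, while tangency makes them opposite.\<close>
  show h13: "ren locus (D 1 (D 3 f)) = 0" using T(2)[of 1 3] H(1)[of 3] by (simp add: mpoly_eq_uminus_iff)
  show "ren locus (D 2 (D 3 f)) = 0" using h13 H(1)[of 3] by simp
  show h14: "ren locus (D 1 (D 4 f)) = 0" using h13 H(2)[of 1] by (simp add: D_commute[of 1])
  show "ren locus (D 2 (D 4 f)) = 0" using h14 H(1)[of 4] by simp
  show "ren locus (D 2 (D 2 f)) = ren locus (D 1 (D 1 f))" using T(2)[of 1 1] by simp
  show "ren locus (D 4 (D 4 f)) = ren locus (D 3 (D 3 f))" using U(2)[of 3 3] by simp
  show "ren locus (D 1 (D 2 f)) = - ren locus (D 1 (D 1 f))" using H(1)[of 1] by (simp add: D_commute[of 1 2])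
  show "ren locus (D 3 (D 4 f)) = - ren locus (D 3 (D 3 f))" using H(2)[of 3] by (simp add: D_commute[of 3 4])
qed

lemma ren_locus_vdm: "n \<ge> 4 \<Longrightarrow> ren locus (vdm n) = 0"
proof -
  assume "n \<ge> 4"
  then have t: "ren (swap 1 2) (vdm n) = - vdm n"
    by (intro ren_transpose_vdm) (auto simp: upper_pairs_def)
  have "ren locus (vdm n) = ren locus (ren (swap 1 2) (vdm n))"
    by (simp add: ren_locus_transpose)
  then show ?thesis unfolding t by (simp add: mpoly_eq_uminus_iff)
qed

lemma vdm_hessian:
  assumes n: "n \<ge> 4"
  shows "ren locus (D j (vdm n)) = 0"
    "j \<notin> {1, 2, 3, 4} \<Longrightarrow> ren locus (D i (D j (vdm n))) = 0"
    "ren locus (D 1 (D 1 (vdm n))) = 0" "ren locus (D 1 (D 2 (vdm n))) = 0"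
    "ren locus (D 3 (D 3 (vdm n))) = 0" "ren locus (D 3 (D 4 (vdm n))) = 0"
    "ren locus (D 2 (D 3 (vdm n))) = - ren locus (D 1 (D 3 (vdm n)))"
    "ren locus (D 1 (D 4 (vdm n))) = - ren locus (D 1 (D 3 (vdm n)))"
    "ren locus (D 1 (D 3 (vdm n))) \<noteq> 0"
proof -
  let ?t = "swap 1 2" and ?u = "swap 3 4" and ?V = "vdm n"
  have "ren ?t ?V = cscale (- 1) ?V" "ren ?u ?V = cscale (- 1) ?V"
    unfolding cscale_minus_one by (intro ren_transpose_vdm; use n in \<open>auto simp: upper_pairs_def\<close>)+
  note T = ren_locus_D_transpose[of ?t, OF _ this(1), simplified] and U = ren_locus_D_transpose[of ?u, OF _ this(2), simplified]
  have f1: "ren locus (D j ?V) = 0" for j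
  proof (cases "j \<in> {1, 2}")
    case True
    then have "?u j = j" by (auto simp: Transposition.transpose_def)
    then show ?thesis using U(1)[of j] by (simp add: cscale_minus_one mpoly_eq_uminus_iff)
  next
    case False
    then have "?t j = j" by (auto simp: Transposition.transpose_def)
    then show ?thesis using T(1)[of j] by (simp add: cscale_minus_one mpoly_eq_uminus_iff)
  qed
  then show "ren locus (D j ?V) = 0" .
  note H = ren_locus_tangent[OF f1]
  show "ren locus (D i (D j ?V)) = 0" if "j \<notin> {1, 2, 3, 4}" using H(3)[OF that, of i] by (simp add: D_commute)
  \<comment> \<open>Exchanging 3 and 4 leaves D 1 and D 2 alone but negates V, so this entry equals
    its own negative. The next three entries follow in the same way, the last two from the exchange
    of 1 and 2.\<close>
  show "ren locus (D 1 (D 1 ?V)) = 0" using U(2)[of 1 1] by (simp add: cscale_minus_one mpoly_eq_uminus_iff)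
  show "ren locus (D 1 (D 2 ?V)) = 0" using U(2)[of 1 2] by (simp add: cscale_minus_one mpoly_eq_uminus_iff)
  show "ren locus (D 3 (D 3 ?V)) = 0" using T(2)[of 3 3] by (simp add: cscale_minus_one mpoly_eq_uminus_iff)
  show "ren locus (D 3 (D 4 ?V)) = 0" using T(2)[of 3 4] by (simp add: cscale_minus_one mpoly_eq_uminus_iff)
  show "ren locus (D 2 (D 3 ?V)) = - ren locus (D 1 (D 3 ?V))" using H(1)[of 3] .
  show "ren locus (D 1 (D 4 ?V)) = - ren locus (D 1 (D 3 ?V))" using H(2)[of 1] by (simp add: D_commute[of 1])
  \<comment> \<open>Each of the two vanishing factors must be differentiated once: on the locus, D 1
    D 3 of (x_1 - x_2)(x_3 - x_4) Y is x_1 x_3 Y.\<close>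
  let ?P = "upper_pairs {1..n} - {(1, 2), (3, 4)}"
  define Y where "Y = (\<Prod>p\<in>?P. var (fst p) - var (snd p))"
  have sub: "{(1, 2), (3, 4)} \<subseteq> upper_pairs {1..n}" using n by (auto simp: upper_pairs_def)
  have "?V = (\<Prod>p\<in>{(1, 2), (3, 4)}. var (fst p) - var (snd p)) * Y"
    unfolding vdm_def Y_def by (simp add: prod.subset_diff[OF sub] mult.commute)
  then have V: "?V = (var 1 - var 2) * ((var 3 - var 4) * Y)" by simp
  have "ren locus Y \<noteq> 0" unfolding Y_def
    by (rule ren_diff_var_prod_nonzero) (auto simp: upper_pairs_def split: if_splits)
  moreover have "ren locus (D 1 (D 3 ?V)) = var 1 * var 3 * ren locus Y"
    unfolding V by (simp add: D_mult D_var D_add ren_mult ren_add)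
  ultimately show "ren locus (D 1 (D 3 ?V)) \<noteq> 0" by simp
qed

lemma ren_locus_D13_mult:
  "ren locus (D 1 (D 3 (f * g))) = ren locus (D 1 (D 3 f)) * ren locus g + ren locus (D 1 f) * ren locus (D 3 g)
     + ren locus (D 3 f) * ren locus (D 1 g) + ren locus f * ren locus (D 1 (D 3 g))"
  by (simp add: D_mult D_add ren_add ren_mult algebra_simps)

text \<open>For i = 1, ..., 4 the cross term T_i equals c times D_i^2 f on the locus, so together
  they carry the factor 2 \<theta> + 1 = 0. The \<theta>^2 term dies because f, D 1 f, D 3 f and D 1
  D 3 f all vanish there.\<close>

lemma ren_locus_Phi:
  assumes f: "f \<in> ideal_I n" and n: "n \<ge> 4"
  shows "ren locus (D 1 (D 3 (Phi (sum_weight n (jack_weight (- 1 / 2))) (vdm n) f))) = 0"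
proof -
  let ?V = "vdm n" and ?R = "ren locus"
  note Hf = ideal_I_hessian[OF f n] and HV = vdm_hessian[OF n]
  have f0: "?R f = 0" using f by (simp add: ideal_I_iff)
  have V0: "?R ?V = 0" using n by (rule ren_locus_vdm)
  define c where "c = ?R (D 1 (D 3 ?V))"
  define a where "a = ?R (D 1 (D 1 f))"
  define b where "b = ?R (D 3 (D 3 f))"
  define T where "T i = ?R (D 1 (D i ?V)) * ?R (D 3 (D i f)) + ?R (D 3 (D i ?V)) * ?R (D 1 (D i f))" for i
  define S where "S i = cscale (- 1) (T i) + c * ?R (D i (D i f))" for i
  have 1: "?R (D 1 (D 3 (D i (D i ?V) * f))) = 0" for i
    unfolding ren_locus_D13_mult by (simp add: Hf f0)
  have 2: "?R (D 1 (D 3 (D i ?V * D i f))) = T i" for i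
    unfolding ren_locus_D13_mult by (simp add: Hf HV T_def)
  have 3: "?R (D 1 (D 3 (?V * D i (D i f)))) = c * ?R (D i (D i f))" for i
    unfolding ren_locus_D13_mult by (simp add: HV V0 c_def)
  have "?R (D 1 (D 3 (Phi (sum_weight n (jack_weight (- 1 / 2))) ?V f))) = (\<Sum>i\<in>{1..n}. S i)"
    unfolding Phi_jack_weight D_sum ren_sum D_add ren_add D_cscale ren_cscale 1 2 3 S_def by simp
  also have "\<dots> = (\<Sum>i\<in>{1, 2, 3, 4}. S i)"
  proof (rule sum.mono_neutral_right)
    show "\<forall>i\<in>{1..n} - {1, 2, 3, 4}. S i = 0" by (simp add: S_def T_def Hf HV)
  qed (use n in auto)
  also have "\<dots> = S 1 + (S 2 + (S 3 + S 4))" by simp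
  also have "S 1 = - (c * a) + c * a"
    using HV(3) D_commute[of 3 1 ?V] D_commute[of 3 1 f] Hf(3)
    by (simp add: S_def T_def cscale_minus_one c_def a_def)
  also have "S 2 = - (c * a) + c * a"
    using HV D_commute[of 3 2 ?V] D_commute[of 3 2 f] Hf
    by (simp add: S_def T_def cscale_minus_one c_def a_def)
  also have "S 3 = - (c * b) + c * b"
    using HV Hf by (simp add: S_def T_def cscale_minus_one c_def b_def)
  also have "S 4 = - (c * b) + c * b"
    using HV Hf by (simp add: S_def T_def cscale_minus_one c_def b_def)
  also have "- (c * a) + c * a + (- (c * a) + c * a + (- (c * b) + c * b + (- (c * b) + c * b))) = 0" by simp
  finally show ?thesis .
qed

lemma vdm_dvd_antisymmetric:
  assumes "\<And>i j. (i, j) \<in> upper_pairs {1..n} \<Longrightarrow> ren (swap i j) X = - X"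
  shows "vdm n dvd X"
proof -
  have "(var i - var j) ^ 1 dvd X" if ij: "(i, j) \<in> upper_pairs {1..n}" for i j
  proof -
    have "ren (id(j := i)) X = ren (id(j := i)) (ren (swap i j) X)"
      by (simp add: ren_ren merge_comp_transpose)
    then have "ren (id(j := i)) X = - ren (id(j := i)) X" unfolding assms[OF ij] by simp
    then show ?thesis by (simp add: diff_var_dvd_iff mpoly_eq_uminus_iff)
  qed
  then have "(\<Prod>p\<in>upper_pairs {1..n}. (var (fst p) - var (snd p)) ^ 1) dvd X"
    by (rule prod_diff_var_power_dvd[where e = "\<lambda>_. 1", rotated 2]) (auto, auto simp: upper_pairs_def)
  then show ?thesis by (simp add: vdm_def)
qed

text \<open>Antisymmetry makes \<open>Phi\<close> divisible by V. As V and its first derivatives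
  vanish on the locus, D 1 D 3 of V g reduces there to g times the nonzero D 1 D 3 V, which turns
  \<open>ren_locus_Phi\<close> into the vanishing of g.\<close>

lemma Phi_jack_weight_in_ideal:
  assumes f: "f \<in> ideal_I n" "homogeneous d f" and n: "n \<ge> 4"
  obtains g where "g \<in> ideal_I n" "homogeneous d g"
    "Phi (\<lambda>k m. sum_weight n (jack_weight (- 1 / 2)) k m - E) (vdm n) f = vdm n * g"
proof -
  let ?V = "vdm n" and ?w = "jack_weight (- 1 / 2)"
  let ?X = "Phi (\<lambda>k m. sum_weight n ?w k m - E) ?V f"
  have sym: "ren s f = f" if "s permutes {1..n}" for s using ideal_I_ren[OF n f(1) that] .
  have "?V dvd ?X"
  proof (rule vdm_dvd_antisymmetric)
    fix i j assume ij: "(i, j) \<in> upper_pairs {1..n}"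
    then have t: "swap i j permutes {1..n}"
      by (intro transpose_permutes) (auto simp: upper_pairs_def)
    show "ren (swap i j) ?X = - ?X"
      unfolding ren_Phi_vdm[OF t sym[OF t]] ren_transpose_vdm[OF ij] by (rule Phi_uminus_left)
  qed
  then obtain g where g: "?X = ?V * g" by (rule dvdE)
  have hom: "homogeneous d g"
  proof (cases "?X = 0")
    case True
    then show ?thesis using g by simp
  next
    case False
    then show ?thesis
      using homogeneous_mult_cancel(2)[of _ ?V g] homogeneous_Phi[OF homogeneous_vdm f(2)] homogeneous_vdm g
      by (metis diff_add_inverse)
  qed
  have "f \<in> mpolys n" using f(1) by (simp add: ideal_I_iff sym_polys_iff)
  then have "?V * g \<in> mpolys n" unfolding g[symmetric] by (intro mpolys_Phi mpolys_vdm)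
  then have "g \<in> mpolys n" using mpolys_mult_cancel[OF _ mpolys_vdm] n by simp
  moreover have "ren s g = g" if s: "s permutes {1..n}" for s
  proof -
    have "ren s ?V * ren s g = Phi (\<lambda>k m. sum_weight n ?w k m - E) (ren s ?V) f"
      unfolding ren_mult[symmetric] g[symmetric] by (rule ren_Phi_vdm[OF s sym[OF s]])
    moreover have "Phi (\<lambda>k m. sum_weight n ?w k m - E) (ren s ?V) f = ren s ?V * g"
      using ren_vdm[OF s]
    proof
      assume v: "ren s ?V = ?V"
      show ?thesis unfolding v by (rule g)
    next
      assume v: "ren s ?V = - ?V"
      show ?thesis unfolding v Phi_uminus_left g by simp
    qed
    ultimately have "ren s ?V * ren s g = ren s ?V * g" by (rule trans)
    moreover have "ren s ?V \<noteq> 0" using ren_vdm[OF s] by auto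
    ultimately show ?thesis by simp
  qed
  moreover have "ren locus g = 0"
  proof -
    have prod: "ren locus (D 1 (D 3 (?V * h))) = ren locus (D 1 (D 3 ?V)) * ren locus h" for h
      unfolding ren_locus_D13_mult using vdm_hessian[OF n] ren_locus_vdm[OF n] by simp
    have "ren locus (D 1 (D 3 ?X)) = 0"
      unfolding Phi_diff_weight using ren_locus_Phi[OF f(1) n] prod[of f] f(1) by (simp add: ideal_I_iff)
    then show ?thesis unfolding g prod using vdm_hessian(9)[OF n] by simp
  qed
  ultimately have "g \<in> ideal_I n" by (simp add: ideal_I_iff sym_polys_iff)
  then show ?thesis using hom g by (rule that)
qed

lemma lead_Q_poly: "n \<ge> 4 \<Longrightarrow> lead (mon_of n (jack_lambda n)) (lookup (Q_poly n) (mon_of n (jack_lambda n))) (Q_poly n)"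
  by (simp add: lead_def pre_Q_poly)

lemma Q_poly_nonzero: "n \<ge> 4 \<Longrightarrow> Q_poly n \<noteq> 0"
  using lookup_Q_poly_jack_lambda[of n] by auto

text \<open>Uniqueness in minimal degree makes the left side c V Q for some constant c. Its
  coefficient at \<delta> + \<lambda> carries the factor eigenvalue minus E, which is 0, while V Q
  has a nonzero coefficient there; hence c = 0.\<close>

lemma Phi_Q_poly:
  assumes n: "n \<ge> 4"
  defines "E \<equiv> eigenvalue n (jack_weight (- 1 / 2)) (jack_lambda n)"
  shows "Phi (\<lambda>k m. sum_weight n (jack_weight (- 1 / 2)) k m - E) (vdm n) (Q_poly n) = 0"
proof -
  let ?w = "jack_weight (- 1 / 2)" and ?lam = "jack_lambda n"
  let ?N = "delta n + mon_of n ?lam"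
  note lam = is_partition_jack_lambda[OF n]
  obtain g where g: "g \<in> ideal_I n" "homogeneous (min_deg n) g"
    "Phi (\<lambda>k m. sum_weight n ?w k m - E) (vdm n) (Q_poly n) = vdm n * g"
    using Phi_jack_weight_in_ideal[OF Q_poly_ideal_I[OF n] homogeneous_Q_poly[OF n] n] .
  obtain c where c: "g = cscale c (Q_poly n)"
    using ideal_I_min_degree_unique[OF n g(1,2) Q_poly_ideal_I[OF n] homogeneous_Q_poly[OF n] Q_poly_nonzero[OF n]] .
  have X: "Phi (\<lambda>k m. sum_weight n ?w k m - E) (vdm n) (Q_poly n) = cscale c (vdm n * Q_poly n)"
    unfolding g(3) c by (simp add: cscale_def algebra_simps)
  have "lookup (Phi (\<lambda>k m. sum_weight n ?w k m - E) (vdm n) (Q_poly n)) ?N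
     = lookup (vdm n) (delta n) * lookup (Q_poly n) (mon_of n ?lam) * (eigenvalue n ?w ?lam - E)"
    unfolding lookup_Phi
  proof (rule sum_keys_unique)
    fix k m assume km: "k \<in> keys (vdm n)" "m \<in> keys (Q_poly n)" "k + m = ?N"
    show "k = delta n \<and> m = mon_of n ?lam"
      using pre_add_eq_cancel[OF km(3) pre_vdm[OF km(1)] pre_Q_poly[OF n km(2)]] by simp
  qed
  then have "lookup (Phi (\<lambda>k m. sum_weight n ?w k m - E) (vdm n) (Q_poly n)) ?N = 0" by (simp add: E_def)
  then have "c * lookup (vdm n * Q_poly n) ?N = 0" unfolding X by simp
  moreover have "lookup (vdm n * Q_poly n) ?N = lookup (Q_poly n) (mon_of n ?lam)"
    using lead_mult[OF lead_vdm lead_Q_poly[OF n]] by (simp add: lead_def)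
  ultimately have "c = 0" using lookup_Q_poly_jack_lambda[OF n] by simp
  then show ?thesis unfolding X by simp
qed

lemma jack_eq_Q_poly:
  assumes n: "n \<ge> 4"
  shows "jack_well_defined n (jack_lambda n) (- 1 / 2)"
    "Q_poly n = cscale (lookup (Q_poly n) (mon_of n (jack_lambda n))) (jack n (jack_lambda n) (- 1 / 2))"
proof -
  let ?lam = "jack_lambda n" and ?w = "jack_weight (- 1 / 2)"
  note lam = is_partition_jack_lambda[OF n] and nd = nondegenerate_jack_lambda[OF n]
  note J = jack_eq_solution[OF lam nondegenerate_pos[OF lam] nd]
  show "jack_well_defined n ?lam (- 1 / 2)" using J(1) .
  let ?c = "lookup (Q_poly n) (mon_of n ?lam)"
  let ?u = "\<lambda>mu. lookup (Q_poly n) (mon_of n mu)"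
  have c0: "?c \<noteq> 0" using lookup_Q_poly_jack_lambda[OF n] .
  then have "mon_of n ?lam \<in> keys (Q_poly n)" by (simp add: in_keys_iff)
  then have "mon_degree (mon_of n ?lam) = min_deg n"
    using homogeneous_Q_poly[OF n] by (simp add: homogeneous_def)
  then have Q: "Q_poly n = msum n ?lam ?u"
    using sym_polys_Q_poly[OF n] lam homogeneous_Q_poly[OF n] pre_Q_poly[OF n] by (intro sym_eq_msum) auto
  have m: "msum n ?lam (\<lambda>mu. ?u mu / ?c) = cscale (1 / ?c) (msum n ?lam ?u)"
    unfolding msum_def cscale_def sum_distrib_left by (simp add: mult_single flip: mult.assoc)
  have "Phi (\<lambda>k m. sum_weight n ?w k m - eigenvalue n ?w ?lam) (vdm n) (msum n ?lam (\<lambda>mu. ?u mu / ?c)) = 0"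
    unfolding m Phi_cscale_right Q[symmetric] Phi_Q_poly[OF n] by simp
  then have "msum n ?lam (\<lambda>mu. ?u mu / ?c) = msum n ?lam (solution n ?lam ?w)"
    using Phi_eq_zero_imp_solution[OF nd] c0 by (intro msum_cong) simp
  then have "jack n ?lam (- 1 / 2) = cscale (1 / ?c) (Q_poly n)" using J(2) m Q by simp
  then show "Q_poly n = cscale ?c (jack n ?lam (- 1 / 2))" using c0 by simp
qed

section \<open>The ring of symmetric polynomials\<close>

lemma sym_polys_closed:
  "0 \<in> sym_polys n" "1 \<in> sym_polys n"
  "f \<in> sym_polys n \<Longrightarrow> g \<in> sym_polys n \<Longrightarrow> f + g \<in> sym_polys n"
  "f \<in> sym_polys n \<Longrightarrow> g \<in> sym_polys n \<Longrightarrow> f * g \<in> sym_polys n"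
  "f \<in> sym_polys n \<Longrightarrow> - f \<in> sym_polys n"
  by (auto simp: sym_polys_iff mpolys_add mpolys_mult mpolys_uminus ren_add ren_mult)

lemma ring_sym_ring: "ring (sym_ring n)"
proof (rule ringI)
  show "abelian_group (sym_ring n)"
  proof (rule abelian_groupI)
    fix f assume "f \<in> carrier (sym_ring n)"
    then show "\<exists>g\<in>carrier (sym_ring n). g \<oplus>\<^bsub>sym_ring n\<^esub> f = \<zero>\<^bsub>sym_ring n\<^esub>"
      by (intro bexI[of _ "- f"]) (auto simp: sym_ring_def sym_polys_closed)
  qed (auto simp: sym_ring_def sym_polys_closed algebra_simps)
  show "monoid (sym_ring n)"
    by (rule monoidI) (auto simp: sym_ring_def sym_polys_closed algebra_simps)
qed (auto simp: sym_ring_def algebra_simps)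

lemma ideal_sym_ringI:
  assumes "S \<subseteq> sym_polys n" "0 \<in> S" "\<And>f g. f \<in> S \<Longrightarrow> g \<in> S \<Longrightarrow> f + g \<in> S"
    "\<And>f. f \<in> S \<Longrightarrow> - f \<in> S" "\<And>f g. f \<in> S \<Longrightarrow> g \<in> sym_polys n \<Longrightarrow> g * f \<in> S"
  shows "ideal S (sym_ring n)"
proof (rule idealI[OF ring_sym_ring])
  interpret ring "sym_ring n" by (rule ring_sym_ring)
  have inv: "inv\<^bsub>add_monoid (sym_ring n)\<^esub> f = - f" if "f \<in> S" for f
    unfolding a_inv_def[symmetric]
    using that assms(1) by (intro minus_equality) (auto simp: sym_ring_def sym_polys_closed)
  show "subgroup S (add_monoid (sym_ring n))"
    by (rule subgroup.intro) (use assms inv in \<open>auto simp: sym_ring_def\<close>)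
qed (use assms in \<open>auto simp: sym_ring_def mult.commute\<close>)

lemma ideal_ideal_I: "ideal (ideal_I n) (sym_ring n)"
  by (rule ideal_sym_ringI) (auto simp: ideal_I_iff sym_polys_closed ren_add ren_mult)

text \<open>Multiplication never lowers the degrees of monomials. For d = \<open>min_deg n\<close>
  this ideal would contain any generating set whose members all have larger degree, yet it misses
  Q.\<close>

lemma ideal_I_degree_gt: "ideal {f \<in> ideal_I n. \<forall>m\<in>keys f. d < mon_degree m} (sym_ring n)"
proof (rule ideal_sym_ringI)
  fix f g assume f: "f \<in> {f \<in> ideal_I n. \<forall>m\<in>keys f. d < mon_degree m}"
  { assume "g \<in> {f \<in> ideal_I n. \<forall>m\<in>keys f. d < mon_degree m}"
    then show "f + g \<in> {f \<in> ideal_I n. \<forall>m\<in>keys f. d < mon_degree m}"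
      using f keys_add[of f g] by (auto simp: ideal_I_iff sym_polys_closed ren_add) }
  show "- f \<in> {f \<in> ideal_I n. \<forall>m\<in>keys f. d < mon_degree m}"
    using f by (auto simp: ideal_I_iff sym_polys_closed in_keys_iff)
  assume g: "g \<in> sym_polys n"
  have "d < mon_degree m" if m: "m \<in> keys (g * f)" for m
  proof -
    obtain k l where "m = k + l" "l \<in> keys f" using m keys_mult[of g f] by blast
    then show ?thesis using f by (auto simp: mon_degree_add intro: less_le_trans)
  qed
  then show "g * f \<in> {f \<in> ideal_I n. \<forall>m\<in>keys f. d < mon_degree m}"
    using f g by (auto simp: ideal_I_iff sym_polys_closed ren_mult)
qed (auto simp: ideal_I_iff sym_polys_closed)

lemma ideal_I_generators:
  assumes n: "n \<ge> 4" and G: "G \<subseteq> ideal_I n" "\<forall>g\<in>G. g \<noteq> 0 \<and> (\<exists>d. homogeneous d g)"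
    and gen: "Idl\<^bsub>sym_ring n\<^esub> G = ideal_I n"
  shows "\<exists>g\<in>G. total_degree g = min_deg n" "\<forall>g\<in>G. min_deg n \<le> total_degree g"
proof -
  have deg: "homogeneous (total_degree g) g" if "g \<in> G" for g
    using that G(2) total_degree_homogeneous by metis
  then show ge: "\<forall>g\<in>G. min_deg n \<le> total_degree g"
    using G ideal_I_min_degree[OF n] by (meson subsetD)
  show "\<exists>g\<in>G. total_degree g = min_deg n"
  proof (rule ccontr)
    assume "\<not> (\<exists>g\<in>G. total_degree g = min_deg n)"
    then have gt: "min_deg n < total_degree g" if "g \<in> G" for g using ge that by (metis le_neq_implies_less)
    let ?K = "{f \<in> ideal_I n. \<forall>m\<in>keys f. min_deg n < mon_degree m}"
    interpret ring "sym_ring n" by (rule ring_sym_ring)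
    have "G \<subseteq> ?K" using G(1) gt deg by (auto simp: homogeneous_def)
    then have "Idl\<^bsub>sym_ring n\<^esub> G \<subseteq> ?K" by (rule genideal_minimal[OF ideal_I_degree_gt])
    then have "Q_poly n \<in> ?K" using gen Q_poly_ideal_I[OF n] by auto
    moreover have "mon_of n (jack_lambda n) \<in> keys (Q_poly n)"
      using lookup_Q_poly_jack_lambda[OF n] by (simp add: in_keys_iff)
    ultimately show False using homogeneous_Q_poly[OF n] by (auto simp: homogeneous_def)
  qed
qed

theorem mainTheorem5:
  fixes n :: nat
  assumes "n \<ge> 4"
  shows "ideal (ideal_I n) (sym_ring n)
    \<and> int (min_deg n) = int n ^ 2 - 4 * int n + 3
    \<and> (\<exists>f\<in>ideal_I n. f \<noteq> 0 \<and> homogeneous (min_deg n) f)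
    \<and> (\<forall>f\<in>ideal_I n. \<forall>d. f \<noteq> 0 \<and> homogeneous d f \<longrightarrow> min_deg n \<le> d)
    \<and> (\<forall>G \<subseteq> ideal_I n.
          (\<forall>g\<in>G. g \<noteq> 0 \<and> (\<exists>d. homogeneous d g)) \<and> Idl\<^bsub>sym_ring n\<^esub> G = ideal_I n \<longrightarrow>
          (\<exists>g\<in>G. total_degree g = min_deg n) \<and> (\<forall>g\<in>G. min_deg n \<le> total_degree g))
    \<and> jack_well_defined n (jack_lambda n) (- 1 / 2)
    \<and> jack n (jack_lambda n) (- 1 / 2) \<noteq> 0
    \<and> {f \<in> ideal_I n. homogeneous (min_deg n) f} = range (\<lambda>c. cscale c (jack n (jack_lambda n) (- 1 / 2)))
    \<and> Q_poly n \<in> ideal_I n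
    \<and> total_degree (Q_poly n) = min_deg n
    \<and> (\<exists>c. c \<noteq> 0 \<and> Q_poly n = cscale c (jack n (jack_lambda n) (- 1 / 2)))"
proof (intro conjI)
  let ?J = "jack n (jack_lambda n) (- 1 / 2)" and ?c = "lookup (Q_poly n) (mon_of n (jack_lambda n))"
  note Q = Q_poly_ideal_I[OF assms] homogeneous_Q_poly[OF assms] Q_poly_nonzero[OF assms]
  have c: "?c \<noteq> 0" using lookup_Q_poly_jack_lambda[OF assms] .
  have QJ: "Q_poly n = cscale ?c ?J" using jack_eq_Q_poly(2)[OF assms] .
  have J: "?J = cscale (1 / ?c) (Q_poly n)" using c by (subst QJ) simp
  show "ideal (ideal_I n) (sym_ring n)" by (rule ideal_ideal_I)
  obtain k where "n = k + 4" using assms by (metis add.commute le_Suc_ex)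
  then show "int (min_deg n) = int n ^ 2 - 4 * int n + 3"
    by (simp add: min_deg_def power2_eq_square algebra_simps)
  show "\<exists>f\<in>ideal_I n. f \<noteq> 0 \<and> homogeneous (min_deg n) f" using Q by blast
  show "\<forall>f\<in>ideal_I n. \<forall>d. f \<noteq> 0 \<and> homogeneous d f \<longrightarrow> min_deg n \<le> d"
    using ideal_I_min_degree[OF assms] by blast
  show "\<forall>G \<subseteq> ideal_I n.
      (\<forall>g\<in>G. g \<noteq> 0 \<and> (\<exists>d. homogeneous d g)) \<and> Idl\<^bsub>sym_ring n\<^esub> G = ideal_I n \<longrightarrow>
      (\<exists>g\<in>G. total_degree g = min_deg n) \<and> (\<forall>g\<in>G. min_deg n \<le> total_degree g)"
    using ideal_I_generators[OF assms] by blast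
  show "jack_well_defined n (jack_lambda n) (- 1 / 2)" by (rule jack_eq_Q_poly(1)[OF assms])
  show "?J \<noteq> 0" using QJ Q(3) by auto
  show "{f \<in> ideal_I n. homogeneous (min_deg n) f} = range (\<lambda>c. cscale c ?J)"
  proof (intro equalityI subsetI)
    fix f assume "f \<in> {f \<in> ideal_I n. homogeneous (min_deg n) f}"
    then obtain a where "f = cscale a (Q_poly n)" using ideal_I_min_degree_unique[OF assms _ _ Q] by blast
    then have "f = cscale (a * ?c) ?J" by (subst (asm) QJ) simp
    then show "f \<in> range (\<lambda>c. cscale c ?J)" by blast
  next
    fix f assume "f \<in> range (\<lambda>c. cscale c ?J)"
    then obtain a where "f = cscale a (cscale (1 / ?c) (Q_poly n))" using J by auto
    then show "f \<in> {f \<in> ideal_I n. homogeneous (min_deg n) f}"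
      using Q by (auto intro: ideal_I_cscale homogeneous_cscale)
  qed
  show "Q_poly n \<in> ideal_I n" by (rule Q)
  show "total_degree (Q_poly n) = min_deg n" using total_degree_homogeneous Q by blast
  show "\<exists>c. c \<noteq> 0 \<and> Q_poly n = cscale c ?J" using c QJ by blast
qed

end
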